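(* Let $\Omega=[0,1]$, $T>0$, $p\in(1,+\infty)$, let $K:\Omega^2\to[0,1]$ be a symmetric measurable function and let $g\in L^\infty(\Omega)$. Let $u$ be the solution in $[0,T]$ of $u_t=-\boldsymbol{\Delta}_p^{K}(u)$, $u(\cdot,0)=g$, and let $\check u_n$ be the space-time interpolation of the fully discrete $p$-Laplacian evolution on the weighted graph $K/\mathcal Q_n$. Then $$\|u-\check u_n\|_{C(0,T;L^p(\Omega))}\longrightarrow0\quad\text{as } n\to\infty,\ \tau\to0.$$
   Context: $\boldsymbol{\Delta}_p^{K}(u)(x)=-\int_\Omega K(x,y)|u(y)-u(x)|^{p-2}(u(y)-u(x))\,dy$. A solution in $[0,T]$ is a function in $W^{1,1}(0,T;L^1(\Omega))$ satisfying the initial condition a.e. and the equation a.e. in $\Omega\times(0,T)$. Let $[n]=\{1,\dots,n\}$, $\Omega_i^{(n)}=[\frac{i-1}{n},\frac in)$. The weighted graph $K/\mathcal Q_n$ has vertex set $[n]$, edge set $[n]\times[n]$ and weights $(\hat K_n)_{ij}=n^2\int_{\Omega_i^{(n)}\times\Omega_j^{(n)}}K(x,y)\,dx\,dy$. Initial data: $g_i^0=n\int_{\Omega_i^{(n)}}g(x)\,dx$. Let $0=t_0<\dots<t_N=T$ be a (not necessarily uniform) partition, $\tau_{h-1}=|t_h-t_{h-1}|$, $\tau=\max_h\tau_h$. The values $u_i^h$ satisfy $u_i^0=g_i^0$ and $$\frac{u_i^h-u_i^{h-1}}{\tau_{h-1}}=\frac1n\sum_{j=1}^n(\hat K_n)_{ij}|u_j^{h-1}-u_i^{h-1}|^{p-2}(u_j^{h-1}-u_i^{h-1}),\quad(i,h)\in[n]\times[N].$$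 Then $\check u_n(x,t)=\frac{t_h-t}{\tau_{h-1}}u_i^{h-1}+\frac{t-t_{h-1}}{\tau_{h-1}}u_i^h$ for $x\in\Omega_i^{(n)}$, $t\in(t_{h-1},t_h]$, and $\check u_n(x,0)=g_i^0$ for $x\in\Omega_i^{(n)}$. $\|w\|_{C(0,T;L^p(\Omega))}=\sup_{t\in[0,T]}\|w(\cdot,t)\|_{L^p(\Omega)}$.
   Formalization: A solution is also required to have K(x,y)|u(y,t)-u(x,t)|^{p-1} integrable over Ω×Ω for a.e. t (automatic for p≤2 and for bounded u); without this, for p>3, solutions with g=0 are not unique and the claim fails for some of them. *)

theory Defs
  imports "HOL-Analysis.Analysis"
begin

text \<open>
  The domain is \<open>[0,1]\<close>. Measurability, integrals and almost-everywhere statements refer to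
  Lebesgue measure throughout. Functions on \<open>\<Omega> \<times> I\<close> are curried, space variable first.
\<close>

definition Om :: "real set" where
  "Om = {0..1}"

abbreviation OmM :: "real measure" where
  "OmM \<equiv> lebesgue_on Om"


section \<open>Kernels, data and the nonlocal operator\<close>

definition symmetric_kernel :: "(real \<Rightarrow> real \<Rightarrow> real) \<Rightarrow> bool" where
  "symmetric_kernel K \<longleftrightarrow>
     (\<lambda>(x, y). K x y) \<in> borel_measurable (lebesgue_on (Om \<times> Om)) \<and>
     (\<forall>x\<in>Om. \<forall>y\<in>Om. 0 \<le> K x y \<and> K x y \<le> 1 \<and> K x y = K y x)"

definition Linfty :: "(real \<Rightarrow> real) \<Rightarrow> bool" where
  "Linfty g \<longleftrightarrow> g \<in> borel_measurable OmM \<and> (\<exists>M. AE x in OmM. \<bar>g x\<bar> \<le> M)"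

text \<open>\<open>|r|\<^sup>p\<^sup>-\<^sup>2 r\<close>, which is \<open>0\<close> at \<open>r = 0\<close> for every \<open>p > 1\<close>.\<close>

definition phi :: "real \<Rightarrow> real \<Rightarrow> real" where
  "phi p r = \<bar>r\<bar> powr (p - 2) * r"

definition nonlocal_plap ::
  "(real \<Rightarrow> real \<Rightarrow> real) \<Rightarrow> real \<Rightarrow> (real \<Rightarrow> real) \<Rightarrow> real \<Rightarrow> real" where
  "nonlocal_plap K p f x = - (\<integral>y. K x y * phi p (f y - f x) \<partial>OmM)"

text \<open>
  Since the Bochner integral of a non-integrable function is \<open>0\<close> by convention, the functions
  on which the operator is meaningful have to be singled out. Absolute integrability over
  \<open>\<Omega> \<times> \<Omega>\<close> holds for every \<open>f \<in> L\<^sup>1(\<Omega>)\<close> if \<open>p \<le> 2\<close> and for every \<open>f \<in> L\<^sup>p\<^sup>-\<^sup>1(\<Omega>)\<close> if \<open>p > 2\<close>;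
  it makes the operator take values in \<open>L\<^sup>1(\<Omega>)\<close>. Integrability in \<open>y\<close> alone, for almost every
  \<open>x\<close>, would not suffice: for large \<open>p\<close> it admits solutions of the evolution problem with zero
  initial data that receive mass from infinity.
\<close>

definition plap_domain ::
  "(real \<Rightarrow> real \<Rightarrow> real) \<Rightarrow> real \<Rightarrow> (real \<Rightarrow> real) \<Rightarrow> bool" where
  "plap_domain K p f \<longleftrightarrow>
     integrable (lebesgue_on (Om \<times> Om)) (\<lambda>(x, y). K x y * phi p (f y - f x))"


section \<open>The space \<open>W\<^sup>1\<^sup>,\<^sup>1(0,T;L\<^sup>1(\<Omega>))\<close> and solutions\<close>

text \<open>\<open>C\<^sub>c\<^sup>\<infinity>(0,T)\<close>; the support is automatically compact, being closed and bounded.\<close>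

definition test_function :: "real \<Rightarrow> (real \<Rightarrow> real) \<Rightarrow> bool" where
  "test_function T \<eta> \<longleftrightarrow>
     (\<forall>k. (deriv ^^ k) \<eta> differentiable_on UNIV) \<and> closure {t. \<eta> t \<noteq> 0} \<subseteq> {0<..<T}"

text \<open>
  \<open>W11 T u v\<close>: \<open>u\<close> belongs to \<open>W\<^sup>1\<^sup>,\<^sup>1(0,T;L\<^sup>1(\<Omega>))\<close> and \<open>v\<close> is its weak time derivative. The space
  \<open>L\<^sup>1(0,T;L\<^sup>1(\<Omega>))\<close> is identified with \<open>L\<^sup>1(\<Omega> \<times> (0,T))\<close>, and the Bochner integrals in time, which
  are elements of \<open>L\<^sup>1(\<Omega>)\<close>, are evaluated at almost every \<open>x\<close>. As usual, \<open>u\<close> stands for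
  the representative in \<open>C([0,T];L\<^sup>1(\<Omega>))\<close>, so that \<open>u(\<cdot>,t)\<close> is meaningful for every \<open>t\<close>, in
  particular for \<open>t = 0\<close>; this is the content of the last two conjuncts.
\<close>

definition W11 :: "real \<Rightarrow> (real \<Rightarrow> real \<Rightarrow> real) \<Rightarrow> (real \<Rightarrow> real \<Rightarrow> real) \<Rightarrow> bool" where
  "W11 T u v \<longleftrightarrow>
     integrable (lebesgue_on (Om \<times> {0<..<T})) (\<lambda>(x, t). u x t) \<and>
     integrable (lebesgue_on (Om \<times> {0<..<T})) (\<lambda>(x, t). v x t) \<and>
     (\<forall>\<eta>. test_function T \<eta> \<longrightarrow>
        (AE x in OmM.
           (\<integral>t. u x t * deriv \<eta> t \<partial>lebesgue_on {0<..<T})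
             = - (\<integral>t. v x t * \<eta> t \<partial>lebesgue_on {0<..<T}))) \<and>
     (\<forall>t\<in>{0..T}. integrable OmM (\<lambda>x. u x t)) \<and>
     (\<forall>t\<in>{0..T}. ((\<lambda>s. \<integral>x. \<bar>u x s - u x t\<bar> \<partial>OmM) \<longlongrightarrow> 0) (at t within {0..T}))"

definition is_solution ::
  "(real \<Rightarrow> real \<Rightarrow> real) \<Rightarrow> real \<Rightarrow> (real \<Rightarrow> real) \<Rightarrow> real \<Rightarrow> (real \<Rightarrow> real \<Rightarrow> real) \<Rightarrow> bool" where
  "is_solution K p g T u \<longleftrightarrow>
     (\<exists>v. W11 T u v \<and>
        (AE x in OmM. u x 0 = g x) \<and>
        (AE t in lebesgue_on {0<..<T}. plap_domain K p (\<lambda>x. u x t)) \<and>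
        (AE (x, t) in lebesgue_on (Om \<times> {0<..<T}).
           v x t = - nonlocal_plap K p (\<lambda>y. u y t) x))"


section \<open>The fully discrete problem on \<open>K/\<Q>\<^sub>n\<close>\<close>

definition cell :: "nat \<Rightarrow> nat \<Rightarrow> real set" where
  "cell n i = {(real i - 1) / real n ..< real i / real n}"

definition weight :: "(real \<Rightarrow> real \<Rightarrow> real) \<Rightarrow> nat \<Rightarrow> nat \<Rightarrow> nat \<Rightarrow> real" where
  "weight K n i j =
     (real n)\<^sup>2 * (\<integral>z. (case z of (x, y) \<Rightarrow> K x y) \<partial>lebesgue_on (cell n i \<times> cell n j))"

definition init :: "(real \<Rightarrow> real) \<Rightarrow> nat \<Rightarrow> nat \<Rightarrow> real" where
  "init g n i = real n * (\<integral>x. g x \<partial>lebesgue_on (cell n i))"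

definition time_partition :: "real \<Rightarrow> nat \<Rightarrow> (nat \<Rightarrow> real) \<Rightarrow> bool" where
  "time_partition T N t \<longleftrightarrow> t 0 = 0 \<and> t N = T \<and> (\<forall>h\<in>{1..N}. t (h - 1) < t h)"

text \<open>\<open>step t h\<close> is the step leading from \<open>t\<^sub>h\<close> to \<open>t\<^sub>h\<^sub>+\<^sub>1\<close>.\<close>

definition step :: "(nat \<Rightarrow> real) \<Rightarrow> nat \<Rightarrow> real" where
  "step t h = \<bar>t (h + 1) - t h\<bar>"

definition mesh :: "nat \<Rightarrow> (nat \<Rightarrow> real) \<Rightarrow> real" where
  "mesh N t = Max ((\<lambda>h. step t (h - 1)) ` {1..N})"

text \<open>\<open>U h i\<close> is the value at time level \<open>h\<close> and vertex \<open>i\<close>.\<close>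

definition discrete_solution ::
  "(real \<Rightarrow> real \<Rightarrow> real) \<Rightarrow> real \<Rightarrow> (real \<Rightarrow> real) \<Rightarrow> nat \<Rightarrow> nat \<Rightarrow> (nat \<Rightarrow> real)
     \<Rightarrow> (nat \<Rightarrow> nat \<Rightarrow> real) \<Rightarrow> bool" where
  "discrete_solution K p g n N t U \<longleftrightarrow>
     (\<forall>i\<in>{1..n}. U 0 i = init g n i) \<and>
     (\<forall>i\<in>{1..n}. \<forall>h\<in>{1..N}.
        (U h i - U (h - 1) i) / step t (h - 1)
          = 1 / real n * (\<Sum>j=1..n. weight K n i j * phi p (U (h - 1) j - U (h - 1) i)))"

text \<open>The cells do not cover \<open>x = 1\<close>, where the interpolation gets the value \<open>0\<close>.\<close>

definition interpolation ::
  "(real \<Rightarrow> real) \<Rightarrow> nat \<Rightarrow> nat \<Rightarrow> (nat \<Rightarrow> real) \<Rightarrow> (nat \<Rightarrow> nat \<Rightarrow> real)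
     \<Rightarrow> real \<Rightarrow> real \<Rightarrow> real" where
  "interpolation g n N t U x s =
     (\<Sum>i=1..n. indicator (cell n i) x *
        (if s = 0 then init g n i
         else \<Sum>h=1..N. indicator {t (h - 1)<..t h} s *
                ((t h - s) / step t (h - 1) * U (h - 1) i
                  + (s - t (h - 1)) / step t (h - 1) * U h i)))"


section \<open>Norms\<close>

text \<open>
  The norms take values in the extended non-negative reals, so that a finite value entails
  that the powers involved are integrable.
\<close>

definition Lp_norm :: "real \<Rightarrow> (real \<Rightarrow> real) \<Rightarrow> ennreal" where
  "Lp_norm p f =
     (let I = (\<integral>\<^sup>+x. ennreal (\<bar>f x\<bar> powr p) \<partial>OmM)
      in if I = \<infinity> then \<infinity> else ennreal (enn2real I powr (1 / p)))"

definition CLp_norm :: "real \<Rightarrow> real \<Rightarrow> (real \<Rightarrow> real \<Rightarrow> real) \<Rightarrow> ennreal" where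
  "CLp_norm T p w = (SUP t\<in>{0..T}. Lp_norm p (\<lambda>x. w x t))"

end

theory Submission
  imports Defs
begin

text \<open>
  The operator is accretive in \<open>L\<^sup>1(\<Omega>)\<close>, so its solutions depend in \<open>L\<^sup>1\<close> on the data and on
  perturbations of the equation with constant \<open>1\<close>. The interpolation of the discrete solution is a
  perturbed solution, and the perturbation vanishes as the meshes shrink.

  Accretivity comes from the symmetry of the kernel. If \<open>u\<close> and \<open>w\<close> are two functions on
  \<open>\<Omega>\<close>, \<open>q\<close> is nondecreasing, \<open>s = q(u - w)\<close> and \<open>\<Psi>(x,y) = \<phi>(u(y) - u(x)) - \<phi>(w(y) - w(x))\<close>, then
  exchanging \<open>x\<close> and \<open>y\<close> turns twice the integral of \<open>s(x) K(x,y) \<Psi>(x,y)\<close> into the integral of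
  \<open>K(x,y) (s(x) - s(y)) \<Psi>(x,y)\<close>, and this integrand is nonpositive because \<open>\<phi>\<close> and \<open>q\<close> are monotone
  (\<open>antisymmetric_integral_nonpos\<close>). It is carried along the evolution by an integrated chain
  inequality: a convex function of the primitive of an integrable function grows at most by the
  integral of its subgradient times that function (\<open>convex_chain_rule\<close>). Together they give
  \<open>entropy_decay\<close>, in which \<open>w\<close> may be any function affine in time, at the price of the \<open>L\<^sup>1\<close> norm of its
  residual. For convex functions that approximate the modulus this is the stability estimate
  \<open>L1_growth\<close>; for one that vanishes on \<open>[-M,M]\<close> it is the \<open>maximum_principle\<close>, which bounds a
  solution that a priori is merely in \<open>L\<^sup>1\<close>. The weak time derivative enters only through
  \<open>W11_primitive\<close>: for each \<open>t\<close>, almost everywhere, \<open>u(t)\<close> is \<open>u(0)\<close> plus the integral of the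
  derivative.

  On each time step the interpolation is affine in time and constant on the cells. Its residual
  (\<open>cell_residual\<close>) has two parts. One is the \<open>L\<^sup>1\<close> distance of \<open>K\<close> to its cell averages, which
  tends to \<open>0\<close> with the cell size (\<open>averages_converge_L1\<close>). The other is the change of \<open>\<phi>\<close> within one
  time step, which is small because \<open>\<phi>\<close> is uniformly continuous on bounded sets and the discrete
  values stay bounded (\<open>discrete_solutions_bounded\<close>). For \<open>p \<ge> 2\<close> the bound is a discrete
  maximum principle, valid for small time steps; for \<open>p < 2\<close>, where the slope of \<open>\<phi>\<close> at \<open>0\<close> is
  infinite and the maximum principle may fail, the sublinear growth of \<open>\<phi>\<close> suffices. Thus
  \<open>interpolation_L1_error\<close> yields convergence in \<open>L\<^sup>1\<close>, uniformly in time; as both functions are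
  bounded, convergence in \<open>L\<^sup>p\<close> follows.
\<close>

section \<open>Smooth test functions with trapezoidal graph\<close>

text \<open>
  The classical flat functions. Division by a power of \<open>x\<close> makes the family closed under
  differentiation up to linear combinations, and smoothness follows by induction.
\<close>

definition flat_exp :: "nat \<Rightarrow> real \<Rightarrow> real" where
  "flat_exp k x = (if x \<le> 0 then 0 else exp (- (1 / x)) / x ^ k)"

lemma flat_exp_tendsto_0: "(flat_exp k \<longlongrightarrow> 0) (at 0)"
proof -
  have "((\<lambda>y::real. y ^ k / exp y) \<longlongrightarrow> 0) at_top"
    by (rule tendsto_power_div_exp_0)
  then have "((\<lambda>x::real. (inverse x) ^ k / exp (inverse x)) \<longlongrightarrow> 0) (at_right 0)"
    by (rule filterlim_compose) (rule filterlim_inverse_at_top_right)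
  then have "(flat_exp k \<longlongrightarrow> 0) (at_right 0)"
  proof (rule Lim_transform_eventually)
    show "\<forall>\<^sub>F x in at_right 0. (inverse x) ^ k / exp (inverse x) = flat_exp k x"
      by (rule eventually_at_right_less[THEN eventually_mono])
        (auto simp: flat_exp_def exp_minus field_simps power_one_over)
  qed
  moreover have "(flat_exp k \<longlongrightarrow> 0) (at_left 0)"
  proof (rule Lim_transform_eventually[OF tendsto_const])
    show "\<forall>\<^sub>F x in at_left 0. 0 = flat_exp k x"
      by (auto simp: flat_exp_def eventually_at_filter)
  qed
  ultimately show ?thesis
    by (simp add: filterlim_at_split)
qed

lemma flat_exp_has_derivative:
  "(flat_exp k has_real_derivative flat_exp (k + 2) x - of_nat k * flat_exp (k + 1) x) (at x)"
proof (cases x "0::real" rule: linorder_cases)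
  case less
  have "((\<lambda>_. 0) has_real_derivative 0) (at x)" by simp
  then have "(flat_exp k has_real_derivative 0) (at x)"
    by (rule has_field_derivative_transform_within_open[where S = "{..<0}"])
      (use less in \<open>auto simp: flat_exp_def\<close>)
  with less show ?thesis by (simp add: flat_exp_def)
next
  case equal
  have "((\<lambda>h. (flat_exp k (0 + h) - flat_exp k 0) / h) \<longlongrightarrow> 0) (at 0)"
  proof (rule Lim_transform_eventually[OF flat_exp_tendsto_0[of "k + 1"]])
    show "\<forall>\<^sub>F h in at 0. flat_exp (k + 1) h = (flat_exp k (0 + h) - flat_exp k 0) / h"
      by (auto simp: flat_exp_def eventually_at_filter)
  qed
  then have "(flat_exp k has_real_derivative 0) (at 0)"
    by (simp add: DERIV_def)
  with equal show ?thesis by (simp add: flat_exp_def)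
next
  case greater
  have "((\<lambda>y. exp (- (1 / y)) / y ^ k) has_real_derivative
      flat_exp (k + 2) x - of_nat k * flat_exp (k + 1) x) (at x)"
  proof -
    have "real k * x ^ (k - Suc 0) = real k * x ^ k / x"
      using greater by (cases k) auto
    then have P: "((\<lambda>y. y ^ k) has_real_derivative real k * x ^ k / x) (at x)"
      using DERIV_pow[of k x] by simp
    have E: "((\<lambda>y. exp (- (1 / y))) has_real_derivative exp (- (1 / x)) / x\<^sup>2) (at x)"
      using greater by (auto intro!: derivative_eq_intros simp: power2_eq_square)
    show ?thesis
    proof (rule DERIV_cong[OF DERIV_divide[OF E P]])
      have *: "(e / x\<^sup>2 * X - e * (real k * X / x)) / (X * X)
          = e / (X * x\<^sup>2) - real k * (e / (X * x))" if "X \<noteq> 0" for X e :: real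
        using that greater by (simp add: diff_divide_distrib power2_eq_square mult_ac)
      show "(exp (- (1 / x)) / x\<^sup>2 * x ^ k - exp (- (1 / x)) * (real k * x ^ k / x)) / (x ^ k * x ^ k)
          = flat_exp (k + 2) x - real k * flat_exp (k + 1) x"
        using greater by (subst *) (simp_all add: flat_exp_def power_add power2_eq_square mult.commute)
    qed (use greater in simp)
  qed
  then show ?thesis
    by (rule has_field_derivative_transform_within_open[where S = "{0<..}"])
      (use greater in \<open>auto simp: flat_exp_def\<close>)
qed

text \<open>
  A product of two flat functions is a bump supported in \<open>[a,b]\<close>. The linear span of such bumps is closed under
  derivatives, so all its members are smooth.
\<close>

inductive_set bump_span :: "(real \<Rightarrow> real) set" where
  base: "(\<lambda>r. flat_exp j (r - a) * flat_exp k (b - r)) \<in> bump_span"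
| add: "f \<in> bump_span \<Longrightarrow> h \<in> bump_span \<Longrightarrow> (\<lambda>r. f r + h r) \<in> bump_span"
| scale: "f \<in> bump_span \<Longrightarrow> (\<lambda>r. c * f r) \<in> bump_span"

lemma bump_span_has_derivative:
  assumes "f \<in> bump_span"
  shows "\<exists>f'\<in>bump_span. \<forall>x. (f has_real_derivative f' x) (at x)"
  using assms
proof induction
  case (base j a k b)
  let ?B = "\<lambda>j k r. flat_exp j (r - a) * flat_exp k (b - r)"
  let ?f' = "\<lambda>r. (?B (j + 2) k r + (- of_nat j) * ?B (j + 1) k r)
                + ((- 1) * ?B j (k + 2) r + of_nat k * ?B j (k + 1) r)"
  have "?f' \<in> bump_span"
    by (intro bump_span.intros)
  moreover have "(?B j k has_real_derivative ?f' x) (at x)" for x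
  proof -
    have 1: "((\<lambda>r. flat_exp j (r - a)) has_real_derivative
        (flat_exp (j + 2) (x - a) - of_nat j * flat_exp (j + 1) (x - a)) * 1) (at x)"
      by (rule DERIV_chain2[OF flat_exp_has_derivative]) (auto intro!: derivative_eq_intros)
    have 2: "((\<lambda>r. flat_exp k (b - r)) has_real_derivative
        (flat_exp (k + 2) (b - x) - of_nat k * flat_exp (k + 1) (b - x)) * (- 1)) (at x)"
      by (rule DERIV_chain2[OF flat_exp_has_derivative]) (auto intro!: derivative_eq_intros)
    show ?thesis
      by (rule DERIV_cong[OF DERIV_mult[OF 1 2]]) (simp add: algebra_simps)
  qed
  ultimately show ?case by (intro bexI[of _ ?f'] allI)
next
  case (add f h)
  then obtain f' h' where "f' \<in> bump_span" "h' \<in> bump_span"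
    and "\<And>x. (f has_real_derivative f' x) (at x)" "\<And>x. (h has_real_derivative h' x) (at x)"
    by blast
  then show ?case
    by (intro bexI[of _ "\<lambda>r. f' r + h' r"] allI DERIV_add bump_span.add) auto
next
  case (scale f c)
  then obtain f' where "f' \<in> bump_span" and "\<And>x. (f has_real_derivative f' x) (at x)"
    by blast
  then show ?case
    by (intro bexI[of _ "\<lambda>r. c * f' r"] allI DERIV_cmult bump_span.scale) auto
qed

lemma bump_span_higher_deriv: "f \<in> bump_span \<Longrightarrow> (deriv ^^ k) f \<in> bump_span"
proof (induction k)
  case (Suc k)
  then obtain f' where "f' \<in> bump_span" "\<And>x. ((deriv ^^ k) f has_real_derivative f' x) (at x)"
    using bump_span_has_derivative by blast
  then have "deriv ((deriv ^^ k) f) = f'"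
    by (intro ext DERIV_imp_deriv)
  with \<open>f' \<in> bump_span\<close> show ?case by simp
qed simp

lemma bump_span_differentiable: "f \<in> bump_span \<Longrightarrow> f differentiable_on UNIV"
  using bump_span_has_derivative[of f] 
  by (auto simp: differentiable_on_def real_differentiable_def)

text \<open>
  Normalising the bump on \<open>[a,b]\<close> to mass \<open>1\<close> and integrating it gives a smooth step from \<open>0\<close> to \<open>1\<close>.
\<close>

lemma smooth_step_exists:
  fixes a b :: real
  assumes "a < b"
  obtains \<psi> \<Psi> where "\<psi> \<in> bump_span" "\<And>r. (\<Psi> has_real_derivative \<psi> r) (at r)"
    "\<And>r. 0 \<le> \<psi> r" "\<And>r. r \<notin> {a..b} \<Longrightarrow> \<psi> r = 0"
    "\<And>r. r \<le> a \<Longrightarrow> \<Psi> r = 0" "\<And>r. b \<le> r \<Longrightarrow> \<Psi> r = 1"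
    "has_bochner_integral lborel \<psi> 1"
proof -
  define B where "B r = flat_exp 0 (r - a) * flat_exp 0 (b - r)" for r
  have B_span: "B \<in> bump_span"
    unfolding B_def by (rule bump_span.base)
  have cont: "continuous_on S B" for S
    using bump_span_differentiable[OF B_span] continuous_on_subset
      differentiable_imp_continuous_on by blast
  have B_nonneg: "0 \<le> B r" for r by (simp add: B_def flat_exp_def)
  have B_pos: "0 < B r" if "a < r" "r < b" for r
    using that by (simp add: B_def flat_exp_def)
  have B_0: "B r = 0" if "r \<notin> {a..b}" for r
    using that by (auto simp: B_def flat_exp_def)
  \<comment> \<open>Starting the primitive at \<open>a - 1\<close> makes it differentiable on both sides of \<open>a\<close>.\<close>
  define A where "A r = integral {a - 1..r} B" for r
  have A_0: "A r = 0" if "r \<le> a" for r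
  proof -
    have "A r = integral {a - 1..r} (\<lambda>_. 0)"
      unfolding A_def by (rule integral_cong) (use that in \<open>auto simp: B_def flat_exp_def\<close>)
    then show ?thesis by simp
  qed
  have A_deriv: "(A has_real_derivative B r) (at r)" for r
  proof (cases "r < a")
    case True
    have "((\<lambda>_. 0) has_real_derivative 0) (at r)" by simp
    then have "(A has_real_derivative 0) (at r)"
      by (rule has_field_derivative_transform_within_open[where S = "{..<a}"])
        (use True A_0 in auto)
    with True B_0 show ?thesis by simp
  next
    case False
    have "(A has_real_derivative B r) (at r within {a - 1..r + 1})"
      unfolding A_def by (rule integral_has_real_derivative[OF cont]) (use False in auto)
    moreover have "at r within {a - 1..r + 1} = at r"
      by (rule at_within_interior) (use False in auto)
    ultimately show ?thesis by simp
  qed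
  have A_mono: "A r \<le> A s" if "r \<le> s" for r s
    by (rule DERIV_nonneg_imp_nondecreasing[OF that]) (use A_deriv B_nonneg in blast)
  have A_b: "0 < A b"
  proof -
    have "\<exists>z>a. z < b \<and> A b - A a = (b - a) * B z"
      by (rule MVT2[OF assms]) (use A_deriv in auto)
    then show ?thesis using A_0[of a] B_pos assms by (auto intro: mult_pos_pos)
  qed
  have A_top: "A r = A b" if "b \<le> r" for r
  proof (cases "b = r")
    case False
    then have "b < r" using that by simp
    then have "\<exists>z>b. z < r \<and> A r - A b = (r - b) * B z"
      by (rule MVT2) (use A_deriv in auto)
    then show ?thesis using B_0 by auto
  qed simp
  have int_B: "has_bochner_integral lborel B (A b)"
  proof -
    have "has_bochner_integral lborel (\<lambda>x. indicator {a..b} x *\<^sub>R B x) (A b - A a)"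
      by (rule has_bochner_integral_FTC_Icc)
        (use assms A_deriv cont in \<open>auto simp: has_real_derivative_iff_has_vector_derivative[symmetric]
           intro: has_field_derivative_at_within\<close>)
    then have "has_bochner_integral lborel (\<lambda>x. indicator {a..b} x *\<^sub>R B x) (A b)"
      by (simp only: A_0[of a, simplified] diff_zero)
    then show ?thesis
      by (rule has_bochner_integral_cong[THEN iffD1, rotated -1])
        (use B_0 in \<open>auto simp: indicator_def\<close>)
  qed
  show ?thesis
  proof (rule that[of "\<lambda>r. (1 / A b) * B r" "\<lambda>r. (1 / A b) * A r"])
    show "(\<lambda>r. (1 / A b) * B r) \<in> bump_span"
      by (rule bump_span.scale[OF B_span])
    show "((\<lambda>r. (1 / A b) * A r) has_real_derivative (1 / A b) * B r) (at r)" for r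
      by (rule DERIV_cmult[OF A_deriv])
    show "has_bochner_integral lborel (\<lambda>r. (1 / A b) * B r) 1"
      using has_bochner_integral_mult_right[OF int_B, of "1 / A b"] A_b by simp
    show "(1 / A b) * A r = 1" if "b \<le> r" for r
      using A_top[OF that] A_b by simp
  qed (use A_b A_0 B_0 B_nonneg in auto)
qed

text \<open>
  Test functions that approximate the indicator function of an interval, whose derivative is the
  difference of two probability densities concentrated near its end points. They turn the
  weak formulation into a statement about increments in time.
\<close>

lemma trapezoidal_test_function:
  fixes a b c d T :: real
  assumes "0 < a" "a < b" "b \<le> c" "c < d" "d < T"
  obtains \<eta> \<psi> \<theta> where "test_function T \<eta>" "deriv \<eta> = (\<lambda>r. \<psi> r - \<theta> r)"
    "\<And>r. 0 \<le> \<psi> r" "\<And>r. 0 \<le> \<theta> r"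
    "\<And>r. r \<notin> {a..b} \<Longrightarrow> \<psi> r = 0" "\<And>r. r \<notin> {c..d} \<Longrightarrow> \<theta> r = 0"
    "continuous_on UNIV \<psi>" "continuous_on UNIV \<theta>" "continuous_on UNIV \<eta>"
    "has_bochner_integral lborel \<psi> 1" "has_bochner_integral lborel \<theta> 1"
    "\<And>r. 0 \<le> \<eta> r" "\<And>r. \<eta> r \<le> 1" "\<And>r. r \<in> {b..c} \<Longrightarrow> \<eta> r = 1"
    "\<And>r. r \<notin> {a..d} \<Longrightarrow> \<eta> r = 0"
proof -
  obtain \<psi> \<Psi> where 1: "\<psi> \<in> bump_span" "\<And>r. (\<Psi> has_real_derivative \<psi> r) (at r)"
    "\<And>r. 0 \<le> \<psi> r" "\<And>r. r \<notin> {a..b} \<Longrightarrow> \<psi> r = 0"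
    "\<And>r. r \<le> a \<Longrightarrow> \<Psi> r = 0" "\<And>r. b \<le> r \<Longrightarrow> \<Psi> r = 1" "has_bochner_integral lborel \<psi> 1"
    using smooth_step_exists[OF \<open>a < b\<close>] by metis
  obtain \<theta> X where 2: "\<theta> \<in> bump_span" "\<And>r. (X has_real_derivative \<theta> r) (at r)"
    "\<And>r. 0 \<le> \<theta> r" "\<And>r. r \<notin> {c..d} \<Longrightarrow> \<theta> r = 0"
    "\<And>r. r \<le> c \<Longrightarrow> X r = 0" "\<And>r. d \<le> r \<Longrightarrow> X r = 1" "has_bochner_integral lborel \<theta> 1"
    using smooth_step_exists[OF \<open>c < d\<close>] by metis
  have mono: "\<Psi> r \<le> \<Psi> s" "X r \<le> X s" if "r \<le> s" for r s
    by (rule DERIV_nonneg_imp_nondecreasing[OF that], use 1 2 in blast)+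
  have bounds: "0 \<le> \<Psi> r" "\<Psi> r \<le> 1" "0 \<le> X r" "X r \<le> 1" for r
    using 1(5)[of "min r a"] 1(6)[of "max r b"] mono(1)[of "min r a" r] mono(1)[of r "max r b"]
      2(5)[of "min r c"] 2(6)[of "max r d"] mono(2)[of "min r c" r] mono(2)[of r "max r d"]
    by auto
  define \<eta> where "\<eta> r = \<Psi> r - X r" for r
  have \<eta>_deriv: "(\<eta> has_real_derivative \<psi> r - \<theta> r) (at r)" for r
    unfolding \<eta>_def by (intro DERIV_diff 1 2)
  then have deriv_\<eta>: "deriv \<eta> = (\<lambda>r. \<psi> r - \<theta> r)"
    by (intro ext DERIV_imp_deriv)
  have "(\<lambda>r. \<psi> r + (- 1) * \<theta> r) \<in> bump_span"
    by (intro bump_span.add bump_span.scale 1 2)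
  then have diff_span: "deriv \<eta> \<in> bump_span"
    by (simp add: deriv_\<eta>)
  have \<eta>_0: "\<eta> r = 0" if "r \<notin> {a..d}" for r
    using that 1(5)[of r] 2(5)[of r] 1(6)[of r] 2(6)[of r] assms by (auto simp: \<eta>_def)
  have \<eta>_diff: "\<eta> differentiable_on UNIV"
    using \<eta>_deriv by (auto simp: differentiable_on_def real_differentiable_def)
  have "(deriv ^^ k) \<eta> differentiable_on UNIV" for k
  proof (cases k)
    case (Suc m)
    then have "(deriv ^^ k) \<eta> = (deriv ^^ m) (deriv \<eta>)"
      by (simp add: funpow_swap1)
    then show ?thesis
      using bump_span_differentiable[OF bump_span_higher_deriv[OF diff_span]] by simp
  qed (simp add: \<eta>_diff)
  moreover have "closure {t. \<eta> t \<noteq> 0} \<subseteq> {a..d}"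
    by (rule closure_minimal) (use \<eta>_0 in blast, simp)
  ultimately have "test_function T \<eta>"
    using assms by (auto simp: test_function_def)
  show ?thesis
  proof (rule that[OF \<open>test_function T \<eta>\<close> deriv_\<eta> 1(3) 2(3) 1(4) 2(4) _ _ _ 1(7) 2(7)])
    show "continuous_on UNIV \<psi>" "continuous_on UNIV \<theta>" "continuous_on UNIV \<eta>"
      using bump_span_differentiable 1(1) 2(1) \<eta>_diff differentiable_imp_continuous_on by blast+
    show "0 \<le> \<eta> r" for r
      using bounds(1)[of r] 1(6)[of r] 2(5)[of r] bounds(4)[of r] assms 
      by (cases "r \<le> c") (auto simp: \<eta>_def)
    show "\<eta> r \<le> 1" for r
      using bounds[of r] by (auto simp: \<eta>_def)
    show "\<eta> r = 1" if "r \<in> {b..c}" for r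
      using that 1(6)[of r] 2(5)[of r] by (auto simp: \<eta>_def)
  qed (use \<eta>_0 in auto)
qed

section \<open>Borel representatives of Lebesgue measurable functions\<close>

lemma AE_lebesgue_on_iff:
  assumes "S \<in> sets borel"
  shows "(AE x in lebesgue_on S. P x) \<longleftrightarrow> (AE x in lborel. x \<in> S \<longrightarrow> P x)"
  using assms by (subst AE_restrict_space_iff) (auto simp: AE_completion_iff)

text \<open>
  Lebesgue measure is complete, so a function that is almost everywhere equal to a Borel function is
  measurable. This is what allows sections and integrals of Lebesgue measurable functions
  to be computed on Borel representatives, for which Fubini's theorem holds on the product of the
  uncompleted measures.
\<close>

lemma borel_measurable_lebesgue_AE:
  fixes f f' :: "'a::euclidean_space \<Rightarrow> real"
  assumes "f' \<in> borel_measurable borel" "AE x in lborel. f x = f' x"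
  shows "f \<in> borel_measurable lebesgue"
proof (rule measurableI)
  fix A :: "real set" assume A: "A \<in> sets borel"
  show "f -` A \<inter> space lebesgue \<in> sets lebesgue"
  proof (rule completion.in_sets_AE)
    show "AE x in lebesgue. (x \<in> f' -` A) = (x \<in> f -` A \<inter> space lebesgue)"
      using assms(2) unfolding AE_completion_iff by eventually_elim auto
    show "f' -` A \<in> sets lebesgue"
      using measurable_sets[OF assms(1) A] by auto
  qed auto
qed auto

lemma lebesgue_on_representative:
  fixes f f' :: "'a::euclidean_space \<Rightarrow> real"
  assumes S: "S \<in> sets borel" and f': "f' \<in> borel_measurable borel"
    and ae: "AE x in lborel. x \<in> S \<longrightarrow> f x = f' x"
  shows "f \<in> borel_measurable (lebesgue_on S)"
    and "integrable (lebesgue_on S) f \<longleftrightarrow> integrable lborel (\<lambda>x. indicator S x * f' x)"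
    and "(\<integral>x. f x \<partial>lebesgue_on S) = (LBINT x. indicator S x * f' x)"
proof -
  have [measurable]: "S \<in> sets borel" "f' \<in> borel_measurable borel" by fact+
  have SL: "S \<inter> space lebesgue \<in> sets lebesgue" using S by auto
  have ae': "AE x in lborel. indicator S x * f x = indicator S x * f' x"
    using ae by eventually_elim (auto simp: indicator_def)
  have meas: "(\<lambda>x. indicator S x * f x) \<in> borel_measurable lebesgue"
    by (rule borel_measurable_lebesgue_AE[OF _ ae']) simp
  have meas': "(\<lambda>x. indicator S x * f' x) \<in> borel_measurable lborel" by simp
  show "f \<in> borel_measurable (lebesgue_on S)"
    using meas by (simp add: borel_measurable_restrict_space_iff[OF SL])
  have "integrable (lebesgue_on S) f \<longleftrightarrow> integrable lebesgue (\<lambda>x. indicator S x * f x)"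
    by (simp add: integrable_restrict_space[OF SL])
  also have "\<dots> \<longleftrightarrow> integrable lebesgue (\<lambda>x. indicator S x * f' x)"
    by (rule integrable_cong_AE)
      (use meas ae' meas' in \<open>auto simp: AE_completion_iff intro: measurable_completion\<close>)
  finally show "integrable (lebesgue_on S) f \<longleftrightarrow> integrable lborel (\<lambda>x. indicator S x * f' x)"
    by (simp only: integrable_completion[OF meas'])
  have "(\<integral>x. f x \<partial>lebesgue_on S) = (\<integral>x. indicator S x * f x \<partial>lebesgue)"
    by (simp add: integral_restrict_space[OF SL])
  also have "\<dots> = (\<integral>x. indicator S x * f' x \<partial>lebesgue)"
    by (rule integral_cong_AE)
      (use meas ae' meas' in \<open>auto simp: AE_completion_iff intro: measurable_completion\<close>)
  finally show "(\<integral>x. f x \<partial>lebesgue_on S) = (LBINT x. indicator S x * f' x)"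
    by (simp only: integral_completion[OF meas'])
qed

lemma borel_representative_exists:
  fixes f :: "'a::euclidean_space \<Rightarrow> real"
  assumes S: "S \<in> sets borel" and f: "f \<in> borel_measurable (lebesgue_on S)"
  obtains f' where "f' \<in> borel_measurable borel" "\<And>x. x \<notin> S \<Longrightarrow> f' x = 0"
    "AE x in lborel. x \<in> S \<longrightarrow> f x = f' x"
proof -
  have "(\<lambda>x. if x \<in> S then f x else 0) \<in> borel_measurable lebesgue"
    by (rule borel_measurable_if_I[OF f]) (use S in auto)
  then obtain g where g: "g \<in> borel_measurable lborel"
      "AE x in lborel. (if x \<in> S then f x else 0) = g x"
    using completion_ex_borel_measurable_real by blast
  show thesis
  proof (rule that[of "\<lambda>x. indicator S x * g x"])
    show "(\<lambda>x. indicator S x * g x) \<in> borel_measurable borel"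
      using S g(1) by measurable
    show "AE x in lborel. x \<in> S \<longrightarrow> f x = indicator S x * g x"
      using g(2) by eventually_elim auto
  qed auto
qed

lemma AE_lborel_fst:
  fixes P :: "'a::euclidean_space \<times> 'b::euclidean_space \<Rightarrow> bool"
  assumes "AE z in lborel. P z"
  shows "AE x in lborel. AE y in lborel. P (x, y)"
  by (rule lborel_pair.AE_pair) (use assms in \<open>simp only: lborel_prod\<close>)

text \<open>
  The exceptional set need not be measurable, hence the detour through a Borel null set that contains it.
\<close>

lemma AE_lborel_snd:
  fixes P :: "'a::euclidean_space \<times> 'b::euclidean_space \<Rightarrow> bool"
  assumes "AE z in lborel. P z"
  shows "AE y in lborel. AE x in lborel. P (x, y)"
proof -
  obtain N where N: "\<And>z. z \<in> space lborel - N \<Longrightarrow> P z"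
      "N \<in> null_sets (lborel :: ('a \<times> 'b) measure)"
    by (rule AE_E3[OF assms]) (rule that)
  have "N \<in> sets (lborel \<Otimes>\<^sub>M lborel)"
    unfolding lborel_prod using N(2) by (rule null_setsD2)
  have "AE x in lborel. AE y in lborel. (x, y) \<notin> N"
    using AE_lborel_fst[OF AE_not_in[OF N(2)]] .
  moreover have "{z \<in> space (lborel \<Otimes>\<^sub>M lborel). (fst z, snd z) \<notin> N} \<in> sets (lborel \<Otimes>\<^sub>M lborel)"
  proof -
    have "space (lborel \<Otimes>\<^sub>M lborel) - N \<in> sets (lborel \<Otimes>\<^sub>M lborel)"
      by (rule sets.compl_sets) fact
    also have "space (lborel \<Otimes>\<^sub>M lborel) - N
        = {z \<in> space (lborel \<Otimes>\<^sub>M lborel). (fst z, snd z) \<notin> N}"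
      by auto
    finally show ?thesis .
  qed
  ultimately have "AE y in lborel. AE x in lborel. (x, y) \<notin> N"
    by (subst (asm) lborel_pair.AE_commute)
  then show ?thesis
  proof eventually_elim
    case (elim y)
    then show ?case
      by eventually_elim (use N(1) in simp)
  qed
qed

lemma AE_lborel_fst_lift:
  fixes Q :: "'a::euclidean_space \<Rightarrow> bool"
  assumes "AE x in lborel. Q x"
  shows "AE z in (lborel :: ('a \<times> 'b::euclidean_space) measure). Q (fst z)"
    and "AE z in (lborel :: ('b::euclidean_space \<times> 'a) measure). Q (snd z)"
proof -
  obtain N where N: "\<And>x. x \<in> space lborel - N \<Longrightarrow> Q x" "N \<in> null_sets (lborel :: 'a measure)"
    by (rule AE_E3[OF assms]) (rule that)
  have "N \<times> UNIV \<in> null_sets (lborel \<Otimes>\<^sub>M lborel :: ('a \<times> 'b) measure)"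
    by (rule lborel.times_in_null_sets1[OF N(2)]) simp
  then have "AE z in (lborel :: ('a \<times> 'b) measure). z \<notin> N \<times> UNIV"
    unfolding lborel_prod by (rule AE_not_in)
  then show "AE z in (lborel :: ('a \<times> 'b) measure). Q (fst z)"
    by eventually_elim (use N(1) in \<open>auto simp: mem_Times_iff\<close>)
  have "UNIV \<times> N \<in> null_sets (lborel \<Otimes>\<^sub>M lborel :: ('b \<times> 'a) measure)"
    by (rule lborel.times_in_null_sets2[OF _ N(2)]) simp
  then have "AE z in (lborel :: ('b \<times> 'a) measure). z \<notin> UNIV \<times> N"
    unfolding lborel_prod by (rule AE_not_in)
  then show "AE z in (lborel :: ('b \<times> 'a) measure). Q (snd z)"
    by eventually_elim (use N(1) in \<open>auto simp: mem_Times_iff\<close>)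
qed

lemma AE_lborel_swap:
  fixes P :: "'a::euclidean_space \<times> 'a \<Rightarrow> bool"
  assumes "AE z in lborel. P z"
  shows "AE z in lborel. P (snd z, fst z)"
proof -
  have "AE z in distr (lborel \<Otimes>\<^sub>M lborel) (lborel \<Otimes>\<^sub>M lborel) (\<lambda>(x, y). (y, x)). P z"
    by (subst lborel_pair.distr_pair_swap[symmetric]) (simp only: lborel_prod assms)
  then have "AE z in (lborel \<Otimes>\<^sub>M lborel). P (case z of (x, y) \<Rightarrow> (y, x))"
    by (rule AE_distrD[OF measurable_pair_swap'])
  then show ?thesis by (simp only: lborel_prod case_prod_unfold)
qed

abbreviation lborel2 :: "(real \<times> real) measure" where
  "lborel2 \<equiv> lborel \<Otimes>\<^sub>M lborel"

abbreviation flux :: "(real \<Rightarrow> real \<Rightarrow> real) \<Rightarrow> (real \<Rightarrow> real) \<Rightarrow> (real \<Rightarrow> real) \<Rightarrow> real \<Rightarrow> real" where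
  "flux K \<phi> f x \<equiv> LBINT y. K x y * \<phi> (f y - f x)"

abbreviation flux_integrable :: "(real \<Rightarrow> real \<Rightarrow> real) \<Rightarrow> (real \<Rightarrow> real) \<Rightarrow> (real \<Rightarrow> real) \<Rightarrow> bool" where
  "flux_integrable K \<phi> f \<equiv> integrable lborel2 (\<lambda>(x, y). K x y * \<phi> (f y - f x))"

abbreviation cell_L1_error :: "(real \<Rightarrow> real \<Rightarrow> real) \<Rightarrow> (nat \<Rightarrow> nat \<Rightarrow> real) \<Rightarrow> nat \<Rightarrow> real" where
  "cell_L1_error K A n \<equiv> \<Sum>i=1..n. \<Sum>j=1..n.
     LBINT z. indicator (cell n i \<times> cell n j) z * \<bar>K (fst z) (snd z) - A i j\<bar>"

lemma integrable_lborel_prod_mult: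
  fixes f g :: "real \<Rightarrow> real"
  assumes f: "integrable lborel f" and g: "integrable lborel g"
  shows "integrable lborel2 (\<lambda>(x, y). f x * g y)"
proof (rule lborel_pair.Fubini_integrable)
  have [measurable]: "f \<in> borel_measurable borel" "g \<in> borel_measurable borel"
    using f g by auto
  show "(\<lambda>(x, y). f x * g y) \<in> borel_measurable lborel2"
    by measurable
  show "integrable lborel (\<lambda>x. LBINT y. norm (case (x, y) of (x, y) \<Rightarrow> f x * g y))"
    using f by (simp add: abs_mult)
qed (use f g in auto)

lemma Om_borel [measurable]: "Om \<in> sets borel"
  by (simp add: Om_def)

lemma integral_OmM_representative:
  fixes f f' :: "real \<Rightarrow> real"
  assumes "f' \<in> borel_measurable borel" "\<And>x. x \<notin> Om \<Longrightarrow> f' x = 0"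
    "AE x in lborel. x \<in> Om \<longrightarrow> f x = f' x"
  shows "(\<integral>x. f x \<partial>OmM) = (LBINT x. f' x)"
proof -
  have "(\<integral>x. f x \<partial>OmM) = (LBINT x. indicator Om x * f' x)"
    by (rule lebesgue_on_representative(3)[OF Om_borel assms(1,3)])
  also have "(\<lambda>x. indicator Om x * f' x) = f'"
    using assms(2) by (auto simp: fun_eq_iff indicator_def)
  finally show ?thesis .
qed

lemma OmM_representative_exists:
  fixes f :: "real \<Rightarrow> real"
  assumes "integrable OmM f"
  obtains f' where "integrable lborel f'" "\<And>x. x \<notin> Om \<Longrightarrow> f' x = 0"
    "AE x in lborel. x \<in> Om \<longrightarrow> f x = f' x"
proof -
  obtain f' where f': "f' \<in> borel_measurable borel" "\<And>x. x \<notin> Om \<Longrightarrow> f' x = 0"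
    "AE x in lborel. x \<in> Om \<longrightarrow> f x = f' x"
    using borel_representative_exists[OF Om_borel borel_measurable_integrable[OF assms]] by blast
  have "integrable lborel (\<lambda>x. indicator Om x * f' x)"
    using lebesgue_on_representative(2)[OF Om_borel f'(1,3)] assms by blast
  also have "(\<lambda>x. indicator Om x * f' x) = f'"
    using f'(2) by (auto simp: fun_eq_iff indicator_def)
  finally show ?thesis using that f' by blast
qed

lemma product_representative_exists:
  fixes f :: "real \<Rightarrow> real \<Rightarrow> real"
  assumes S: "S \<in> sets borel" and T: "T \<in> sets borel"
    and f: "integrable (lebesgue_on (S \<times> T)) (\<lambda>(x, t). f x t)"
  obtains f' where "integrable lborel2 (\<lambda>(x, t). f' x t)"
    "\<And>x t. x \<notin> S \<or> t \<notin> T \<Longrightarrow> f' x t = 0"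
    "AE z in lborel. z \<in> S \<times> T \<longrightarrow> f (fst z) (snd z) = f' (fst z) (snd z)"
proof -
  have ST: "S \<times> T \<in> sets (borel :: (real \<times> real) measure)"
    using S T by (simp add: borel_prod[symmetric])
  obtain g where g: "g \<in> borel_measurable borel" "\<And>z. z \<notin> S \<times> T \<Longrightarrow> g z = 0"
    "AE z in lborel. z \<in> S \<times> T \<longrightarrow> (case z of (x, t) \<Rightarrow> f x t) = g z"
    using borel_representative_exists[OF ST borel_measurable_integrable[OF f]] by blast
  have "integrable lborel (\<lambda>z. indicator (S \<times> T) z * g z)"
    using lebesgue_on_representative(2)[OF ST g(1,3)] f by blast
  also have "(\<lambda>z. indicator (S \<times> T) z * g z) = (\<lambda>(x, t). g (x, t))"
    using g(2) by (auto simp: fun_eq_iff indicator_def)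
  finally have "integrable lborel2 (\<lambda>(x, t). g (x, t))"
    by (simp only: lborel_prod)
  then show ?thesis
    by (rule that[of "\<lambda>x t. g (x, t)"]) (use g in \<open>auto simp: case_prod_unfold\<close>)
qed

lemma Om2_borel: "Om \<times> Om \<in> sets (borel :: (real \<times> real) measure)"
  by (simp add: borel_prod[symmetric])

section \<open>Time primitives of functions in \<open>W\<^sup>1\<^sup>,\<^sup>1\<close>\<close>

text \<open>
  An average in time of \<open>f(\<cdot>,r)\<close> over \<open>r \<in> [a,b]\<close> is as close to \<open>c\<close> in \<open>L\<^sup>1\<close> as the individual slices are:
  move the norm inside the average and exchange the integrals.
\<close>

lemma L1_mollification_le:
  fixes f :: "real \<Rightarrow> real \<Rightarrow> real" and \<psi> c :: "real \<Rightarrow> real"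
  assumes f: "integrable lborel2 (\<lambda>(x, r). f x r)"
    and c: "integrable lborel c"
    and cont: "continuous_on UNIV \<psi>" and nonneg: "\<And>r. 0 \<le> \<psi> r"
    and supp: "\<forall>r. r \<notin> {a..b} \<longrightarrow> \<psi> r = 0"
    and mass: "has_bochner_integral lborel \<psi> 1"
    and le: "AE r in lborel. r \<in> {a..b} \<longrightarrow> (LBINT x. \<bar>f x r - c x\<bar>) \<le> e"
  shows "integrable lborel (\<lambda>x. LBINT r. f x r * \<psi> r)"
    and "AE x in lborel. integrable lborel (\<lambda>r. f x r * \<psi> r)"
    and "(LBINT x. \<bar>(LBINT r. f x r * \<psi> r) - c x\<bar>) \<le> e"
proof -
  have f_meas: "(\<lambda>z. f (fst z) (snd z)) \<in> borel_measurable lborel2"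
    using f by (simp add: case_prod_unfold)
  have [measurable]: "\<psi> \<in> borel_measurable borel"
    using cont by (rule borel_measurable_continuous_onI)
  have "compact (\<psi> ` {a..b})"
    by (rule compact_continuous_image) (use cont continuous_on_subset in auto)
  then obtain B where B: "\<forall>r\<in>{a..b}. \<bar>\<psi> r\<bar> \<le> B"
    by (auto dest!: compact_imp_bounded simp: bounded_iff)
  have B': "\<bar>\<psi> r\<bar> \<le> max 0 B" for r
    using B[rule_format, of r] supp[rule_format, of r] by (cases "r \<in> {a..b}") auto
  have f\<psi>: "integrable lborel2 (\<lambda>(x, r). f x r * \<psi> r)"
  proof (rule Bochner_Integration.integrable_bound)
    show "integrable lborel2 (\<lambda>(x, r). max 0 B * f x r)"
      using integrable_mult_right[OF f, of "max 0 B"] by (simp add: case_prod_unfold)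
    show "(\<lambda>(x, r). f x r * \<psi> r) \<in> borel_measurable lborel2"
      using f_meas by (simp add: case_prod_unfold)
    show "AE z in lborel2. norm (case z of (x, r) \<Rightarrow> f x r * \<psi> r)
        \<le> norm (case z of (x, r) \<Rightarrow> max 0 B * f x r)"
      by (rule AE_I2) (use B' in \<open>auto simp: abs_mult mult.commute[of _ "\<psi> _"] intro!: mult_right_mono\<close>)
  qed
  have \<psi>_int: "integrable lborel \<psi>" "(LBINT r. \<psi> r) = 1"
    using mass by (auto simp: has_bochner_integral_iff)
  have g: "integrable lborel2 (\<lambda>(x, r). (f x r - c x) * \<psi> r)"
    using Bochner_Integration.integrable_diff[OF f\<psi> integrable_lborel_prod_mult[OF c \<psi>_int(1)]]
    by (simp add: case_prod_unfold left_diff_distrib)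
  then have g_abs: "integrable lborel2 (\<lambda>(x, r). \<bar>f x r - c x\<bar> * \<psi> r)"
    using integrable_norm[OF g] nonneg by (simp add: case_prod_unfold abs_mult)
  show int: "integrable lborel (\<lambda>x. LBINT r. f x r * \<psi> r)"
    by (rule lborel_pair.integrable_fst[OF f\<psi>])
  show sec: "AE x in lborel. integrable lborel (\<lambda>r. f x r * \<psi> r)"
    by (rule lborel_pair.AE_integrable_fst[OF f\<psi>])
  have "(LBINT x. \<bar>(LBINT r. f x r * \<psi> r) - c x\<bar>)
      \<le> (LBINT x. (LBINT r. \<bar>f x r - c x\<bar> * \<psi> r))"
  proof (rule integral_mono_AE)
    show "integrable lborel (\<lambda>x. \<bar>(LBINT r. f x r * \<psi> r) - c x\<bar>)"
      using int c by simp
    show "integrable lborel (\<lambda>x. LBINT r. \<bar>f x r - c x\<bar> * \<psi> r)"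
      by (rule lborel_pair.integrable_fst[OF g_abs])
    show "AE x in lborel. \<bar>(LBINT r. f x r * \<psi> r) - c x\<bar> \<le> (LBINT r. \<bar>f x r - c x\<bar> * \<psi> r)"
      using sec
    proof eventually_elim
      case (elim x)
      have "(LBINT r. f x r * \<psi> r) - c x = (LBINT r. f x r * \<psi> r - c x * \<psi> r)"
        using elim \<psi>_int by simp
      also have "\<dots> = (LBINT r. (f x r - c x) * \<psi> r)"
        by (simp add: left_diff_distrib)
      finally show ?case
        using integral_norm_bound[of lborel "\<lambda>r. (f x r - c x) * \<psi> r"] nonneg
        by (simp add: abs_mult)
    qed
  qed
  also have "\<dots> = (LBINT r. (LBINT x. \<bar>f x r - c x\<bar> * \<psi> r))"
    by (rule lborel_pair.Fubini_integral[symmetric, OF g_abs])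
  also have "\<dots> \<le> (LBINT r. e * \<psi> r)"
  proof (rule integral_mono_AE)
    show "integrable lborel (\<lambda>r. LBINT x. \<bar>f x r - c x\<bar> * \<psi> r)"
      by (rule lborel_pair.integrable_snd[OF g_abs])
    show "AE r in lborel. (LBINT x. \<bar>f x r - c x\<bar> * \<psi> r) \<le> e * \<psi> r"
      using le
    proof eventually_elim
      case (elim r)
      then show ?case
        using supp[rule_format, of r] nonneg[of r] by (cases "r \<in> {a..b}") (auto intro!: mult_right_mono)
    qed
  qed (use \<psi>_int in simp)
  also have "\<dots> = e" using \<psi>_int by simp
  finally show "(LBINT x. \<bar>(LBINT r. f x r * \<psi> r) - c x\<bar>) \<le> e" .
qed

text \<open>
  The weak formulation is tested with trapezoids that approximate the indicator function of \<open>(0,t)\<close>. Their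
  derivatives average \<open>u\<close> over short intervals next to \<open>0\<close> and \<open>t\<close>; by continuity of \<open>u\<close> in
  \<open>L\<^sup>1\<close> these averages approach \<open>u(0)\<close> and \<open>u(t)\<close>. Since the exceptional sets depend on the test
  function, the identity is obtained by showing that the \<open>L\<^sup>1\<close> norm of the defect vanishes.
\<close>

lemma W11_primitive:
  fixes u v vb :: "real \<Rightarrow> real \<Rightarrow> real" and u0 :: "real \<Rightarrow> real"
  assumes W: "W11 T u v" and "0 < T"
    and u0: "integrable lborel u0" "\<And>x. x \<notin> Om \<Longrightarrow> u0 x = 0"
       "AE x in lborel. x \<in> Om \<longrightarrow> u x 0 = u0 x"
    and vb: "integrable lborel2 (\<lambda>(x, t). vb x t)"
       "\<And>x t. x \<notin> Om \<or> t \<notin> {0<..<T} \<Longrightarrow> vb x t = 0"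
       "AE z in lborel. z \<in> Om \<times> {0<..<T} \<longrightarrow> v (fst z) (snd z) = vb (fst z) (snd z)"
    and t: "t \<in> {0..T}"
  shows "AE x in lborel. x \<in> Om \<longrightarrow> u x t = u0 x + (LBINT r. indicator {0..t} r * vb x r)"
proof (cases "t = 0")
  case True
  have "(LBINT r. indicator {0..t} r * vb x r) = 0" for x
    by (rule integral_eq_zero_AE) (use True vb(2) in \<open>auto simp: indicator_def\<close>)
  with u0(3) True show ?thesis by simp
next
  case False
  with t have t: "0 < t" "t \<le> T" by auto
  note W' = W[unfolded W11_def]
  note u_int = W'[THEN conjunct1]
    and weak = W'[THEN conjunct2, THEN conjunct2, THEN conjunct1, rule_format]
    and u_slice = W'[THEN conjunct2, THEN conjunct2, THEN conjunct2, THEN conjunct1, rule_format]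
    and u_cont = W'[THEN conjunct2, THEN conjunct2, THEN conjunct2, THEN conjunct2, rule_format]
  have T_borel: "{0<..<T} \<in> sets borel" by simp
  obtain ub where ub: "integrable lborel2 (\<lambda>(x, t). ub x t)"
    "\<And>x t. x \<notin> Om \<or> t \<notin> {0<..<T} \<Longrightarrow> ub x t = 0"
    "AE z in lborel. z \<in> Om \<times> {0<..<T} \<longrightarrow> u (fst z) (snd z) = ub (fst z) (snd z)"
    by (rule product_representative_exists[OF Om_borel T_borel u_int]) (rule that)
  obtain ut where ut: "integrable lborel ut" "\<And>x. x \<notin> Om \<Longrightarrow> ut x = 0"
    "AE x in lborel. x \<in> Om \<longrightarrow> u x t = ut x"
    using OmM_representative_exists[OF u_slice[of t]] t by auto
  have u0_out: "\<forall>x. x \<notin> Om \<longrightarrow> u0 x = 0" and ut_out: "\<forall>x. x \<notin> Om \<longrightarrow> ut x = 0"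
    using u0(2) ut(2) by blast+
  have vb_meas: "(\<lambda>z. vb (fst z) (snd z)) \<in> borel_measurable lborel2"
    using vb(1) by (simp add: case_prod_unfold)
  have v_cut: "integrable lborel2 (\<lambda>(x, r). h r * vb x r)"
    if h: "h \<in> borel_measurable borel" "\<And>r. \<bar>h r\<bar> \<le> 1" for h :: "real \<Rightarrow> real"
  proof (rule Bochner_Integration.integrable_bound[OF vb(1)])
    have [measurable]: "h \<in> borel_measurable borel" by fact
    show "(\<lambda>(x, r). h r * vb x r) \<in> borel_measurable lborel2"
      using vb_meas by (simp add: case_prod_unfold)
    show "AE z in lborel2. norm (case z of (x, r) \<Rightarrow> h r * vb x r)
        \<le> norm (case z of (x, t) \<Rightarrow> vb x t)"
      by (rule AE_I2) (use h(2) in \<open>auto simp: abs_mult intro!: mult_left_le_one_le\<close>)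
  qed
  define E where "E x = (LBINT r. indicator {0<..<t} r * vb x r)" for x
  have E_int: "integrable lborel E"
    unfolding E_def by (rule lborel_pair.integrable_fst[OF v_cut]) (auto simp: indicator_def)
  have "(LBINT x. \<bar>u0 x - ut x + E x\<bar>) \<le> 3 * e" if "0 < e" for e
  proof -
    have slice_dist: "AE r in lborel. r \<in> {0<..<T} \<longrightarrow>
        (\<integral>x. \<bar>u x r - u x s\<bar> \<partial>OmM) = (LBINT x. \<bar>ub x r - us x\<bar>)"
      if "integrable lborel us" "\<forall>x. x \<notin> Om \<longrightarrow> us x = 0"
        "AE x in lborel. x \<in> Om \<longrightarrow> u x s = us x" for s us
      using AE_lborel_snd[OF ub(3)]
    proof eventually_elim
      case (elim r)
      have [measurable]: "us \<in> borel_measurable borel" using that(1) by auto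
      have [measurable]: "(\<lambda>x. ub x r) \<in> borel_measurable borel"
        using measurable_compose[OF measurable_Pair2'[of r lborel lborel]
          borel_measurable_integrable[OF ub(1)]] by simp
      show ?case
      proof
        assume r: "r \<in> {0<..<T}"
        show "(\<integral>x. \<bar>u x r - u x s\<bar> \<partial>OmM) = (LBINT x. \<bar>ub x r - us x\<bar>)"
        proof (rule integral_OmM_representative)
          show "AE x in lborel. x \<in> Om \<longrightarrow> \<bar>u x r - u x s\<bar> = \<bar>ub x r - us x\<bar>"
            using elim that(3) by eventually_elim (use r in auto)
        qed (use that(2) ub(2) in auto)
      qed
    qed
    have near: "\<exists>d>0. \<forall>r\<in>{0..T}. r \<noteq> s \<longrightarrow> \<bar>r - s\<bar> < d \<longrightarrow> (\<integral>x. \<bar>u x r - u x s\<bar> \<partial>OmM) < e"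
      if "s \<in> {0..T}" for s
      using tendstoD[OF u_cont[OF that] \<open>0 < e\<close>]
      by (auto simp: eventually_at dist_real_def)
    obtain d0 where d0: "d0 > 0"
        "\<And>r. r \<in> {0..T} \<Longrightarrow> r \<noteq> 0 \<Longrightarrow> \<bar>r - 0\<bar> < d0 \<Longrightarrow> (\<integral>x. \<bar>u x r - u x 0\<bar> \<partial>OmM) < e"
      using near[of 0] t by auto
    obtain d1 where d1: "d1 > 0"
        "\<And>r. r \<in> {0..T} \<Longrightarrow> r \<noteq> t \<Longrightarrow> \<bar>r - t\<bar> < d1 \<Longrightarrow> (\<integral>x. \<bar>u x r - u x t\<bar> \<partial>OmM) < e"
      using near[of t] t by auto
    \<comment> \<open>The trapezoid rises on \<open>[q,2q]\<close> and falls on \<open>[t-2q,t-q]\<close>; \<open>5q \<le> t\<close> keeps these intervals apart.\<close>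
    define q where "q k = t / (real k + 5)" for k :: nat
    have q_pos: "0 < q k" and q_le: "5 * q k \<le> t" for k
      using t by (auto simp: q_def field_simps)
    have q_lim: "q \<longlonglongrightarrow> 0"
      unfolding q_def by (rule tendsto_divide_0[OF tendsto_const])
        (intro filterlim_at_top_imp_at_infinity filterlim_tendsto_add_at_top[OF tendsto_const, 
          of _ _ 5, simplified add.commute] filterlim_real_sequentially)
    \<comment> \<open>Outside this set the trapezoid coincides with the indicator function of \<open>(0,t)\<close>.\<close>
    define A where "A k = {0<..2 * q k} \<union> {t - 2 * q k..<t}" for k
    have A_meas [measurable]: "A k \<in> sets borel" for k by (simp add: A_def)
    have "(\<lambda>k. \<integral>z. indicator (A k) (snd z) * \<bar>vb (fst z) (snd z)\<bar> \<partial>lborel2)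
        \<longlonglongrightarrow> (\<integral>z. 0 \<partial>lborel2)"
    proof (rule integral_dominated_convergence)
      show "integrable lborel2 (\<lambda>z. \<bar>vb (fst z) (snd z)\<bar>)"
        using integrable_norm[OF vb(1)] by (simp add: case_prod_unfold)
      show "AE z in lborel2.
          (\<lambda>k. indicator (A k) (snd z) * \<bar>vb (fst z) (snd z)\<bar>) \<longlonglongrightarrow> 0"
      proof (rule AE_I2, rule tendsto_eventually)
        fix z :: "real \<times> real"
        let ?r = "snd z"
        have "\<forall>\<^sub>F k in sequentially. ?r \<notin> A k"
        proof (cases "0 < ?r \<and> ?r < t")
          case True
          then have "\<forall>\<^sub>F k in sequentially. q k < min (?r / 2) ((t - ?r) / 2)"
            by (intro order_tendstoD(2)[OF q_lim]) auto
          then show ?thesis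
            by eventually_elim (auto simp: A_def)
        next
          case False
          have "?r \<notin> A k" for k
            using False q_pos[of k] q_le[of k] by (auto simp: A_def)
          then show ?thesis by simp
        qed
        then show "\<forall>\<^sub>F k in sequentially. indicator (A k) (snd z) * \<bar>vb (fst z) (snd z)\<bar> = 0"
          by eventually_elim simp
      qed
    qed (use vb_meas in \<open>auto simp: indicator_def intro!: AE_I2\<close>)
    then have lim: "(\<lambda>k. \<integral>z. indicator (A k) (snd z) * \<bar>vb (fst z) (snd z)\<bar> \<partial>lborel2)
        \<longlonglongrightarrow> 0" by simp
    have "\<forall>\<^sub>F k in sequentially.
        (\<integral>z. indicator (A k) (snd z) * \<bar>vb (fst z) (snd z)\<bar> \<partial>lborel2) < e
        \<and> q k < d0 / 3 \<and> q k < d1 / 3"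
      by (intro eventually_conj order_tendstoD(2)[OF lim] order_tendstoD(2)[OF q_lim])
        (use \<open>0 < e\<close> d0 d1 in auto)
    then obtain k where k:
        "(\<integral>z. indicator (A k) (snd z) * \<bar>vb (fst z) (snd z)\<bar> \<partial>lborel2) < e"
        "q k < d0 / 3" "q k < d1 / 3"
      by (auto simp: eventually_sequentially)
    have abcd: "0 < q k" "q k < 2 * q k" "2 * q k \<le> t - 2 * q k" "t - 2 * q k < t - q k" "t - q k < T"
      using q_pos[of k] q_le[of k] t by auto
    obtain \<eta> \<psi> \<theta> where \<eta>: "test_function T \<eta>" "deriv \<eta> = (\<lambda>r. \<psi> r - \<theta> r)"
      "\<And>r. 0 \<le> \<psi> r" "\<And>r. 0 \<le> \<theta> r"
      "\<And>r. r \<notin> {q k..2 * q k} \<Longrightarrow> \<psi> r = 0" "\<And>r. r \<notin> {t - 2 * q k..t - q k} \<Longrightarrow> \<theta> r = 0"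
      "continuous_on UNIV \<psi>" "continuous_on UNIV \<theta>" "continuous_on UNIV \<eta>"
      "has_bochner_integral lborel \<psi> 1" "has_bochner_integral lborel \<theta> 1"
      "\<And>r. 0 \<le> \<eta> r" "\<And>r. \<eta> r \<le> 1" "\<And>r. r \<in> {2 * q k..t - 2 * q k} \<Longrightarrow> \<eta> r = 1"
      "\<And>r. r \<notin> {q k..t - q k} \<Longrightarrow> \<eta> r = 0"
      by (rule trapezoidal_test_function[OF abcd]) (rule that)
    have supp: "\<forall>r. r \<notin> {q k..2 * q k} \<longrightarrow> \<psi> r = 0"
        "\<forall>r. r \<notin> {t - 2 * q k..t - q k} \<longrightarrow> \<theta> r = 0"
      using \<eta>(5,6) by blast+
    have [measurable]: "\<psi> \<in> borel_measurable borel" "\<theta> \<in> borel_measurable borel"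
        "\<eta> \<in> borel_measurable borel"
      using \<eta>(7-9) by (auto intro: borel_measurable_continuous_onI)
    have "AE r in lborel. r \<in> {q k..2 * q k} \<longrightarrow> (LBINT x. \<bar>ub x r - u0 x\<bar>) \<le> e"
      using slice_dist[OF u0(1) u0_out u0(3)]
    proof eventually_elim
      case (elim r)
      then show ?case
        using d0(2)[of r] k(2) abcd t by auto
    qed
    note A = L1_mollification_le[OF ub(1) u0(1) \<eta>(7,3) supp(1) \<eta>(10) this]
    have "AE r in lborel. r \<in> {t - 2 * q k..t - q k} \<longrightarrow> (LBINT x. \<bar>ub x r - ut x\<bar>) \<le> e"
      using slice_dist[OF ut(1) ut_out ut(3)]
    proof eventually_elim
      case (elim r)
      then show ?case
        using d1(2)[of r] k(3) abcd t by auto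
    qed
    note C = L1_mollification_le[OF ub(1) ut(1) \<eta>(8,4) supp(2) \<eta>(11) this]
    let ?A = "\<lambda>x. \<integral>r. ub x r * \<psi> r \<partial>lborel" and ?C = "\<lambda>x. \<integral>r. ub x r * \<theta> r \<partial>lborel"
    let ?E = "\<lambda>x. \<integral>r. \<eta> r * vb x r \<partial>lborel"
    have vc: "integrable lborel2 (\<lambda>(x, r). \<eta> r * vb x r)"
      by (rule v_cut) (use \<eta>(12,13) in auto)
    have E'_int: "integrable lborel ?E"
      by (rule lborel_pair.integrable_fst[OF vc])
    have identity: "AE x in lborel. ?A x - ?C x + ?E x = 0"
    proof -
      have "AE x in lborel. x \<in> Om \<longrightarrow>
           (\<integral>r. u x r * deriv \<eta> r \<partial>lebesgue_on {0<..<T})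
             = - (\<integral>r. v x r * \<eta> r \<partial>lebesgue_on {0<..<T})"
        using weak[OF \<eta>(1)] by (simp add: AE_lebesgue_on_iff)
      then show ?thesis
        using AE_lborel_fst[OF ub(3)] AE_lborel_fst[OF vb(3)] A(2) C(2)
      proof eventually_elim
        case (elim x)
        show ?case
        proof (cases "x \<in> Om")
          case True
          have [measurable]: "(\<lambda>r. ub x r) \<in> borel_measurable borel"
            using measurable_compose[OF measurable_Pair1'[of x lborel lborel]
              borel_measurable_integrable[OF ub(1)]] by simp
          have [measurable]: "(\<lambda>r. vb x r) \<in> borel_measurable borel"
            using measurable_compose[OF measurable_Pair1'[of x lborel lborel]
              borel_measurable_integrable[OF vb(1)]] by simp
          have "(\<integral>r. u x r * deriv \<eta> r \<partial>lebesgue_on {0<..<T})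
              = (LBINT r. indicator {0<..<T} r * (ub x r * (\<psi> r - \<theta> r)))"
          proof (rule lebesgue_on_representative(3))
            show "AE r in lborel. r \<in> {0<..<T} \<longrightarrow> u x r * deriv \<eta> r = ub x r * (\<psi> r - \<theta> r)"
              using elim(2) by eventually_elim (use True \<eta>(2) in auto)
          qed auto
          also have "\<dots> = (LBINT r. ub x r * \<psi> r - ub x r * \<theta> r)"
            by (rule Bochner_Integration.integral_cong)
              (use ub(2) in \<open>auto simp: indicator_def algebra_simps\<close>)
          also have "\<dots> = ?A x - ?C x"
            by (rule Bochner_Integration.integral_diff[OF elim(4,5)])
          finally have 1: "(\<integral>r. u x r * deriv \<eta> r \<partial>lebesgue_on {0<..<T}) = ?A x - ?C x" .
          have "(\<integral>r. v x r * \<eta> r \<partial>lebesgue_on {0<..<T})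
              = (LBINT r. indicator {0<..<T} r * (\<eta> r * vb x r))"
          proof (rule lebesgue_on_representative(3))
            show "AE r in lborel. r \<in> {0<..<T} \<longrightarrow> v x r * \<eta> r = \<eta> r * vb x r"
              using elim(3) by eventually_elim (use True in auto)
          qed auto
          also have "\<dots> = ?E x"
            by (rule Bochner_Integration.integral_cong) (use vb(2) in \<open>auto simp: indicator_def\<close>)
          finally show ?thesis
            using elim(1) True 1 by simp
        qed (use ub(2) vb(2) in simp)
      qed
    qed
    have vA: "integrable lborel2 (\<lambda>(x, r). indicator (A k) r * \<bar>vb x r\<bar>)"
      using integrable_norm[OF v_cut[of "indicator (A k)"]]
      by (simp add: case_prod_unfold abs_mult indicator_def)
    have "(LBINT x. \<bar>E x - ?E x\<bar>)
        \<le> (LBINT x. (LBINT r. indicator (A k) r * \<bar>vb x r\<bar>))"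
    proof (rule integral_mono_AE)
      show "integrable lborel (\<lambda>x. LBINT r. indicator (A k) r * \<bar>vb x r\<bar>)"
        by (rule lborel_pair.integrable_fst[OF vA])
      show "integrable lborel (\<lambda>x. \<bar>E x - ?E x\<bar>)"
        using E_int E'_int by simp
      have ic: "integrable lborel2 (\<lambda>(x, r). indicator {0<..<t} r * vb x r)"
        by (rule v_cut) (auto simp: indicator_def)
      show "AE x in lborel. \<bar>E x - ?E x\<bar> \<le> (LBINT r. indicator (A k) r * \<bar>vb x r\<bar>)"
        using lborel_pair.AE_integrable_fst[OF vA] lborel_pair.AE_integrable_fst[OF ic]
          lborel_pair.AE_integrable_fst[OF vc]
      proof eventually_elim
        case (elim x)
        have "E x - ?E x = (LBINT r. indicator {0<..<t} r * vb x r - \<eta> r * vb x r)"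
          using elim by (simp add: E_def)
        also have "\<bar>\<dots>\<bar> \<le> (LBINT r. indicator (A k) r * \<bar>vb x r\<bar>)"
        proof (rule integral_abs_bound[THEN order_trans], rule integral_mono)
          show "\<bar>indicator {0<..<t} r * vb x r - \<eta> r * vb x r\<bar> \<le> indicator (A k) r * \<bar>vb x r\<bar>" for r
          proof -
            have "\<bar>indicator {0<..<t} r - \<eta> r\<bar> \<le> (indicator (A k) r :: real)"
              using \<eta>(12-15)[of r] abcd by (auto simp: indicator_def A_def)
            then have "\<bar>indicator {0<..<t} r - \<eta> r\<bar> * \<bar>vb x r\<bar> \<le> indicator (A k) r * \<bar>vb x r\<bar>"
              by (rule mult_right_mono) simp
            then show ?thesis
              by (simp add: abs_mult[symmetric] left_diff_distrib)
          qed
        qed (use elim in auto)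
        finally show ?case .
      qed
    qed
    also have "\<dots> < e"
      using k(1) by (simp add: lborel_pair.integral_fst[OF vA] case_prod_unfold)
    finally have EE: "(LBINT x. \<bar>E x - ?E x\<bar>) < e" .
    have "(LBINT x. \<bar>u0 x - ut x + E x\<bar>)
        \<le> (LBINT x. \<bar>?A x - u0 x\<bar> + \<bar>?C x - ut x\<bar> + \<bar>E x - ?E x\<bar>)"
    proof (rule integral_mono_AE)
      show "AE x in lborel. \<bar>u0 x - ut x + E x\<bar> \<le> \<bar>?A x - u0 x\<bar> + \<bar>?C x - ut x\<bar> + \<bar>E x - ?E x\<bar>"
        using identity by eventually_elim auto
    qed (use A(1) C(1) E_int E'_int u0(1) ut(1) in auto)
    also have "\<dots> = (LBINT x. \<bar>?A x - u0 x\<bar>) + (LBINT x. \<bar>?C x - ut x\<bar>)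
        + (LBINT x. \<bar>E x - ?E x\<bar>)"
      using A(1) C(1) E_int E'_int u0(1) ut(1) by simp
    finally show ?thesis
      using A(3) C(3) EE by simp
  qed
  note small = this
  have "(LBINT x. \<bar>u0 x - ut x + E x\<bar>) \<le> 0"
  proof (rule field_le_epsilon)
    fix e :: real assume "0 < e"
    then show "(LBINT x. \<bar>u0 x - ut x + E x\<bar>) \<le> 0 + e"
      using small[of "e / 3"] by simp
  qed
  moreover have "0 \<le> (LBINT x. \<bar>u0 x - ut x + E x\<bar>)"
    by simp
  ultimately have "(LBINT x. \<bar>u0 x - ut x + E x\<bar>) = 0" by linarith
  then have "AE x in lborel. \<bar>u0 x - ut x + E x\<bar> = 0"
    by (subst (asm) integral_nonneg_eq_0_iff_AE) (use u0(1) ut(1) E_int in auto)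
  then show ?thesis
    using ut(3)
  proof eventually_elim
    case (elim x)
    have [measurable]: "(\<lambda>r. vb x r) \<in> borel_measurable borel"
      using measurable_compose[OF measurable_Pair1'[of x lborel lborel]
        borel_measurable_integrable[OF vb(1)]] by simp
    have "E x = (LBINT r. indicator {0..t} r * vb x r)"
      unfolding E_def
    proof (rule integral_cong_AE)
      show "AE r in lborel. indicator {0<..<t} r * vb x r = indicator {0..t} r * vb x r"
        using AE_lborel_singleton[of 0] AE_lborel_singleton[of t]
        by eventually_elim (auto simp: indicator_def)
    qed auto
    with elim show ?case by auto
  qed
qed

section \<open>Convex entropies and their chain rule\<close>

text \<open>
  A convex \<open>J\<close> with Lipschitz constant \<open>1\<close>, and a continuous selection \<open>q\<close> of its subdifferential. The subgradient inequality is
  the form of convexity that bounds increments of \<open>J\<close> along a path by increments of the path.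
\<close>

definition entropy_pair :: "(real \<Rightarrow> real) \<Rightarrow> (real \<Rightarrow> real) \<Rightarrow> bool" where
  "entropy_pair J q \<longleftrightarrow> J 0 = 0 \<and> (\<forall>c d. J d - J c \<le> q d * (d - c)) \<and>
     continuous_on UNIV q \<and> mono q \<and> (\<forall>d. \<bar>q d\<bar> \<le> 1)"

lemma entropy_pair_lipschitz:
  assumes "entropy_pair J q"
  shows "\<bar>J d - J c\<bar> \<le> \<bar>d - c\<bar>"
proof -
  have *: "J d - J c \<le> \<bar>d - c\<bar>" for c d
  proof -
    have "J d - J c \<le> q d * (d - c)" using assms by (auto simp: entropy_pair_def)
    also have "\<dots> \<le> \<bar>q d\<bar> * \<bar>d - c\<bar>" by (simp add: abs_mult[symmetric])
    also have "\<dots> \<le> 1 * \<bar>d - c\<bar>"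
      by (rule mult_right_mono) (use assms in \<open>auto simp: entropy_pair_def\<close>)
    finally show ?thesis by simp
  qed
  from *[of d c] *[of c d] show ?thesis by (simp add: abs_le_iff abs_minus_commute)
qed

lemma entropy_pair_le_abs: "entropy_pair J q \<Longrightarrow> \<bar>J d\<bar> \<le> \<bar>d\<bar>"
  using entropy_pair_lipschitz[of J q d 0] by (simp add: entropy_pair_def)

lemma entropy_pair_measurable:
  assumes "entropy_pair J q"
  shows "J \<in> borel_measurable borel" "q \<in> borel_measurable borel"
proof -
  have "1-lipschitz_on UNIV J"
    by (rule lipschitz_onI) (use entropy_pair_lipschitz[OF assms] in \<open>auto simp: dist_real_def\<close>)
  then show "J \<in> borel_measurable borel"
    by (intro borel_measurable_continuous_onI lipschitz_on_continuous_on)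
  show "q \<in> borel_measurable borel"
    using assms by (intro borel_measurable_continuous_onI) (simp add: entropy_pair_def)
qed

text \<open>
  On an interval \<open>[s,t]\<close> the subgradient inequality gives
  \<open>J(D(t)) - J(D(s)) \<le> q(D(t)) (D(t) - D(s))\<close>. If the interval is so short that \<open>q \<circ> D\<close> varies by at most \<open>e\<close>, the
  factor \<open>q(D(t))\<close> may be moved under the integral at the cost of \<open>e\<close> times the integral of \<open>|f|\<close>. This estimate is
  additive in the interval, so bisection extends it from short intervals to \<open>[a,b]\<close>.
\<close>

lemma convex_chain_rule:
  fixes D f J q :: "real \<Rightarrow> real"
  assumes ab: "a \<le> b" and f: "f absolutely_integrable_on {a..b}"
    and D: "\<And>s. s \<in> {a..b} \<Longrightarrow> D s = D a + integral {a..s} f"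
    and Jq: "entropy_pair J q"
  shows "J (D b) - J (D a) \<le> integral {a..b} (\<lambda>r. q (D r) * f r)"
proof -
  have J: "J d - J c \<le> q d * (d - c)" for c d
    using Jq by (simp add: entropy_pair_def)
  have f_int: "f integrable_on {a..b}"
    by (rule set_lebesgue_integral_eq_integral(1)[OF f])
  have D_cont: "continuous_on {a..b} D"
  proof (rule continuous_on_eq)
    show "continuous_on {a..b} (\<lambda>s. D a + integral {a..s} f)"
      by (intro continuous_intros indefinite_integral_continuous_1 f_int)
  qed (rule D[symmetric])
  have qD_cont: "continuous_on {a..b} (\<lambda>r. q (D r))"
    by (rule continuous_on_compose2[OF _ D_cont, of UNIV])
      (use Jq in \<open>auto simp: entropy_pair_def\<close>)
  have qf: "(\<lambda>r. q (D r) * f r) absolutely_integrable_on {a..b}"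
    by (rule absolutely_integrable_bounded_measurable_product_real)
      (use qD_cont f Jq in \<open>auto simp: bounded_iff entropy_pair_def
        intro!: continuous_imp_measurable_on_sets_lebesgue\<close>)
  have abs_f: "(\<lambda>r. \<bar>f r\<bar>) absolutely_integrable_on {a..b}"
    using absolutely_integrable_norm[OF f] by (simp add: o_def)
  have sub: "h integrable_on {s..t}"
    if "h absolutely_integrable_on {a..b}" "a \<le> s" "t \<le> b" for h :: "real \<Rightarrow> real" and s t
    by (rule integrable_subinterval_real[OF set_lebesgue_integral_eq_integral(1)[OF that(1)]])
      (use that in auto)
  have bound: "J (D b) - J (D a) \<le> integral {a..b} (\<lambda>r. q (D r) * f r) + e * integral {a..b} (\<lambda>r. \<bar>f r\<bar>)"
    if "0 < e" for e
  proof -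
    have "uniformly_continuous_on {a..b} (\<lambda>r. q (D r))"
      by (rule compact_uniformly_continuous[OF qD_cont]) simp
    then obtain d where d: "d > 0"
        "\<And>s t. s \<in> {a..b} \<Longrightarrow> t \<in> {a..b} \<Longrightarrow> \<bar>t - s\<bar> < d \<Longrightarrow> \<bar>q (D t) - q (D s)\<bar> < e"
      using \<open>0 < e\<close> unfolding uniformly_continuous_on_def dist_real_def by metis
    define P where "P s t \<longleftrightarrow> (a \<le> s \<longrightarrow> s \<le> t \<longrightarrow> t \<le> b \<longrightarrow>
        J (D t) - J (D s) \<le> integral {s..t} (\<lambda>r. q (D r) * f r) + e * integral {s..t} (\<lambda>r. \<bar>f r\<bar>))" for s t
    have "P a b"
    proof (rule Bolzano[where P = P, OF ab])
      fix r s t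
      assume trans: "P r s" "P s t" "r \<le> s" "s \<le> t"
      show "P r t"
        unfolding P_def
      proof (intro impI)
        assume *: "a \<le> r" "r \<le> t" "t \<le> b"
        have "integral {r..s} (\<lambda>r. q (D r) * f r) + integral {s..t} (\<lambda>r. q (D r) * f r)
            = integral {r..t} (\<lambda>r. q (D r) * f r)"
          "integral {r..s} (\<lambda>r. \<bar>f r\<bar>) + integral {s..t} (\<lambda>r. \<bar>f r\<bar>) = integral {r..t} (\<lambda>r. \<bar>f r\<bar>)"
          using trans * sub[OF qf, of r t] sub[OF abs_f, of r t]
          by (auto intro!: Henstock_Kurzweil_Integration.integral_combine)
        moreover have "J (D s) - J (D r)
            \<le> integral {r..s} (\<lambda>r. q (D r) * f r) + e * integral {r..s} (\<lambda>r. \<bar>f r\<bar>)"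
          "J (D t) - J (D s)
            \<le> integral {s..t} (\<lambda>r. q (D r) * f r) + e * integral {s..t} (\<lambda>r. \<bar>f r\<bar>)"
          using trans * by (auto simp: P_def)
        ultimately show "J (D t) - J (D r)
            \<le> integral {r..t} (\<lambda>r. q (D r) * f r) + e * integral {r..t} (\<lambda>r. \<bar>f r\<bar>)"
          by (smt (verit) distrib_left)
      qed
    next
      fix x
      assume "a \<le> x" "x \<le> b"
      have "P s t" if "s \<le> x" "x \<le> t" "t - s < d" for s t
        unfolding P_def
      proof (intro impI)
        assume *: "a \<le> s" "s \<le> t" "t \<le> b"
        have "integral {a..s} f + integral {s..t} f = integral {a..t} f"
          by (rule Henstock_Kurzweil_Integration.integral_combine) (use * f in \<open>auto intro: sub\<close>)
        then have Dst: "D t - D s = integral {s..t} f"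
          using D[of s] D[of t] * by auto
        have "J (D t) - J (D s) \<le> q (D t) * integral {s..t} f"
          using J[of "D t" "D s"] Dst by simp
        also have "\<dots> = integral {s..t} (\<lambda>r. q (D t) * f r)"
          by simp
        also have "\<dots> \<le> integral {s..t} (\<lambda>r. q (D r) * f r + e * \<bar>f r\<bar>)"
        proof (rule integral_le)
          show "(\<lambda>r. q (D t) * f r) integrable_on {s..t}"
            using sub[OF f] * by (auto intro!: integrable_on_mult_right)
          show "(\<lambda>r. q (D r) * f r + e * \<bar>f r\<bar>) integrable_on {s..t}"
            using sub[OF qf] sub[OF abs_f] *
            by (intro Henstock_Kurzweil_Integration.integrable_add integrable_on_mult_right) auto
          show "q (D t) * f r \<le> q (D r) * f r + e * \<bar>f r\<bar>" if "r \<in> {s..t}" for r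
          proof -
            have "(q (D t) - q (D r)) * f r \<le> \<bar>q (D t) - q (D r)\<bar> * \<bar>f r\<bar>"
              by (simp add: abs_mult[symmetric])
            also have "\<dots> \<le> e * \<bar>f r\<bar>"
              using d(2)[of r t] that * \<open>t - s < d\<close> by (intro mult_right_mono) auto
            finally show ?thesis by (simp add: algebra_simps)
          qed
        qed
        also have "\<dots> = integral {s..t} (\<lambda>r. q (D r) * f r) + e * integral {s..t} (\<lambda>r. \<bar>f r\<bar>)"
          using sub[OF qf] sub[OF abs_f] *
          by (subst Henstock_Kurzweil_Integration.integral_add)
            (auto intro!: integrable_on_mult_right)
        finally show "J (D t) - J (D s)
            \<le> integral {s..t} (\<lambda>r. q (D r) * f r) + e * integral {s..t} (\<lambda>r. \<bar>f r\<bar>)" .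
      qed
      then show "\<exists>d>0. \<forall>s t. s \<le> x \<and> x \<le> t \<and> t - s < d \<longrightarrow> P s t"
        using d(1) by blast
    qed
    then show ?thesis using ab by (simp add: P_def)
  qed
  show ?thesis
  proof (rule field_le_epsilon)
    fix e :: real assume e: "0 < e"
    let ?F = "integral {a..b} (\<lambda>r. \<bar>f r\<bar>)"
    have F: "0 \<le> ?F"
      by (rule Henstock_Kurzweil_Integration.integral_nonneg) (use sub[OF abs_f] in auto)
    then have "e / (?F + 1) * ?F \<le> e"
      using e by (simp add: field_simps)
    then show "J (D b) - J (D a) \<le> integral {a..b} (\<lambda>r. q (D r) * f r) + e"
      using bound[of "e / (?F + 1)"] e F by (smt (verit) divide_pos_pos)
  qed
qed

text \<open>
  \<open>soft_abs M e\<close> is the Legendre transform of \<open>M|q| + e q\<^sup>2/2\<close> on \<open>[-1,1]\<close>: the distance to \<open>[-M,M]\<close>, with its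
  corners rounded as in the Huber function, and \<open>soft_clip M e\<close> is the maximiser.
\<close>

definition soft_clip :: "real \<Rightarrow> real \<Rightarrow> real \<Rightarrow> real" where
  "soft_clip M e d = max (- 1) (min 1 ((d - max (- M) (min M d)) / e))"

definition soft_abs :: "real \<Rightarrow> real \<Rightarrow> real \<Rightarrow> real" where
  "soft_abs M e d = soft_clip M e d * d - M * \<bar>soft_clip M e d\<bar> - e * (soft_clip M e d)\<^sup>2 / 2"

text \<open>
  The maximiser property, from which convexity and all bounds on \<open>soft_abs\<close> follow by choosing \<open>q\<close>.
\<close>

lemma soft_abs_ge:
  assumes "0 \<le> M" "0 < e" "\<bar>q\<bar> \<le> 1"
  shows "q * d - M * \<bar>q\<bar> - e * q\<^sup>2 / 2 \<le> soft_abs M e d"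
proof -
  have pos: "q * d - M * \<bar>q\<bar> - e * q\<^sup>2 / 2 \<le> soft_abs M e d" if "M < d" "\<bar>q\<bar> \<le> 1" for q d
  proof -
    define s where "s = (d - M) / e"
    have s: "0 < s" "d = M + e * s" using that assms by (auto simp: s_def)
    have clip: "soft_clip M e d = min 1 s"
    proof -
      have "max (- M) (min M d) = M" using that assms by simp
      then show ?thesis using s(1) by (simp add: soft_clip_def s_def[symmetric])
    qed
    have abs: "soft_abs M e d = e * (min 1 s * s - (min 1 s)\<^sup>2 / 2)"
      unfolding soft_abs_def clip using s by (simp add: algebra_simps)
    have 1: "q * d - M * \<bar>q\<bar> \<le> e * (q * s)"
    proof (cases "0 \<le> q")
      case False
      then have "M * q \<le> 0" using assms by (simp add: mult_nonneg_nonpos)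
      with False show ?thesis by (simp add: s(2) algebra_simps)
    qed (simp add: s(2) algebra_simps)
    have "q * s - q\<^sup>2 / 2 \<le> min 1 s * s - (min 1 s)\<^sup>2 / 2"
    proof (cases "s \<le> 1")
      case True
      have "0 \<le> (s - q)\<^sup>2" by simp
      then show ?thesis using True by (simp add: power2_eq_square algebra_simps)
    next
      case False
      have "0 \<le> (1 - q) * (s - (1 + q) / 2)"
        using False that by (intro mult_nonneg_nonneg) auto
      then show ?thesis using False by (simp add: power2_eq_square algebra_simps diff_divide_distrib)
    qed
    then have "e * (q * s - q\<^sup>2 / 2) \<le> soft_abs M e d"
      unfolding abs using assms by simp
    with 1 show ?thesis by (simp add: algebra_simps)
  qed
  consider "M < d" | "M < - d" | "- M \<le> d" "d \<le> M" by linarith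
  then show ?thesis
  proof cases
    case 2
    have "soft_clip M e (- d) = - soft_clip M e d"
      using assms 2 by (auto simp: soft_clip_def min_def max_def field_simps)
    then have "soft_abs M e (- d) = soft_abs M e d"
      by (simp add: soft_abs_def)
    with pos[OF 2, of "- q"] assms show ?thesis by simp
  next
    case 3
    then have "soft_abs M e d = 0" by (simp add: soft_abs_def soft_clip_def)
    moreover have "q * d \<le> M * \<bar>q\<bar>"
    proof -
      have "q * d \<le> \<bar>q\<bar> * \<bar>d\<bar>" by (simp add: abs_mult[symmetric])
      also have "\<dots> \<le> \<bar>q\<bar> * M" using 3 by (intro mult_left_mono) auto
      finally show ?thesis by (simp add: mult.commute)
    qed
    ultimately show ?thesis using assms(2) by (smt (verit) divide_nonneg_nonneg mult_nonneg_nonneg zero_le_power2)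
  qed (use pos assms in auto)
qed

lemma soft_abs_entropy:
  assumes "0 \<le> M" "0 < e"
  shows "entropy_pair (soft_abs M e) (soft_clip M e)"
  unfolding entropy_pair_def
proof (intro conjI allI)
  show q1: "\<bar>soft_clip M e d\<bar> \<le> 1" for d by (auto simp: soft_clip_def)
  show "soft_abs M e 0 = 0" using assms by (simp add: soft_abs_def soft_clip_def)
  show "soft_abs M e d - soft_abs M e c \<le> soft_clip M e d * (d - c)" for c d
    using soft_abs_ge[OF assms q1[of d], of c] by (simp add: soft_abs_def[of M e d] algebra_simps)
  show "continuous_on UNIV (soft_clip M e)"
    unfolding soft_clip_def using assms by (intro continuous_intros) auto
  show "mono (soft_clip M e)"
  proof (rule monoI)
    fix c d :: real assume "c \<le> d"
    then have "c - max (- M) (min M c) \<le> d - max (- M) (min M d)"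
      by (simp add: max_def min_def)
    then have "(c - max (- M) (min M c)) / e \<le> (d - max (- M) (min M d)) / e"
      using assms by (simp add: divide_right_mono)
    then show "soft_clip M e c \<le> soft_clip M e d"
      unfolding soft_clip_def by (intro max.mono min.mono order_refl)
  qed
qed

lemma soft_abs_zero: "\<bar>d\<bar> \<le> M \<Longrightarrow> soft_abs M e d = 0"
  by (simp add: soft_abs_def soft_clip_def abs_le_iff)

lemma soft_abs_nonneg: "0 \<le> M \<Longrightarrow> 0 < e \<Longrightarrow> 0 \<le> soft_abs M e d"
  using soft_abs_ge[of M e 0 d] by simp

lemma soft_abs_pos:
  assumes "0 \<le> M" "0 < e" "M < \<bar>d\<bar>"
  shows "0 < soft_abs M e d"
proof -
  define s where "s = min 1 ((\<bar>d\<bar> - M) / e)"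
  have s: "0 < s" "s \<le> 1" using assms by (auto simp: s_def)
  have "s * e \<le> \<bar>d\<bar> - M"
    using assms by (simp add: s_def min_def field_simps)
  have "0 < s * ((\<bar>d\<bar> - M) - s * e / 2)"
    using s assms \<open>s * e \<le> \<bar>d\<bar> - M\<close> by (intro mult_pos_pos) auto
  also have "\<dots> = (sgn d * s) * d - M * \<bar>sgn d * s\<bar> - e * (sgn d * s)\<^sup>2 / 2"
    using s assms by (auto simp: sgn_if power2_eq_square algebra_simps abs_mult)
  also have "\<dots> \<le> soft_abs M e d"
    by (rule soft_abs_ge) (use s assms in \<open>auto simp: abs_mult sgn_if\<close>)
  finally show ?thesis .
qed

lemma soft_abs_ge_abs: "0 < e \<Longrightarrow> \<bar>d\<bar> - e / 2 \<le> soft_abs 0 e d"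
  using soft_abs_ge[of 0 e "if d < 0 then - 1 else 1" d] by (cases "d < 0") simp_all

section \<open>Contraction for the nonlocal flow\<close>

text \<open>
  Accretivity: exchanging the variables replaces \<open>s(x)\<close> by half of \<open>s(x) - s(y)\<close>.
\<close>

lemma antisymmetric_integral_nonpos:
  fixes K \<Psi> :: "real \<Rightarrow> real \<Rightarrow> real" and s :: "real \<Rightarrow> real"
  assumes int: "integrable lborel2 (\<lambda>(x, y). K x y * \<Psi> x y)"
    and K: "\<And>x y. 0 \<le> K x y" "\<And>x y. K x y = K y x"
    and \<Psi>: "\<And>x y. \<Psi> y x = - \<Psi> x y"
    and s: "s \<in> borel_measurable borel" "\<And>x. \<bar>s x\<bar> \<le> 1"
    and sign: "\<And>x y. (s x - s y) * \<Psi> x y \<le> 0"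
  shows "(LBINT x. s x * (LBINT y. K x y * \<Psi> x y)) \<le> 0"
proof -
  have [measurable]: "s \<in> borel_measurable borel" by fact
  have meas: "(\<lambda>z. K (fst z) (snd z) * \<Psi> (fst z) (snd z)) \<in> borel_measurable lborel2"
    using int by (simp add: case_prod_unfold)
  have G: "integrable lborel2 (\<lambda>(x, y). s x * (K x y * \<Psi> x y))"
  proof (rule Bochner_Integration.integrable_bound[OF int])
    show "(\<lambda>(x, y). s x * (K x y * \<Psi> x y)) \<in> borel_measurable lborel2"
      using meas by (simp add: case_prod_unfold)
    show "AE z in lborel2. norm (case z of (x, y) \<Rightarrow> s x * (K x y * \<Psi> x y))
        \<le> norm (case z of (x, y) \<Rightarrow> K x y * \<Psi> x y)"
      by (rule AE_I2) (use s in \<open>auto simp: abs_mult[of "s _"] intro!: mult_left_le_one_le\<close>)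
  qed
  let ?I = "\<integral>z. (case z of (x, y) \<Rightarrow> s x * (K x y * \<Psi> x y)) \<partial>lborel2"
  have "?I = (\<integral>z. (case z of (x, y) \<Rightarrow> s y * (K y x * \<Psi> y x)) \<partial>lborel2)"
    using lborel_pair.integral_product_swap[OF borel_measurable_integrable[OF G], symmetric]
    by (simp add: case_prod_unfold)
  moreover have G': "integrable lborel2 (\<lambda>(x, y). s y * (K y x * \<Psi> y x))"
    using lborel_pair.integrable_product_swap[OF G] by (simp add: case_prod_unfold)
  ultimately have "- (2 * ?I) = (\<integral>z. - ((case z of (x, y) \<Rightarrow> s x * (K x y * \<Psi> x y))
      + (case z of (x, y) \<Rightarrow> s y * (K y x * \<Psi> y x))) \<partial>lborel2)"
    using G by (simp del: minus_add_distrib)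
  moreover have "0 \<le> \<dots>"
  proof (rule integral_nonneg_AE, rule AE_I2)
    fix z :: "real \<times> real"
    obtain x y where z: "z = (x, y)" by (cases z)
    have "s x * (K x y * \<Psi> x y) + s y * (K y x * \<Psi> y x) = K x y * ((s x - s y) * \<Psi> x y)"
      using K(2)[of y x] \<Psi>[of x y] by (simp add: algebra_simps)
    also have "\<dots> \<le> 0"
      by (rule mult_nonneg_nonpos[OF K(1) sign])
    finally show "0 \<le> - ((case z of (x, y) \<Rightarrow> s x * (K x y * \<Psi> x y))
        + (case z of (x, y) \<Rightarrow> s y * (K y x * \<Psi> y x)))"
      by (simp add: z)
  qed
  ultimately have "?I \<le> 0" by linarith
  moreover have "?I = (LBINT x. (LBINT y. s x * (K x y * \<Psi> x y)))"
    by (rule lborel_pair.integral_fst[OF G, symmetric])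
  ultimately show ?thesis by simp
qed

text \<open>
  The representative of a solution with which the proof works: unlike \<open>u\<close> itself, it is jointly Borel measurable,
  and for almost every \<open>x\<close> it is absolutely continuous in time.
\<close>

definition primitive :: "(real \<Rightarrow> real) \<Rightarrow> (real \<Rightarrow> real \<Rightarrow> real) \<Rightarrow> real \<Rightarrow> real \<Rightarrow> real" where
  "primitive u0 v x s = u0 x + (LBINT r. indicator {0..s} r * v x r)"

lemma primitive_0: "primitive u0 v x 0 = u0 x"
proof -
  have "(LBINT r. indicator {0..0} r * v x r) = 0"
    by (rule integral_eq_zero_AE, rule AE_mp[OF AE_lborel_singleton[of 0]])
      (auto simp: indicator_def intro!: AE_I2)
  then show ?thesis by (simp add: primitive_def)
qed

lemma primitive_measurable:
  assumes "integrable lborel u0" "integrable lborel2 (\<lambda>(x, r). v x r)"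
  shows "(\<lambda>z. primitive u0 v (fst z) (snd z)) \<in> borel_measurable lborel2"
    and "(\<lambda>x. primitive u0 v x s) \<in> borel_measurable borel"
proof -
  have [measurable]: "u0 \<in> borel_measurable borel" using assms(1) by auto
  have [measurable]: "case_prod v \<in> borel_measurable lborel2" using assms(2) by auto
  have *: "indicator {0..s} r = (of_bool (0 \<le> r \<and> r \<le> s) :: real)" for r s :: real
    by (simp add: indicator_def)
  show "(\<lambda>z. primitive u0 v (fst z) (snd z)) \<in> borel_measurable lborel2"
    unfolding primitive_def * by measurable
  from measurable_compose[OF measurable_Pair2'[of s lborel lborel] this]
  show "(\<lambda>x. primitive u0 v x s) \<in> borel_measurable borel" by simp
qed

text \<open>
  Functions on \<open>\<Omega>\<close> are extended by \<open>0\<close> to the real line, so that all integrals are over the whole line or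
  plane. Accretivity rests on the symmetry and the sign of the kernel and on \<open>\<phi>\<close> being odd and monotone.
\<close>

locale nonlocal_flow =
  fixes K :: "real \<Rightarrow> real \<Rightarrow> real" and \<phi> :: "real \<Rightarrow> real"
    and u0 :: "real \<Rightarrow> real" and v :: "real \<Rightarrow> real \<Rightarrow> real" and T :: real
  assumes K_nonneg: "\<And>x y. 0 \<le> K x y" and K_sym: "\<And>x y. K x y = K y x"
    and phi_mono: "mono \<phi>" and phi_odd: "\<And>r. \<phi> (- r) = - \<phi> r"
    and u0_int: "integrable lborel u0"
    and v_int: "integrable lborel2 (\<lambda>(x, r). v x r)"
    and flow: "AE s in lborel. s \<in> {0<..<T} \<longrightarrow>
      flux_integrable K \<phi> (\<lambda>x. primitive u0 v x s) \<and>
      (AE x in lborel. v x s = flux K \<phi> (\<lambda>x. primitive u0 v x s) x)"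
begin

abbreviation "U \<equiv> primitive u0 v"

lemma v_meas: "(\<lambda>z. v (fst z) (snd z)) \<in> borel_measurable lborel2"
  using v_int by (simp add: case_prod_unfold)

lemma v_sections [measurable]: "(\<lambda>r. v x r) \<in> borel_measurable borel"
  using measurable_compose[OF measurable_Pair1'[of x lborel lborel] v_meas] by simp

lemmas U_meas = primitive_measurable(1)[OF u0_int v_int]

lemmas U_section_meas [measurable] = primitive_measurable(2)[OF u0_int v_int]

lemma v_cut_integrable:
  assumes "A \<in> sets borel"
  shows "integrable lborel2 (\<lambda>(x, r). indicator A r * v x r)"
proof (rule Bochner_Integration.integrable_bound[OF v_int])
  have [measurable]: "A \<in> sets borel" by fact
  show "(\<lambda>(x, r). indicator A r * v x r) \<in> borel_measurable lborel2"
    using v_meas by (simp add: case_prod_unfold)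
  show "AE z in lborel2. norm (case z of (x, r) \<Rightarrow> indicator A r * v x r)
      \<le> norm (case z of (x, r) \<Rightarrow> v x r)"
    by (rule AE_I2) (auto simp: indicator_def)
qed

lemma U_integrable: "integrable lborel (\<lambda>x. U x s)"
  unfolding primitive_def
  by (intro Bochner_Integration.integrable_add u0_int lborel_pair.integrable_fst[OF v_cut_integrable]) simp

lemma v_absolutely_integrable:
  assumes "integrable lborel (\<lambda>r. v x r)"
  shows "(\<lambda>r. v x r) absolutely_integrable_on {a..b}"
proof -
  have "integrable lborel (\<lambda>r. indicator {a..b} r *\<^sub>R v x r)"
    by (rule integrable_mult_indicator[OF _ assms]) simp
  then show ?thesis
    by (simp add: set_integrable_def integrable_completion)
qed

lemma U_eq_integral:
  assumes "integrable lborel (\<lambda>r. v x r)"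
  shows "U x s = u0 x + integral {0..s} (\<lambda>r. v x r)"
  using set_lebesgue_integral_eq_integral(2)[OF v_absolutely_integrable[OF assms, of 0 s]]
  by (simp add: primitive_def set_lebesgue_integral_def integral_completion)

text \<open>
  The chain rule is applied for almost every \<open>x\<close> to the difference of the solution and the affine function
  \<open>w + (s - a) z\<close>, and the result is integrated over \<open>x\<close>. After exchanging the order of integration, each time slice is the sum of an
  accretive term, which is nonpositive, and of the residual tested with \<open>q\<close>, where \<open>|q| \<le> 1\<close>.
\<close>

theorem entropy_decay:
  fixes w z :: "real \<Rightarrow> real"
  assumes ab: "0 \<le> a" "a \<le> b" "b \<le> T"
    and Jq: "entropy_pair J q"
    and w: "integrable lborel w" and z: "integrable lborel z"
    and residual: "\<And>s. s \<in> {a<..<b} \<Longrightarrow>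
      flux_integrable K \<phi> (\<lambda>x. w x + (s - a) * z x)"
      "\<And>s. s \<in> {a<..<b} \<Longrightarrow> (LBINT x. \<bar>flux K \<phi> (\<lambda>x. w x + (s - a) * z x) x
         - z x\<bar>) \<le> \<rho>"
  shows "(LBINT x. J (U x b - (w x + (b - a) * z x)))
    \<le> (LBINT x. J (U x a - w x)) + (b - a) * \<rho>"
proof -
  define W where "W x s = w x + (s - a) * z x" for x s
  define D where "D x s = U x s - W x s" for x s
  have W_int: "integrable lborel (\<lambda>x. W x s)" for s
    unfolding W_def using w z by simp
  have D_int: "integrable lborel (\<lambda>x. D x s)" for s
    unfolding D_def using U_integrable W_int by simp
  have [measurable]: "w \<in> borel_measurable borel" "z \<in> borel_measurable borel" 
    using w z by auto
  note [measurable] = entropy_pair_measurable[OF Jq]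
  have D_meas [measurable]: "(\<lambda>z. D (fst z) (snd z)) \<in> borel_measurable lborel2"
    unfolding D_def W_def using U_meas by measurable
  have JD_int: "integrable lborel (\<lambda>x. J (D x s))" for s
  proof (rule Bochner_Integration.integrable_bound[OF D_int[of s]])
    show "(\<lambda>x. J (D x s)) \<in> borel_measurable lborel"
      using borel_measurable_integrable[OF D_int[of s]] by measurable
    show "AE x in lborel. norm (J (D x s)) \<le> norm (D x s)"
      by (rule AE_I2) (use entropy_pair_le_abs[OF Jq] in auto)
  qed
  have q1: "\<bar>q d\<bar> \<le> 1" for d using Jq by (auto simp: entropy_pair_def)
  define G where "G x r = indicator {a..b} r * (q (D x r) * (v x r - z x))" for x r
  have G_int: "integrable lborel2 (\<lambda>(x, r). G x r)"
  proof (rule Bochner_Integration.integrable_bound)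
    have "integrable lborel2 (\<lambda>(x, r). z x * indicator {a..b} r)"
      by (rule integrable_lborel_prod_mult[OF z])
        (rule integrable_real_indicator, auto simp: emeasure_lborel_Icc_eq)
    then have "integrable lborel2
        (\<lambda>p. (case p of (x, r) \<Rightarrow> indicator {a..b} r * v x r) - (case p of (x, r) \<Rightarrow> z x * indicator {a..b} r))"
      by (intro Bochner_Integration.integrable_diff v_cut_integrable) auto
    then show "integrable lborel2 (\<lambda>(x, r). indicator {a..b} r * (v x r - z x))"
      by (simp add: case_prod_unfold algebra_simps)
    show "(\<lambda>(x, r). G x r) \<in> borel_measurable lborel2"
      unfolding G_def case_prod_unfold using v_meas by measurable
    show "AE p in lborel2. norm (case p of (x, r) \<Rightarrow> G x r)
        \<le> norm (case p of (x, r) \<Rightarrow> indicator {a..b} r * (v x r - z x))"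
      by (rule AE_I2)
        (use q1 in \<open>auto simp: G_def abs_mult indicator_def intro!: mult_left_le_one_le\<close>)
  qed
  have v_sec: "AE x in lborel. integrable lborel (\<lambda>r. v x r)"
    by (rule lborel_pair.AE_integrable_fst[OF v_int])
  have chain: "AE x in lborel. J (D x b) - J (D x a) \<le> (LBINT r. G x r)"
    using v_sec lborel_pair.AE_integrable_fst[OF G_int]
  proof eventually_elim
    case (elim x)
    have f: "(\<lambda>r. v x r - z x) absolutely_integrable_on {a..b}"
      by (intro set_integral_diff v_absolutely_integrable elim) (simp add: absolutely_integrable_on_const)
    have D_prim: "D x s = D x a + integral {a..s} (\<lambda>r. v x r - z x)" if "s \<in> {a..b}" for s
    proof -
      have vi: "(\<lambda>r. v x r) integrable_on {c..d}" for c d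
        using set_lebesgue_integral_eq_integral(1)[OF v_absolutely_integrable[OF elim(1)]] .
      have "integral {0..a} (\<lambda>r. v x r) + integral {a..s} (\<lambda>r. v x r) = integral {0..s} (\<lambda>r. v x r)"
        by (rule Henstock_Kurzweil_Integration.integral_combine) (use ab that vi in auto)
      moreover have "integral {a..s} (\<lambda>r. v x r - z x) = integral {a..s} (\<lambda>r. v x r) - (s - a) * z x"
        using that by (subst Henstock_Kurzweil_Integration.integral_diff[OF vi]) auto
      ultimately show ?thesis
        by (simp add: D_def W_def U_eq_integral[OF elim(1)])
    qed
    have "J (D x b) - J (D x a) \<le> integral {a..b} (\<lambda>r. q (D x r) * (v x r - z x))"
      by (rule convex_chain_rule[OF ab(2) f D_prim Jq])
    also have "\<dots> = (LINT r:{a..b}|lborel. q (D x r) * (v x r - z x))"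
      by (rule set_borel_integral_eq_integral(2)[symmetric])
        (use elim(2) in \<open>simp add: set_integrable_def G_def\<close>)
    also have "\<dots> = (LBINT r. G x r)"
      by (simp add: set_lebesgue_integral_def G_def)
    finally show ?case .
  qed
  have slice: "AE r in lborel. (LBINT x. G x r) \<le> indicator {a..b} r * \<rho>"
    using flow lborel_pair.AE_integrable_snd[OF G_int] AE_lborel_singleton[of a] AE_lborel_singleton[of b]
  proof eventually_elim
    case (elim r)
    show ?case
    proof (cases "r \<in> {a<..<b}")
      case True
      define Au where "Au x = flux K \<phi> (\<lambda>x. U x r) x" for x
      define Aw where "Aw x = flux K \<phi> (\<lambda>x. W x r) x" for x
      define \<Psi> where "\<Psi> x y = \<phi> (U y r - U x r) - \<phi> (W y r - W x r)" for x y
      have U1: "flux_integrable K \<phi> (\<lambda>x. U x r)"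
        and v_eq: "AE x in lborel. v x r = Au x"
        using elim(1) True ab by (auto simp: Au_def)
      have W1: "flux_integrable K \<phi> (\<lambda>x. W x r)"
        and res: "(LBINT x. \<bar>Aw x - z x\<bar>) \<le> \<rho>"
        using residual[OF True] by (auto simp: W_def Aw_def)
      have Au_int: "integrable lborel Au" and Aw_int: "integrable lborel Aw"
        unfolding Au_def Aw_def
        by (rule lborel_pair.integrable_fst[OF U1] lborel_pair.integrable_fst[OF W1])+
      have \<Psi>_int: "integrable lborel2 (\<lambda>(x, y). K x y * \<Psi> x y)"
        using Bochner_Integration.integrable_diff[OF U1 W1]
        by (simp add: case_prod_unfold \<Psi>_def right_diff_distrib)
      have diff: "AE x in lborel. Au x - Aw x = (LBINT y. K x y * \<Psi> x y)"
        using lborel_pair.AE_integrable_fst[OF U1] lborel_pair.AE_integrable_fst[OF W1]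
        by eventually_elim (simp add: Au_def Aw_def \<Psi>_def right_diff_distrib)
      define s where "s x = q (D x r)" for x
      have s_meas [measurable]: "s \<in> borel_measurable borel"
        unfolding s_def using borel_measurable_integrable[OF D_int[of r]] by measurable
      have accretive: "(LBINT x. s x * (LBINT y. K x y * \<Psi> x y)) \<le> 0"
      proof (rule antisymmetric_integral_nonpos[OF \<Psi>_int K_nonneg K_sym _ s_meas])
        show "\<Psi> y x = - \<Psi> x y" for x y
          using phi_odd[of "U y r - U x r"] phi_odd[of "W y r - W x r"] by (simp add: \<Psi>_def)
        show "\<bar>s x\<bar> \<le> 1" for x by (simp add: s_def q1)
        show "(s x - s y) * \<Psi> x y \<le> 0" for x y
        proof (cases "D y r \<le> D x r")
          case True
          then have "s y \<le> s x" using Jq by (auto simp: s_def entropy_pair_def dest: monoD)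
          moreover have "\<Psi> x y \<le> 0"
            using True monoD[OF phi_mono, of "U y r - U x r" "W y r - W x r"]
            by (simp add: \<Psi>_def D_def)
          ultimately show ?thesis by (simp add: mult_nonneg_nonpos)
        next
          case False
          then have "s x \<le> s y" using Jq by (auto simp: s_def entropy_pair_def intro!: monoD[of q])
          moreover have "0 \<le> \<Psi> x y"
            using False monoD[OF phi_mono, of "W y r - W x r" "U y r - U x r"]
            by (simp add: \<Psi>_def D_def)
          ultimately show ?thesis by (simp add: mult_nonpos_nonneg)
        qed
      qed
      have s_mult: "integrable lborel (\<lambda>x. s x * h x)" if "integrable lborel h" for h
      proof (rule Bochner_Integration.integrable_bound[OF that])
        show "(\<lambda>x. s x * h x) \<in> borel_measurable lborel" using that by measurable
        show "AE x in lborel. norm (s x * h x) \<le> norm (h x)"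
          by (rule AE_I2) (auto simp: abs_mult s_def q1 intro!: mult_left_le_one_le)
      qed
      have "(LBINT x. G x r) = (LBINT x. s x * (Au x - Aw x) + s x * (Aw x - z x))"
      proof (rule integral_cong_AE)
        show "AE x in lborel. G x r = s x * (Au x - Aw x) + s x * (Aw x - z x)"
          using v_eq by eventually_elim (use True in \<open>auto simp: G_def s_def algebra_simps\<close>)
      qed (use elim(2) Au_int Aw_int in auto)
      also have "\<dots> = (LBINT x. s x * (Au x - Aw x)) + (LBINT x. s x * (Aw x - z x))"
        using Au_int Aw_int z by (intro Bochner_Integration.integral_add s_mult) auto
      also have "(LBINT x. s x * (Au x - Aw x)) = (LBINT x. s x * (LBINT y. K x y * \<Psi> x y))"
        using diff by (intro integral_cong_AE)
          (use Au_int Aw_int lborel_pair.integrable_fst[OF \<Psi>_int] in auto)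
      also have "\<dots> + (LBINT x. s x * (Aw x - z x)) \<le> 0 + (LBINT x. \<bar>Aw x - z x\<bar>)"
      proof (rule add_mono[OF accretive], rule integral_mono)
        show "s x * (Aw x - z x) \<le> \<bar>Aw x - z x\<bar>" for x
        proof -
          have "s x * (Aw x - z x) \<le> \<bar>s x\<bar> * \<bar>Aw x - z x\<bar>" by (simp add: abs_mult[symmetric])
          also have "\<dots> \<le> \<bar>Aw x - z x\<bar>" by (rule mult_left_le_one_le) (auto simp: s_def q1)
          finally show ?thesis .
        qed
      qed (use Aw_int z in \<open>auto intro!: s_mult\<close>)
      also have "\<dots> \<le> \<rho>" using res by simp
      finally show ?thesis using True by simp
    next
      case False
      then have "r \<notin> {a..b}" using elim by auto
      then show ?thesis by (simp add: G_def)
    qed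
  qed
  have "(LBINT x. J (D x b)) - (LBINT x. J (D x a)) = (LBINT x. J (D x b) - J (D x a))"
    using JD_int by simp
  also have "\<dots> \<le> (LBINT x. (LBINT r. G x r))"
    by (rule integral_mono_AE[OF _ lborel_pair.integrable_fst[OF G_int] chain]) (use JD_int in simp)
  also have "\<dots> = (LBINT r. (LBINT x. G x r))"
    by (rule lborel_pair.Fubini_integral[OF G_int, symmetric])
  also have "\<dots> \<le> (LBINT r. indicator {a..b} r * \<rho>)"
    by (rule integral_mono_AE[OF lborel_pair.integrable_snd[OF G_int] _ slice])
      (intro integrable_mult_left integrable_real_indicator, auto simp: emeasure_lborel_Icc_eq)
  also have "\<dots> = (b - a) * \<rho>"
    using ab by simp
  finally show ?thesis
    by (simp add: D_def W_def)
qed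

text \<open>
  The modulus is the limit of \<open>soft_abs 0 e\<close> as \<open>e\<close> tends to \<open>0\<close>.
\<close>

corollary L1_growth:
  fixes w z :: "real \<Rightarrow> real"
  assumes ab: "0 \<le> a" "a \<le> b" "b \<le> T"
    and w: "integrable lborel w" and z: "integrable lborel z"
    and residual: "\<And>s. s \<in> {a<..<b} \<Longrightarrow>
      flux_integrable K \<phi> (\<lambda>x. w x + (s - a) * z x)"
      "\<And>s. s \<in> {a<..<b} \<Longrightarrow> (LBINT x. \<bar>flux K \<phi> (\<lambda>x. w x + (s - a) * z x) x
         - z x\<bar>) \<le> \<rho>"
  shows "(LBINT x. \<bar>U x b - (w x + (b - a) * z x)\<bar>) \<le> (LBINT x. \<bar>U x a - w x\<bar>) + (b - a) * \<rho>"
proof (rule LIMSEQ_le_const2)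
  define e where "e k = 1 / real (Suc k)" for k
  have e: "0 < e k" for k by (simp add: e_def)
  have e_lim: "e \<longlonglongrightarrow> 0" unfolding e_def by (rule LIMSEQ_Suc[OF lim_1_over_n])
  define D where "D x = U x b - (w x + (b - a) * z x)" for x
  have D: "integrable lborel D" unfolding D_def using U_integrable w z by auto
  have D0: "integrable lborel (\<lambda>x. U x a - w x)" using U_integrable w by auto
  note ent = soft_abs_entropy[OF order_refl e]
  note [measurable] = entropy_pair_measurable(1)[OF ent]
  have J_le: "\<bar>soft_abs 0 (e k) d\<bar> \<le> \<bar>d\<bar>" for k d
    by (rule entropy_pair_le_abs[OF ent])
  show "(\<lambda>k. LBINT x. soft_abs 0 (e k) (D x)) \<longlonglongrightarrow> (LBINT x. \<bar>U x b - (w x + (b - a) * z x)\<bar>)"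
    unfolding D_def[symmetric]
  proof (rule integral_dominated_convergence)
    show "integrable lborel (\<lambda>x. \<bar>D x\<bar>)" using D by simp
    show "AE x in lborel. (\<lambda>k. soft_abs 0 (e k) (D x)) \<longlonglongrightarrow> \<bar>D x\<bar>"
    proof (rule AE_I2, rule tendsto_sandwich)
      fix x
      show "(\<lambda>k. \<bar>D x\<bar> - e k / 2) \<longlonglongrightarrow> \<bar>D x\<bar>"
        using tendsto_diff[OF tendsto_const tendsto_divide[OF e_lim tendsto_const[of 2]], of "\<bar>D x\<bar>"] by simp
      show "\<forall>\<^sub>F k in sequentially. \<bar>D x\<bar> - e k / 2 \<le> soft_abs 0 (e k) (D x)"
        using soft_abs_ge_abs[OF e] by (intro always_eventually allI)
      show "\<forall>\<^sub>F k in sequentially. soft_abs 0 (e k) (D x) \<le> \<bar>D x\<bar>"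
        using J_le[of _ "D x"] by (intro always_eventually allI) (auto simp: abs_le_iff)
    qed (rule tendsto_const)
    show "AE x in lborel. norm (soft_abs 0 (e k) (D x)) \<le> \<bar>D x\<bar>" for k
      using J_le by (intro AE_I2) simp
  qed (use D in auto)
  have "(LBINT x. soft_abs 0 (e k) (D x)) \<le> (LBINT x. \<bar>U x a - w x\<bar>) + (b - a) * \<rho>" for k
  proof -
    have "(LBINT x. soft_abs 0 (e k) (D x)) \<le> (LBINT x. soft_abs 0 (e k) (U x a - w x)) + (b - a) * \<rho>"
      unfolding D_def by (rule entropy_decay[OF ab ent w z residual])
    also have "(LBINT x. soft_abs 0 (e k) (U x a - w x)) \<le> (LBINT x. \<bar>U x a - w x\<bar>)"
    proof (rule integral_mono)
      show "integrable lborel (\<lambda>x. soft_abs 0 (e k) (U x a - w x))"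
        by (rule Bochner_Integration.integrable_bound[OF D0])
          (use borel_measurable_integrable[OF D0] J_le in \<open>auto intro!: AE_I2\<close>)
      show "soft_abs 0 (e k) (U x a - w x) \<le> \<bar>U x a - w x\<bar>" for x
        using J_le[of k "U x a - w x"] by (simp add: abs_le_iff)
    qed (use D0 in simp)
    finally show ?thesis by simp
  qed
  then show "\<exists>N. \<forall>k\<ge>N. (LBINT x. soft_abs 0 (e k) (D x)) \<le> (LBINT x. \<bar>U x a - w x\<bar>) + (b - a) * \<rho>"
    by blast
qed

text \<open>
  The zero function is an exact solution, and \<open>soft_abs M 1\<close> vanishes exactly on \<open>[-M,M]\<close>.
\<close>

corollary maximum_principle:
  assumes M: "0 \<le> M" "AE x in lborel. \<bar>u0 x\<bar> \<le> M" and s: "0 \<le> s" "s \<le> T"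
  shows "AE x in lborel. \<bar>U x s\<bar> \<le> M"
proof -
  note ent = soft_abs_entropy[OF M(1) zero_less_one]
  note [measurable] = entropy_pair_measurable(1)[OF ent]
  have [simp]: "\<phi> 0 = 0" using phi_odd[of 0] by simp
  have "(LBINT x. soft_abs M 1 (U x s - (0 + (s - 0) * 0)))
      \<le> (LBINT x. soft_abs M 1 (U x 0 - 0)) + (s - 0) * 0"
    by (rule entropy_decay[OF _ s ent]) (auto simp: case_prod_unfold)
  also have "(LBINT x. soft_abs M 1 (U x 0 - 0)) = 0"
    by (rule integral_eq_zero_AE, rule AE_mp[OF M(2)])
      (auto simp: primitive_0 soft_abs_zero intro!: AE_I2)
  finally have "(LBINT x. soft_abs M 1 (U x s)) \<le> 0" by simp
  moreover have "0 \<le> (LBINT x. soft_abs M 1 (U x s))"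
    by (intro Bochner_Integration.integral_nonneg soft_abs_nonneg M(1)) simp
  ultimately have "(LBINT x. soft_abs M 1 (U x s)) = 0" by linarith
  moreover have "integrable lborel (\<lambda>x. soft_abs M 1 (U x s))"
    by (rule Bochner_Integration.integrable_bound[OF U_integrable[of s]])
      (use entropy_pair_le_abs[OF ent] in \<open>auto intro!: AE_I2\<close>)
  ultimately have "AE x in lborel. soft_abs M 1 (U x s) = 0"
    by (subst (asm) integral_nonneg_eq_0_iff_AE) (use soft_abs_nonneg[OF M(1)] in \<open>auto intro!: AE_I2\<close>)
  then show ?thesis
    by eventually_elim (use soft_abs_pos[OF M(1), of 1] in \<open>force simp: not_le[symmetric]\<close>)
qed

end

section \<open>Averages over cells\<close>

lemma bounded_cut_integrable:
  fixes f :: "'a::euclidean_space \<Rightarrow> real"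
  assumes "f \<in> borel_measurable borel" "\<And>x. \<bar>f x\<bar> \<le> B" "Q \<in> sets borel" "emeasure lborel Q < \<infinity>"
  shows "integrable lborel (\<lambda>x. indicator Q x * f x)"
proof (rule Bochner_Integration.integrable_bound)
  show "integrable lborel (\<lambda>x. indicator Q x * B)"
    by (intro integrable_mult_left integrable_real_indicator) (use assms in auto)
  show "AE x in lborel. norm (indicator Q x * f x) \<le> norm (indicator Q x * B)"
  proof (rule AE_I2)
    fix x show "norm (indicator Q x * f x) \<le> norm (indicator Q x * B)"
      using assms(2)[of x] by (auto simp: indicator_def)
  qed
qed (use assms in measurable)

definition average :: "('a::euclidean_space \<Rightarrow> real) \<Rightarrow> 'a set \<Rightarrow> real" where
  "average f Q = (LBINT x. indicator Q x * f x) / measure lborel Q"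

lemma average_bounds:
  fixes f :: "'a::euclidean_space \<Rightarrow> real"
  assumes f: "f \<in> borel_measurable borel" "\<And>x. a \<le> f x \<and> f x \<le> b"
    and Q: "Q \<in> sets borel" "emeasure lborel Q < \<infinity>" "0 < measure lborel Q"
  shows "a \<le> average f Q" "average f Q \<le> b"
proof -
  have bd: "\<bar>f x\<bar> \<le> max \<bar>a\<bar> \<bar>b\<bar>" for x using f(2)[of x] by auto
  have fi: "integrable lborel (\<lambda>x. indicator Q x * f x)"
    by (rule bounded_cut_integrable[OF f(1) bd Q(1,2)])
  have ind: "integrable lborel (\<lambda>x. indicator Q x * c)" "(LBINT x. indicator Q x * c) = measure lborel Q * c" for c :: real
    using Q by (auto intro!: integrable_mult_left integrable_real_indicator)
  have "(LBINT x. indicator Q x * a) \<le> (LBINT x. indicator Q x * f x)"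
    "(LBINT x. indicator Q x * f x) \<le> (LBINT x. indicator Q x * b)"
    by (rule integral_mono; use fi ind f(2) in \<open>auto simp: indicator_def\<close>)+
  then show "a \<le> average f Q" "average f Q \<le> b"
    using Q(3) unfolding ind(2) average_def by (simp_all add: field_simps)
qed

text \<open>
  A measurable function is an almost everywhere limit of continuous functions; clipping these at the bound of \<open>f\<close> makes dominated
  convergence applicable.
\<close>

lemma continuous_L1_approximation:
  fixes f :: "'a::euclidean_space \<Rightarrow> real"
  assumes f: "f \<in> borel_measurable borel" and B: "\<And>x. \<bar>f x\<bar> \<le> B" and e: "0 < e"
  obtains h where "continuous_on UNIV h" "\<And>x. \<bar>h x\<bar> \<le> B"
    "(LBINT x. indicator (cbox a b) x * \<bar>f x - h x\<bar>) < e"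
proof -
  let ?S = "cbox a b"
  have B0: "0 \<le> B" using B[of undefined] by linarith
  have "f \<in> borel_measurable (lebesgue_on ?S)"
    using f by (intro measurable_restrict_space1 measurable_completion) simp
  then have "f measurable_on ?S"
    by (subst measurable_on_iff_borel_measurable) auto
  then obtain N g where N: "negligible N" and g: "\<And>n. continuous_on UNIV (g n)"
      "\<And>x. x \<notin> N \<Longrightarrow> (\<lambda>n. g n x) \<longlonglongrightarrow> (if x \<in> ?S then f x else 0)"
    unfolding measurable_on_def by blast
  define h where "h n x = max (- B) (min B (g n x))" for n :: nat and x
  have h_cont: "continuous_on UNIV (h n)" for n
    unfolding h_def by (intro continuous_intros g)
  have h_B: "\<bar>h n x\<bar> \<le> B" for n x using B0 by (auto simp: h_def)
  have [measurable]: "f \<in> borel_measurable borel" "h n \<in> borel_measurable borel" for n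
    using f h_cont by (auto intro: borel_measurable_continuous_onI)
  have "(\<lambda>n. LBINT x. indicator ?S x * \<bar>f x - h n x\<bar>) \<longlonglongrightarrow> (\<integral>x. 0 \<partial>(lborel::'a measure))"
  proof (rule integral_dominated_convergence)
    show "integrable lborel (\<lambda>x. indicator ?S x * (2 * B))"
      by (intro integrable_mult_left integrable_real_indicator) (simp, rule emeasure_lborel_cbox_finite)
    have "AE x in lebesgue. x \<notin> N"
      using N by (simp add: AE_not_in negligible_iff_null_sets)
    then have "AE x in lborel. x \<notin> N"
      by (simp add: AE_completion_iff)
    then show "AE x in lborel. (\<lambda>n. indicator ?S x * \<bar>f x - h n x\<bar>) \<longlonglongrightarrow> 0"
    proof eventually_elim
      case (elim x)
      show ?case
      proof (cases "x \<in> ?S")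
        case True
        have "(\<lambda>n. h n x) \<longlonglongrightarrow> max (- B) (min B (f x))"
          unfolding h_def using g(2)[OF elim] True by (intro tendsto_intros) auto
        also have "max (- B) (min B (f x)) = f x" using B[of x] by auto
        finally have "(\<lambda>n. \<bar>f x - h n x\<bar>) \<longlonglongrightarrow> \<bar>f x - f x\<bar>"
          by (intro tendsto_intros)
        then show ?thesis using True by simp
      qed simp
    qed
    show "AE x in lborel. norm (indicator ?S x * \<bar>f x - h n x\<bar>) \<le> indicator ?S x * (2 * B)" for n
    proof (rule AE_I2)
      fix x
      show "norm (indicator ?S x * \<bar>f x - h n x\<bar>) \<le> indicator ?S x * (2 * B)"
        using B[of x] h_B[of n x] by (auto simp: indicator_def)
    qed
  qed auto
  then have "(\<lambda>n. LBINT x. indicator ?S x * \<bar>f x - h n x\<bar>) \<longlonglongrightarrow> 0" by simp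
  then have "\<forall>\<^sub>F n in sequentially. (LBINT x. indicator ?S x * \<bar>f x - h n x\<bar>) < e"
    by (rule order_tendstoD(2)) (rule e)
  then obtain n where "(LBINT x. indicator ?S x * \<bar>f x - h n x\<bar>) < e"
    by (auto simp: eventually_sequentially)
  then show thesis using that[of "h n"] h_cont h_B by blast
qed

text \<open>
  On \<open>Q\<close> the average of \<open>f\<close> differs from \<open>h\<close> by no more than \<open>d\<close> plus the mean of \<open>|f - h|\<close>; the other copy of
  \<open>|f - h|\<close> accounts for replacing \<open>f\<close> by \<open>h\<close>.
\<close>

lemma L1_distance_average_le:
  fixes f h :: "'a::euclidean_space \<Rightarrow> real"
  assumes f: "f \<in> borel_measurable borel" "\<And>x. \<bar>f x\<bar> \<le> B"
    and h: "h \<in> borel_measurable borel" "\<And>x. \<bar>h x\<bar> \<le> B"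
    and Q: "Q \<in> sets borel" "emeasure lborel Q < \<infinity>" "0 < measure lborel Q"
    and osc: "\<And>x y. x \<in> Q \<Longrightarrow> y \<in> Q \<Longrightarrow> \<bar>h x - h y\<bar> \<le> d"
  shows "(LBINT x. indicator Q x * \<bar>f x - average f Q\<bar>)
    \<le> 2 * (LBINT x. indicator Q x * \<bar>f x - h x\<bar>) + d * measure lborel Q"
proof -
  let ?m = "measure lborel Q" and ?e = "\<integral>x. indicator Q x * \<bar>f x - h x\<bar> \<partial>lborel"
  have [measurable]: "f \<in> borel_measurable borel" "h \<in> borel_measurable borel" "Q \<in> sets borel"
    by fact+
  have bd: "\<bar>\<bar>f x - h x\<bar>\<bar> \<le> 2 * B" for x
    using f(2)[of x] h(2)[of x] by auto
  have fh: "integrable lborel (\<lambda>x. indicator Q x * \<bar>f x - h x\<bar>)"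
    by (rule bounded_cut_integrable[where B = "2 * B"]) (use bd Q in auto)
  have ind: "integrable lborel (\<lambda>x. indicator Q x * c)" "(LBINT x. indicator Q x * c) = c * ?m" for c :: real
    using Q by (auto intro!: integrable_mult_left integrable_real_indicator)
  have fi: "integrable lborel (\<lambda>x. indicator Q x * f x)"
    by (rule bounded_cut_integrable[OF f Q(1,2)])
  have near: "\<bar>average f Q - h x\<bar> \<le> ?e / ?m + d" if x: "x \<in> Q" for x
  proof -
    have "average f Q - h x = ((LBINT y. indicator Q y * f y) - (LBINT y. indicator Q y * h x)) / ?m"
      using Q by (simp add: average_def ind(2) diff_divide_distrib)
    also have "\<dots> = (LBINT y. indicator Q y * f y - indicator Q y * h x) / ?m"
      by (simp add: Bochner_Integration.integral_diff[OF fi ind(1)])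
    finally have "\<bar>average f Q - h x\<bar> = \<bar>\<integral>y. indicator Q y * f y - indicator Q y * h x \<partial>lborel\<bar> / ?m"
      using Q by simp
    also have "\<bar>\<integral>y. indicator Q y * f y - indicator Q y * h x \<partial>lborel\<bar>
        \<le> (LBINT y. indicator Q y * \<bar>f y - h y\<bar> + indicator Q y * d)"
    proof (rule integral_abs_bound[THEN order_trans], rule integral_mono)
      show "\<bar>indicator Q y * f y - indicator Q y * h x\<bar> \<le> indicator Q y * \<bar>f y - h y\<bar> + indicator Q y * d" for y
        using osc[OF x, of y] by (auto simp: indicator_def)
    qed (intro integrable_abs Bochner_Integration.integrable_diff Bochner_Integration.integrable_add fi fh ind)+
    also have "\<dots> = ?e + d * ?m"
      using fh ind by simp
    finally show ?thesis
      using Q by (simp add: add_divide_distrib divide_right_mono)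
  qed
  have "(LBINT x. indicator Q x * \<bar>f x - average f Q\<bar>)
      \<le> (LBINT x. indicator Q x * \<bar>f x - h x\<bar> + indicator Q x * (?e / ?m + d))"
  proof (rule integral_mono)
    show "integrable lborel (\<lambda>x. indicator Q x * \<bar>f x - average f Q\<bar>)"
    proof (rule bounded_cut_integrable[where B = "B + \<bar>average f Q\<bar>"])
      show "\<bar>\<bar>f x - average f Q\<bar>\<bar> \<le> B + \<bar>average f Q\<bar>" for x
        using f(2)[of x] by auto
    qed (use Q in auto)
    show "indicator Q x * \<bar>f x - average f Q\<bar> \<le> indicator Q x * \<bar>f x - h x\<bar> + indicator Q x * (?e / ?m + d)" for x
      using near[of x] by (auto simp: indicator_def)
  qed (intro Bochner_Integration.integrable_add fh ind)
  also have "\<dots> = ?e + (?e / ?m + d) * ?m"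
    using fh ind by simp
  also have "\<dots> = 2 * ?e + d * ?m"
    using Q(3) by (simp add: field_simps)
  finally show ?thesis .
qed

text \<open>
  For a continuous function this is uniform continuity, and by the preceding estimate averaging is stable under
  approximation in \<open>L\<^sup>1\<close>.
\<close>

lemma averages_converge_L1:
  fixes f :: "'a::euclidean_space \<Rightarrow> real" and Q :: "nat \<Rightarrow> 'i \<Rightarrow> 'a set"
  assumes f: "f \<in> borel_measurable borel" "\<And>x. \<bar>f x\<bar> \<le> B"
    and fin: "\<And>n. finite (I n)" and disj: "\<And>n. disjoint_family_on (Q n) (I n)"
    and Q: "\<And>n i. i \<in> I n \<Longrightarrow> Q n i \<in> sets borel" "\<And>n i. i \<in> I n \<Longrightarrow> Q n i \<subseteq> cbox a b"
      "\<And>n i. i \<in> I n \<Longrightarrow> 0 < measure lborel (Q n i)"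
    and diam: "\<And>n i x y. i \<in> I n \<Longrightarrow> x \<in> Q n i \<Longrightarrow> y \<in> Q n i \<Longrightarrow> dist x y \<le> D n"
    and D: "D \<longlonglongrightarrow> 0"
  shows "(\<lambda>n. \<Sum>i\<in>I n. LBINT x. indicator (Q n i) x * \<bar>f x - average f (Q n i)\<bar>) \<longlonglongrightarrow> 0"
    (is "?F \<longlonglongrightarrow> 0")
proof (rule tendstoI)
  fix e :: real assume e: "0 < e"
  let ?S = "cbox a b"
  define c where "c = e / (4 * (measure lborel ?S + 1))"
  have c: "0 < c" using e by (simp add: c_def add_pos_nonneg add_nonneg_pos)
  obtain h where h: "continuous_on UNIV h" "\<And>x. \<bar>h x\<bar> \<le> B"
    "(LBINT x. indicator ?S x * \<bar>f x - h x\<bar>) < e / 4"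
    using continuous_L1_approximation[OF f, of "e / 4" a b] e by auto
  have [measurable]: "f \<in> borel_measurable borel" "h \<in> borel_measurable borel"
    using f(1) h(1) by (auto intro: borel_measurable_continuous_onI)
  have "uniformly_continuous_on ?S h"
    by (rule compact_uniformly_continuous) (use h(1) continuous_on_subset in auto)
  then obtain d where d: "0 < d" "\<forall>x\<in>?S. \<forall>y\<in>?S. dist y x < d \<longrightarrow> dist (h y) (h x) < c"
    using c unfolding uniformly_continuous_on_def by blast
  have "\<forall>\<^sub>F n in sequentially. D n < d"
    by (rule order_tendstoD(2)[OF D d(1)])
  then show "\<forall>\<^sub>F n in sequentially. dist (?F n) 0 < e"
  proof eventually_elim
    case (elim n)
    have fin_m: "emeasure lborel (Q n i) < \<infinity>" if "i \<in> I n" for i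
      using emeasure_mono[OF Q(2)[OF that], of lborel] emeasure_lborel_cbox_finite[of a b] 
      by (auto simp: order_le_less_trans)
    have bd: "\<bar>\<bar>f x - h x\<bar>\<bar> \<le> 2 * B" for x
      using f(2)[of x] h(2)[of x] by auto
    have fh: "integrable lborel (\<lambda>x. indicator A x * \<bar>f x - h x\<bar>)"
      if "A \<in> sets borel" "emeasure lborel A < \<infinity>" for A
      by (rule bounded_cut_integrable[where B = "2 * B"]) (use bd that in auto)
    have "?F n \<le> (\<Sum>i\<in>I n. 2 * (LBINT x. indicator (Q n i) x * \<bar>f x - h x\<bar>) + c * measure lborel (Q n i))"
    proof (rule sum_mono, rule L1_distance_average_le[OF f _ h(2)])
      fix i x y assume i: "i \<in> I n" and "x \<in> Q n i" "y \<in> Q n i"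
      then have "dist x y < d" "x \<in> ?S" "y \<in> ?S"
        using diam[OF i, of x y] elim Q(2)[OF i] by auto
      then show "\<bar>h x - h y\<bar> \<le> c"
        using d(2) by (force simp: dist_real_def)
    qed (use Q fin_m in auto)
    also have "\<dots> = 2 * (\<Sum>i\<in>I n. LBINT x. indicator (Q n i) x * \<bar>f x - h x\<bar>)
        + c * (\<Sum>i\<in>I n. measure lborel (Q n i))"
      by (simp add: sum.distrib sum_distrib_left)
    also have "(\<Sum>i\<in>I n. LBINT x. indicator (Q n i) x * \<bar>f x - h x\<bar>)
        = (LBINT x. (\<Sum>i\<in>I n. indicator (Q n i) x * \<bar>f x - h x\<bar>))"
      by (rule Bochner_Integration.integral_sum[symmetric]) (use fh Q fin_m in auto)
    also have "\<dots> \<le> (LBINT x. indicator ?S x * \<bar>f x - h x\<bar>)"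
    proof (rule integral_mono)
      show "integrable lborel (\<lambda>x. \<Sum>i\<in>I n. indicator (Q n i) x * \<bar>f x - h x\<bar>)"
        by (rule Bochner_Integration.integrable_sum) (use fh Q fin_m in auto)
      show "integrable lborel (\<lambda>x. indicator ?S x * \<bar>f x - h x\<bar>)"
        by (rule fh) (simp, rule emeasure_lborel_cbox_finite)
      fix x
      have "(\<Sum>i\<in>I n. indicator (Q n i) x * \<bar>f x - h x\<bar>) = indicator (\<Union>i\<in>I n. Q n i) x * \<bar>f x - h x\<bar>"
        by (simp add: sum_distrib_right[symmetric] indicator_UN_disjoint[OF fin disj])
      also have "\<dots> \<le> indicator ?S x * \<bar>f x - h x\<bar>"
        using Q(2) by (intro mult_right_mono) (auto simp: indicator_def)
      finally show "(\<Sum>i\<in>I n. indicator (Q n i) x * \<bar>f x - h x\<bar>) \<le> indicator ?S x * \<bar>f x - h x\<bar>" .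
    qed
    also have "(\<Sum>i\<in>I n. measure lborel (Q n i)) = measure lborel (\<Union>i\<in>I n. Q n i)"
      by (rule measure_finite_Union[symmetric, OF fin _ disj]) (use Q fin_m in \<open>auto simp: less_top[symmetric]\<close>)
    also have "\<dots> \<le> measure lborel ?S"
      by (rule measure_mono_fmeasurable)
        (use Q(2) in blast, use Q(1) fin in auto)
    finally have "?F n \<le> 2 * (LBINT x. indicator ?S x * \<bar>f x - h x\<bar>) + c * measure lborel ?S"
      using c by simp
    also have "\<dots> < 2 * (e / 4) + e / 4"
    proof (rule add_less_le_mono)
      show "c * measure lborel ?S \<le> e / 4"
      proof -
        have "measure lborel ?S / (measure lborel ?S + 1) \<le> 1" by (simp add: add_nonneg_pos)
        then have "e / 4 * (measure lborel ?S / (measure lborel ?S + 1)) \<le> e / 4"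
          using e by (intro mult_left_le) auto
        then show ?thesis by (simp add: c_def)
      qed
    qed (use h(3) in simp)
    also have "\<dots> \<le> e" using e by simp
    finally have "?F n < e" .
    moreover have "0 \<le> ?F n"
      by (intro sum_nonneg Bochner_Integration.integral_nonneg) auto
    ultimately show ?case by (simp add: dist_real_def)
  qed
qed

section \<open>Functions that are constant on cells\<close>

definition cell_fun :: "nat \<Rightarrow> (nat \<Rightarrow> real) \<Rightarrow> real \<Rightarrow> real" where
  "cell_fun n c x = (\<Sum>i=1..n. indicator (cell n i) x * c i)"

lemma cell_borel [measurable]: "cell n i \<in> sets borel"
  by (simp add: cell_def)

lemma emeasure_cell: "1 \<le> i \<Longrightarrow> emeasure lborel (cell n i) = ennreal (1 / real n)"
  by (simp add: cell_def diff_divide_distrib[symmetric] divide_right_mono)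

lemma measure_cell: "1 \<le> i \<Longrightarrow> measure lborel (cell n i) = 1 / real n"
  using emeasure_cell[of i n] by (simp add: measure_def)

lemma cell_subset:
  assumes "i \<in> {1..n}" shows "cell n i \<subseteq> {0..<1}"
proof
  fix x assume x: "x \<in> cell n i"
  have "0 \<le> (real i - 1) / real n" "real i / real n \<le> 1" using assms by auto
  with x show "x \<in> {0..<1}" by (auto simp: cell_def)
qed

lemma cell_unique:
  assumes "x \<in> cell n i" "x \<in> cell n j" shows "i = j"
proof (cases "n = 0")
  case False
  then have "real i - 1 \<le> x * n" "x * n < real i" "real j - 1 \<le> x * n" "x * n < real j"
    using assms by (auto simp: cell_def field_simps)
  then show ?thesis by linarith
qed (use assms in \<open>auto simp: cell_def\<close>)

lemma cell_disjoint: "disjoint_family_on (cell n) I"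
  using cell_unique by (auto simp: disjoint_family_on_def)

lemma cell_cover:
  assumes "0 < n" "x \<in> {0..<1}"
  obtains i where "i \<in> {1..n}" "x \<in> cell n i"
proof
  define k where "k = nat \<lfloor>x * n\<rfloor>"
  have nn: "0 \<le> x * n" using assms by auto
  then have k: "real k \<le> x * n" "x * n < real k + 1"
    by (simp_all add: k_def)
  have "x * n < 1 * real n" using assms by (intro mult_strict_right_mono) auto
  then have "k < n" using k by linarith
  then show "Suc k \<in> {1..n}" by auto
  show "x \<in> cell n (Suc k)" using k assms by (auto simp: cell_def field_simps)
qed

lemma cell_fun_cell:
  assumes "i \<in> {1..n}" "x \<in> cell n i" shows "cell_fun n c x = c i"
proof -
  have "cell_fun n c x = (\<Sum>j=1..n. if j = i then c j else 0)"
    unfolding cell_fun_def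
    by (rule sum.cong) (use assms cell_unique in \<open>auto simp: indicator_def\<close>)
  with assms(1) show ?thesis by simp
qed

lemma cell_fun_outside:
  assumes "x \<notin> {0..<1}" shows "cell_fun n c x = 0"
  unfolding cell_fun_def
proof (intro sum.neutral ballI)
  fix i assume "i \<in> {1..n}"
  with assms cell_subset have "x \<notin> cell n i" by blast
  then show "indicator (cell n i) x * c i = 0" by simp
qed

lemma cell_fun_measurable [measurable]: "cell_fun n c \<in> borel_measurable borel"
  unfolding cell_fun_def[abs_def] by measurable

lemma cell_fun_integrable: "integrable lborel (cell_fun n c)"
  unfolding cell_fun_def[abs_def]
  by (intro Bochner_Integration.integrable_sum integrable_mult_left integrable_real_indicator)
    (auto simp: emeasure_cell)

lemma cell_fun_bounded:
  assumes "\<And>i. i \<in> {1..n} \<Longrightarrow> \<bar>c i\<bar> \<le> B" "0 \<le> B"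
  shows "\<bar>cell_fun n c x\<bar> \<le> B"
proof (cases "0 < n \<and> x \<in> {0..<1}")
  case True
  then obtain i where "i \<in> {1..n}" "x \<in> cell n i" using cell_cover by blast
  then show ?thesis using assms by (simp add: cell_fun_cell)
next
  case False
  then consider "n = 0" | "x \<notin> {0..<1}" by blast
  then have "cell_fun n c x = 0"
    by cases (simp add: cell_fun_def, rule cell_fun_outside)
  then show ?thesis using assms(2) by simp
qed

lemma cell_fun_cong: "(\<And>i. i \<in> {1..n} \<Longrightarrow> c i = d i) \<Longrightarrow> cell_fun n c x = cell_fun n d x"
  unfolding cell_fun_def by (rule sum.cong) auto

lemma cell_fun_linear: "cell_fun n (\<lambda>i. c i + s * d i) x = cell_fun n c x + s * cell_fun n d x"
  unfolding cell_fun_def sum_distrib_left sum.distrib[symmetric]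
  by (intro sum.cong refl) (simp add: algebra_simps)

lemma cell_diameter: "x \<in> cell n i \<Longrightarrow> y \<in> cell n i \<Longrightarrow> \<bar>x - y\<bar> \<le> 1 / real n"
  by (auto simp: cell_def diff_divide_distrib)

lemma measure_cell_Times:
  assumes "1 \<le> i" "1 \<le> j"
  shows "emeasure lborel (cell n i \<times> cell n j) = ennreal (1 / (real n)\<^sup>2)"
    "measure lborel (cell n i \<times> cell n j) = 1 / (real n)\<^sup>2"
proof -
  have "emeasure lborel2 (cell n i \<times> cell n j) = ennreal (1 / real n) * ennreal (1 / real n)"
    using assms by (simp add: lborel.emeasure_pair_measure_Times emeasure_cell)
  then show "emeasure lborel (cell n i \<times> cell n j) = ennreal (1 / (real n)\<^sup>2)"
    by (simp add: lborel_prod ennreal_mult[symmetric] power2_eq_square)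
  then show "measure lborel (cell n i \<times> cell n j) = 1 / (real n)\<^sup>2"
    by (simp add: measure_def)
qed

lemma cell_Times_borel: "cell n i \<times> cell n j \<in> sets (borel :: (real \<times> real) measure)"
  by (simp add: borel_prod[symmetric])

section \<open>The nonlinearity and the residual of a cell function\<close>

text \<open>
  In this form continuity and monotonicity for all \<open>p > 1\<close> are read off from the power function on
  \<open>[0,\<infinity>)\<close>, without treating the singular factor \<open>|r|\<^sup>p\<^sup>-\<^sup>2\<close> separately for \<open>p < 2\<close>.
\<close>

lemma phi_eq: "phi p r = (max r 0) powr (p - 1) - (max (- r) 0) powr (p - 1)"
proof -
  have *: "s powr (p - 2) * s = s powr (p - 1)" if "0 < s" for s :: real
    using powr_mult_base[of s "p - 2"] that by (simp add: mult.commute)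
  show ?thesis
    using *[of r] *[of "- r"] by (cases r "0::real" rule: linorder_cases) (auto simp: phi_def max_def)
qed

lemma phi_odd: "phi p (- r) = - phi p r"
  by (simp add: phi_def)

lemma phi_mono: "1 < p \<Longrightarrow> mono (phi p)"
  by (rule monoI) (auto simp: phi_eq intro!: diff_mono powr_mono2)

lemma phi_continuous: "1 < p \<Longrightarrow> continuous_on UNIV (phi p)"
  unfolding phi_eq[abs_def] by (intro continuous_intros continuous_on_powr') auto

lemma phi_nonneg: "0 \<le> r \<Longrightarrow> 0 \<le> phi p r"
  by (simp add: phi_def)

lemma phi_abs: "\<bar>phi p r\<bar> = phi p \<bar>r\<bar>"
  by (auto simp: phi_def abs_mult)

lemma phi_abs_le:
  assumes "1 < p" "\<bar>r\<bar> \<le> R" shows "\<bar>phi p r\<bar> \<le> phi p R"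
  unfolding phi_abs using monoD[OF phi_mono[OF assms(1)] assms(2)] .

lemma bounded_supported_integrable_Om2:
  fixes F :: "real \<Rightarrow> real \<Rightarrow> real"
  assumes "(\<lambda>(x, y). F x y) \<in> borel_measurable lborel2"
    and "\<And>x y. \<bar>F x y\<bar> \<le> B" "\<And>x y. x \<notin> Om \<or> y \<notin> Om \<Longrightarrow> F x y = 0"
  shows "integrable lborel2 (\<lambda>(x, y). F x y)"
proof (rule Bochner_Integration.integrable_bound[OF _ assms(1)])
  have "integrable lborel (indicator Om :: real \<Rightarrow> real)"
    by (rule integrable_real_indicator) (auto simp: Om_def)
  then show "integrable lborel2 (\<lambda>(x, y). (B * indicator Om x) * indicator Om y)"
    by (intro integrable_lborel_prod_mult integrable_mult_right)
  show "AE z in lborel2. norm (case z of (x, y) \<Rightarrow> F x y)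
      \<le> norm (case z of (x, y) \<Rightarrow> (B * indicator Om x) * indicator Om y)"
  proof (rule AE_I2, clarify)
    fix x y
    show "norm (F x y) \<le> norm ((B * indicator Om x) * indicator Om y)"
      using assms(2)[of x y] assms(3)[of x y] by (auto simp: indicator_def)
  qed
qed

text \<open>
  Here \<open>V\<close> are the values of the interpolation at some time within a step and \<open>A\<close> those at the beginning of the step, which
  determine the discrete slope \<open>z\<close>. The difference of the two integrands is split as
  \<open>(K - Wt) \<phi>(V\<^sub>j - V\<^sub>i) + Wt (\<phi>(V\<^sub>j - V\<^sub>i) - \<phi>(A\<^sub>j - A\<^sub>i))\<close>. Points \<open>x = 1\<close> or \<open>y = 1\<close>, which lie in \<open>\<Omega>\<close> but in no cell, form a null set.
\<close>

lemma cell_residual: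
  fixes Kb :: "real \<Rightarrow> real \<Rightarrow> real" and \<phi> :: "real \<Rightarrow> real"
  assumes n: "0 < n"
    and Kb_meas: "(\<lambda>(x, y). Kb x y) \<in> borel_measurable lborel2"
    and Kb: "\<And>x y. 0 \<le> Kb x y" "\<And>x y. Kb x y \<le> 1" "\<And>x y. x \<notin> Om \<or> y \<notin> Om \<Longrightarrow> Kb x y = 0"
    and \<phi>_meas: "\<phi> \<in> borel_measurable borel"
    and Wt: "\<And>i j. i \<in> {1..n} \<Longrightarrow> j \<in> {1..n} \<Longrightarrow> 0 \<le> Wt i j \<and> Wt i j \<le> 1"
    and C: "\<And>i j. i \<in> {1..n} \<Longrightarrow> j \<in> {1..n} \<Longrightarrow> \<bar>\<phi> (V j - V i)\<bar> \<le> C"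
    and \<omega>: "\<And>i j. i \<in> {1..n} \<Longrightarrow> j \<in> {1..n} \<Longrightarrow> \<bar>\<phi> (V j - V i) - \<phi> (A j - A i)\<bar> \<le> \<omega>"
    and z: "\<And>i. i \<in> {1..n} \<Longrightarrow> z i = 1 / real n * (\<Sum>j=1..n. Wt i j * \<phi> (A j - A i))"
  shows "flux_integrable Kb \<phi> (cell_fun n V)"
    and "(LBINT x. \<bar>flux Kb \<phi> (cell_fun n V) x - cell_fun n z x\<bar>)
      \<le> C * cell_L1_error Kb Wt n + \<omega>"
proof -
  have [measurable]: "\<phi> \<in> borel_measurable borel" by fact
  have Kb_meas' [measurable]: "(\<lambda>p. Kb (fst p) (snd p)) \<in> borel_measurable lborel2"
    using Kb_meas by (simp add: case_prod_unfold)
  have Kb_sec [measurable]: "(\<lambda>y. Kb x y) \<in> borel_measurable borel" for x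
    using measurable_compose[OF measurable_Pair1'[of x lborel lborel] Kb_meas'] by simp
  have C0: "0 \<le> C" using C[of 1 1] n by (auto intro: order_trans[OF abs_ge_zero])
  have \<omega>0: "0 \<le> \<omega>" using \<omega>[of 1 1] n by (auto intro: order_trans[OF abs_ge_zero])
  have meas: "(\<lambda>(x, y). Kb x y * \<phi> (cell_fun n V y - cell_fun n V x)) \<in> borel_measurable lborel2"
    unfolding case_prod_unfold by measurable
  \<comment> \<open>\<open>C\<close> bounds \<open>\<phi>\<close> on differences of cell values only; outside the cells the function is \<open>0\<close>, which is covered by the further terms.\<close>
  define C' where "C' = max C (max (\<bar>\<phi> 0\<bar>) (max (MAX i\<in>{1..n}. \<bar>\<phi> (V i)\<bar>) (MAX i\<in>{1..n}. \<bar>\<phi> (- V i)\<bar>)))"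
  have C'_ge: "C \<le> C'" "\<bar>\<phi> 0\<bar> \<le> C'" "(MAX i\<in>{1..n}. \<bar>\<phi> (V i)\<bar>) \<le> C'"
      "(MAX i\<in>{1..n}. \<bar>\<phi> (- V i)\<bar>) \<le> C'"
    unfolding C'_def by (intro max.cobounded1 max.coboundedI2 max.cobounded2 order_refl)+
  have \<phi>_bd: "\<bar>\<phi> (cell_fun n V y - cell_fun n V x)\<bar> \<le> C'" for x y
  proof -
    have val: "cell_fun n V x = 0 \<or> (\<exists>i\<in>{1..n}. cell_fun n V x = V i)" for x
      using cell_cover[OF n, of x] cell_fun_cell[of _ n x V] cell_fun_outside[of x n V] by metis
    have m: "\<bar>\<phi> (V i)\<bar> \<le> (MAX i\<in>{1..n}. \<bar>\<phi> (V i)\<bar>)" "\<bar>\<phi> (- V i)\<bar> \<le> (MAX i\<in>{1..n}. \<bar>\<phi> (- V i)\<bar>)"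
      if "i \<in> {1..n}" for i using that by auto
    consider "cell_fun n V x = 0" "cell_fun n V y = 0"
      | i where "i \<in> {1..n}" "cell_fun n V x = V i" "cell_fun n V y = 0"
      | i where "i \<in> {1..n}" "cell_fun n V y = V i" "cell_fun n V x = 0"
      | i j where "i \<in> {1..n}" "cell_fun n V x = V i" "j \<in> {1..n}" "cell_fun n V y = V j"
      using val[of x] val[of y] by blast
    then show ?thesis
    proof cases
      case 2
      then show ?thesis using order_trans[OF m(2) C'_ge(4), of i] by simp
    next
      case 3
      then show ?thesis using order_trans[OF m(1) C'_ge(3), of i] by simp
    next
      case 4
      then show ?thesis using order_trans[OF C C'_ge(1), of i j] by simp
    qed (use C'_ge(2) in simp)
  qed
  show int: "flux_integrable Kb \<phi> (cell_fun n V)"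
  proof (rule bounded_supported_integrable_Om2[OF meas])
    show "\<bar>Kb x y * \<phi> (cell_fun n V y - cell_fun n V x)\<bar> \<le> 1 * C'" for x y
      unfolding abs_mult by (rule mult_mono) (use Kb \<phi>_bd in auto)
  qed (use Kb in auto)
  have cutK: "integrable lborel2
      (\<lambda>(x, y). indicator (cell n i) x * (indicator (cell n j) y * \<bar>Kb x y - Wt i j\<bar>))"
    if "i \<in> {1..n}" "j \<in> {1..n}" for i j
  proof (rule bounded_supported_integrable_Om2)
    show "(\<lambda>(x, y). indicator (cell n i) x * (indicator (cell n j) y * \<bar>Kb x y - Wt i j\<bar>))
        \<in> borel_measurable lborel2"
      unfolding case_prod_unfold by measurable
    show "\<bar>indicator (cell n i) x * (indicator (cell n j) y * \<bar>Kb x y - Wt i j\<bar>)\<bar> \<le> 1" for x y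
      using Kb(1,2)[of x y] Wt[OF that] by (auto simp: indicator_def)
    show "indicator (cell n i) x * (indicator (cell n j) y * \<bar>Kb x y - Wt i j\<bar>) = 0"
      if "x \<notin> Om \<or> y \<notin> Om" for x y
      using that cell_subset[OF \<open>i \<in> {1..n}\<close>] cell_subset[OF \<open>j \<in> {1..n}\<close>]
      by (auto simp: indicator_def Om_def)
  qed
  define R where "R i j x = indicator (cell n i) x * (LBINT y. indicator (cell n j) y * \<bar>Kb x y - Wt i j\<bar>)" for i j x
  have R_int: "integrable lborel (R i j)" if "i \<in> {1..n}" "j \<in> {1..n}" for i j
    using lborel_pair.integrable_fst[OF cutK[OF that]] by (simp add: R_def[abs_def])
  have R_val: "(LBINT x. R i j x) = (LBINT p. indicator (cell n i \<times> cell n j) p * \<bar>Kb (fst p) (snd p) - Wt i j\<bar>)"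
    if "i \<in> {1..n}" "j \<in> {1..n}" for i j
    using lborel_pair.integral_fst[OF cutK[OF that]]
    by (simp add: R_def[abs_def] lborel_prod case_prod_unfold indicator_times mult.assoc)
  have pointwise: "\<bar>flux Kb \<phi> (cell_fun n V) x - cell_fun n z x\<bar>
      \<le> C * (\<Sum>i=1..n. \<Sum>j=1..n. R i j x) + indicator {0..<1} x * \<omega>" if "x \<noteq> 1" for x
  proof (cases "x \<in> {0..<1}")
    case False
    with that have "x \<notin> Om" by (auto simp: Om_def)
    have "0 \<le> R i j x" for i j
      unfolding R_def by (intro mult_nonneg_nonneg Bochner_Integration.integral_nonneg) auto
    then have "0 \<le> C * (\<Sum>i=1..n. \<Sum>j=1..n. R i j x)"
      using C0 by (intro mult_nonneg_nonneg sum_nonneg)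
    with False \<open>x \<notin> Om\<close> show ?thesis using Kb(3)[of x] by (simp add: cell_fun_outside)
  next
    case True
    then obtain i where i: "i \<in> {1..n}" "x \<in> cell n i" using cell_cover[OF n] by blast
    let ?c = "\<lambda>j y. indicator (cell n j) y :: real"
    have cut: "integrable lborel (\<lambda>y. ?c j y * h y)"
      if "j \<in> {1..n}" "h \<in> borel_measurable borel" "\<And>y. \<bar>h y\<bar> \<le> b" for j h b
      by (rule bounded_cut_integrable[OF that(2,3)]) (use that(1) in \<open>auto simp: emeasure_cell\<close>)
    have ind: "integrable lborel (\<lambda>y. ?c j y * b)" "(LBINT y. ?c j y * b) = 1 / real n * b"
      if "j \<in> {1..n}" for j and b :: real
      using that by (auto simp: measure_cell emeasure_cell intro!: integrable_mult_left integrable_real_indicator)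
    have Kcut: "integrable lborel (\<lambda>y. ?c j y * (Kb x y * b))" if "j \<in> {1..n}" for j b
    proof (rule cut[OF that])
      show "\<bar>Kb x y * b\<bar> \<le> 1 * \<bar>b\<bar>" for y
        unfolding abs_mult by (rule mult_right_mono) (use Kb in auto)
    qed measurable
    have dcut: "integrable lborel (\<lambda>y. ?c j y * \<bar>Kb x y - Wt i j\<bar>)" if "j \<in> {1..n}" for j
    proof (rule cut[OF that])
      show "\<bar>\<bar>Kb x y - Wt i j\<bar>\<bar> \<le> 1" for y
        using Kb(1,2)[of x y] Wt[OF i(1) that] by auto
    qed measurable
    have "flux Kb \<phi> (cell_fun n V) x
        = (LBINT y. (\<Sum>j=1..n. ?c j y * (Kb x y * \<phi> (V j - V i))))"
    proof (rule integral_cong_AE)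
      show "AE y in lborel. Kb x y * \<phi> (cell_fun n V y - cell_fun n V x)
          = (\<Sum>j=1..n. ?c j y * (Kb x y * \<phi> (V j - V i)))"
        using AE_lborel_singleton[of 1]
      proof eventually_elim
        case (elim y)
        show ?case
        proof (cases "y \<in> {0..<1}")
          case True
          then obtain j where j: "j \<in> {1..n}" "y \<in> cell n j" using cell_cover[OF n] by blast
          have "(\<Sum>j=1..n. ?c j y * (Kb x y * \<phi> (V j - V i))) = Kb x y * \<phi> (V j - V i)"
            using cell_fun_cell[OF j, of "\<lambda>j. Kb x y * \<phi> (V j - V i)"] by (simp add: cell_fun_def)
          then show ?thesis using cell_fun_cell[OF i] cell_fun_cell[OF j] by simp
        next
          case False
          then have "y \<notin> Om" using elim by (auto simp: Om_def)
          then show ?thesis using Kb(3)[of x y] by simp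
        qed
      qed
    qed measurable
    also have "\<dots> = (\<Sum>j=1..n. LBINT y. ?c j y * (Kb x y * \<phi> (V j - V i)))"
      by (rule Bochner_Integration.integral_sum) (rule Kcut)
    finally have 1: "flux Kb \<phi> (cell_fun n V) x
        = (\<Sum>j=1..n. LBINT y. ?c j y * (Kb x y * \<phi> (V j - V i)))" .
    have 2: "cell_fun n z x = (\<Sum>j=1..n. LBINT y. ?c j y * (Wt i j * \<phi> (A j - A i)))"
      unfolding cell_fun_cell[OF i] z[OF i(1)] sum_distrib_left
      by (intro sum.cong refl ind(2)[symmetric])
    have "\<bar>flux Kb \<phi> (cell_fun n V) x - cell_fun n z x\<bar>
        \<le> (\<Sum>j=1..n. \<bar>(LBINT y. ?c j y * (Kb x y * \<phi> (V j - V i)))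
            - (LBINT y. ?c j y * (Wt i j * \<phi> (A j - A i)))\<bar>)"
      unfolding 1 2 by (simp add: sum_subtractf[symmetric] sum_abs)
    also have "\<dots> \<le> (\<Sum>j=1..n. C * R i j x + \<omega> / n)"
    proof (rule sum_mono)
      fix j assume j: "j \<in> {1..n}"
      have eq: "(LBINT y. ?c j y * (Kb x y * \<phi> (V j - V i))) - (LBINT y. ?c j y * (Wt i j * \<phi> (A j - A i)))
          = (LBINT y. ?c j y * (Kb x y * \<phi> (V j - V i)) - ?c j y * (Wt i j * \<phi> (A j - A i)))"
        by (rule Bochner_Integration.integral_diff[symmetric]) (use Kcut[OF j] ind(1)[OF j] in auto)
      have "\<bar>(LBINT y. ?c j y * (Kb x y * \<phi> (V j - V i)) - ?c j y * (Wt i j * \<phi> (A j - A i)))\<bar>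
          \<le> (LBINT y. C * (?c j y * \<bar>Kb x y - Wt i j\<bar>) + ?c j y * \<omega>)"
      proof (rule integral_abs_bound[THEN order_trans], rule integral_mono)
        fix y
        have "\<bar>Kb x y * \<phi> (V j - V i) - Wt i j * \<phi> (A j - A i)\<bar>
            = \<bar>(Kb x y - Wt i j) * \<phi> (V j - V i) + Wt i j * (\<phi> (V j - V i) - \<phi> (A j - A i))\<bar>"
          by (simp add: algebra_simps)
        also have "\<dots> \<le> \<bar>Kb x y - Wt i j\<bar> * \<bar>\<phi> (V j - V i)\<bar> + \<bar>Wt i j\<bar> * \<bar>\<phi> (V j - V i) - \<phi> (A j - A i)\<bar>"
          by (simp add: abs_mult[symmetric] abs_triangle_ineq)
        also have "\<dots> \<le> \<bar>Kb x y - Wt i j\<bar> * C + 1 * \<omega>"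
          by (intro add_mono mult_mono) (use C[OF i(1) j] \<omega>[OF i(1) j] Wt[OF i(1) j] \<omega>0 in auto)
        finally show "\<bar>?c j y * (Kb x y * \<phi> (V j - V i)) - ?c j y * (Wt i j * \<phi> (A j - A i))\<bar>
            \<le> C * (?c j y * \<bar>Kb x y - Wt i j\<bar>) + ?c j y * \<omega>"
          by (auto simp: indicator_def mult.commute)
      qed (use Kcut[OF j] ind(1)[OF j] dcut[OF j] in auto)
      also have "\<dots> = C * R i j x + \<omega> / n"
        using dcut[OF j] ind[OF j] i(2) by (simp add: R_def)
      finally show "\<bar>(LBINT y. ?c j y * (Kb x y * \<phi> (V j - V i)))
            - (LBINT y. ?c j y * (Wt i j * \<phi> (A j - A i)))\<bar> \<le> C * R i j x + \<omega> / n"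
        unfolding eq .
    qed
    also have "\<dots> = C * (\<Sum>j=1..n. R i j x) + \<omega>"
      using n by (simp add: sum.distrib sum_distrib_left)
    also have "(\<Sum>j=1..n. R i j x) = (\<Sum>i'=1..n. \<Sum>j=1..n. R i' j x)"
    proof -
      have "(\<Sum>i'=1..n. \<Sum>j=1..n. R i' j x) = (\<Sum>i'=1..n. if i' = i then \<Sum>j=1..n. R i j x else 0)"
        by (rule sum.cong) (use i(2) cell_unique in \<open>auto simp: R_def indicator_def\<close>)
      with i(1) show ?thesis by simp
    qed
    finally show ?thesis using True by simp
  qed
  have RR: "integrable lborel (\<lambda>x. \<Sum>i=1..n. \<Sum>j=1..n. R i j x)"
    by (intro Bochner_Integration.integrable_sum R_int)
  have RR_val: "(LBINT x. (\<Sum>i=1..n. \<Sum>j=1..n. R i j x)) = (\<Sum>i=1..n. \<Sum>j=1..n. LBINT x. R i j x)"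
  proof -
    have "(LBINT x. (\<Sum>i=1..n. \<Sum>j=1..n. R i j x)) = (\<Sum>i=1..n. LBINT x. (\<Sum>j=1..n. R i j x))"
      by (rule Bochner_Integration.integral_sum) (intro Bochner_Integration.integrable_sum R_int)
    also have "\<dots> = (\<Sum>i=1..n. \<Sum>j=1..n. LBINT x. R i j x)"
      by (intro sum.cong refl Bochner_Integration.integral_sum R_int)
    finally show ?thesis .
  qed
  have ii: "integrable lborel (\<lambda>x. indicator {0..<1::real} x * \<omega>)"
    "(LBINT x. indicator {0..<1::real} x * \<omega>) = \<omega>"
    by (auto intro!: integrable_mult_left integrable_real_indicator)
  have "(LBINT x. \<bar>flux Kb \<phi> (cell_fun n V) x - cell_fun n z x\<bar>)
      \<le> (LBINT x. C * (\<Sum>i=1..n. \<Sum>j=1..n. R i j x) + indicator {0..<1} x * \<omega>)"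
  proof (rule integral_mono_AE)
    show "AE x in lborel. \<bar>flux Kb \<phi> (cell_fun n V) x - cell_fun n z x\<bar>
        \<le> C * (\<Sum>i=1..n. \<Sum>j=1..n. R i j x) + indicator {0..<1} x * \<omega>"
      using AE_lborel_singleton[of 1] by eventually_elim (rule pointwise)
    show "integrable lborel (\<lambda>x. \<bar>flux Kb \<phi> (cell_fun n V) x - cell_fun n z x\<bar>)"
      by (rule integrable_abs, rule Bochner_Integration.integrable_diff
          [OF lborel_pair.integrable_fst[OF int] cell_fun_integrable])
    show "integrable lborel (\<lambda>x. C * (\<Sum>i=1..n. \<Sum>j=1..n. R i j x) + indicator {0..<1} x * \<omega>)"
      by (rule Bochner_Integration.integrable_add[OF integrable_mult_right[OF RR] ii(1)])
  qed
  also have "\<dots> = C * (LBINT x. (\<Sum>i=1..n. \<Sum>j=1..n. R i j x)) + \<omega>"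
    using RR ii by simp
  also have "\<dots> = C * cell_L1_error Kb Wt n + \<omega>"
    unfolding RR_val by (intro arg_cong2[where f = "(+)"] arg_cong2[where f = "(*)"] sum.cong refl R_val)
  finally show "(LBINT x. \<bar>flux Kb \<phi> (cell_fun n V) x - cell_fun n z x\<bar>)
      \<le> C * cell_L1_error Kb Wt n + \<omega>" .
qed

section \<open>The explicit Euler scheme\<close>

lemma partition_step:
  assumes "time_partition T N t" "h \<in> {1..N}"
  shows "t (h - 1) < t h" "step t (h - 1) = t h - t (h - 1)"
proof -
  show less: "t (h - 1) < t h"
    using assms unfolding time_partition_def by blast
  have "h - 1 + 1 = h" using assms(2) by auto
  then show "step t (h - 1) = t h - t (h - 1)"
    using less by (simp add: step_def del: One_nat_def)
qed

lemma partition_mono: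
  assumes "time_partition T N t" "i \<le> j" "j \<le> N"
  shows "t i \<le> t j"
  using assms(2,3)
proof (induction j rule: dec_induct)
  case (step j)
  then show ?case using partition_step(1)[OF assms(1), of "Suc j"] by auto
qed simp

lemma partition_range:
  assumes "time_partition T N t" "h \<le> N"
  shows "0 \<le> t h" "t h \<le> T"
  using partition_mono[OF assms(1), of 0 h] partition_mono[OF assms(1), of h N] assms
  by (auto simp: time_partition_def)

lemma step_le_mesh: "h \<in> {1..N} \<Longrightarrow> step t (h - 1) \<le> mesh N t"
  unfolding mesh_def by (rule Max_ge) auto

lemma partition_locate:
  assumes tp: "time_partition T N t" and s: "0 < s" "s \<le> T"
  obtains h where "h \<in> {1..N}" "s \<in> {t (h - 1)<..t h}"
proof -
  define h where "h = (LEAST h. s \<le> t h)"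
  have N: "s \<le> t N" "t 0 < s" using tp s by (auto simp: time_partition_def)
  have h: "s \<le> t h" "h \<le> N" unfolding h_def by (rule LeastI[of _ N], rule N) (rule Least_le, rule N)
  with N have "h \<noteq> 0" by (metis not_le)
  then have "\<not> s \<le> t (h - 1)" unfolding h_def using not_less_Least by (metis diff_less less_one not_gr_zero)
  with h \<open>h \<noteq> 0\<close> show thesis by (intro that[of h]) auto
qed

definition discrete_slope ::
  "(real \<Rightarrow> real \<Rightarrow> real) \<Rightarrow> real \<Rightarrow> nat \<Rightarrow> (nat \<Rightarrow> real) \<Rightarrow> nat \<Rightarrow> real" where
  "discrete_slope K p n A i = 1 / real n * (\<Sum>j=1..n. weight K n i j * phi p (A j - A i))"

lemma discrete_solution_step:
  assumes "time_partition T N t" "discrete_solution K p g n N t U" "h \<in> {1..N}" "i \<in> {1..n}"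
  shows "U h i = U (h - 1) i + (t h - t (h - 1)) * discrete_slope K p n (U (h - 1)) i"
proof -
  have "(U h i - U (h - 1) i) / (t h - t (h - 1)) = discrete_slope K p n (U (h - 1)) i"
    using assms(2-4) unfolding discrete_solution_def discrete_slope_def partition_step(2)[OF assms(1,3), symmetric]
    by blast
  then show ?thesis using partition_step(1)[OF assms(1,3)] by (simp add: field_simps)
qed

lemma discrete_slope_le:
  assumes n: "0 < n" and W: "\<And>j. j \<in> {1..n} \<Longrightarrow> 0 \<le> weight K n i j \<and> weight K n i j \<le> 1"
    and c: "0 \<le> c" "\<And>j. j \<in> {1..n} \<Longrightarrow> phi p (A j - A i) \<le> c"
  shows "discrete_slope K p n A i \<le> c"
proof -
  have "(\<Sum>j=1..n. weight K n i j * phi p (A j - A i)) \<le> (\<Sum>j=1..n. c)"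
  proof (rule sum_mono)
    fix j assume j: "j \<in> {1..n}"
    have "weight K n i j * phi p (A j - A i) \<le> weight K n i j * c"
      using W[OF j] c(2)[OF j] by (intro mult_left_mono) auto
    also have "\<dots> \<le> 1 * c" using W[OF j] c(1) by (intro mult_right_mono) auto
    finally show "weight K n i j * phi p (A j - A i) \<le> c" by simp
  qed
  then show ?thesis using n by (simp add: discrete_slope_def field_simps)
qed

lemma discrete_slope_uminus: "discrete_slope K p n (\<lambda>j. - A j) i = - discrete_slope K p n A i"
proof -
  have "phi p (- A j - - A i) = - phi p (A j - A i)" for j
    using phi_odd[of p "A j - A i"] by (simp add: algebra_simps)
  then show ?thesis by (simp add: discrete_slope_def sum_negf del: minus_diff_eq)
qed

lemma discrete_slope_abs_le:
  assumes n: "0 < n" and W: "\<And>j. j \<in> {1..n} \<Longrightarrow> 0 \<le> weight K n i j \<and> weight K n i j \<le> 1"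
    and c: "0 \<le> c" "\<And>j. j \<in> {1..n} \<Longrightarrow> \<bar>phi p (A j - A i)\<bar> \<le> c"
  shows "\<bar>discrete_slope K p n A i\<bar> \<le> c"
proof -
  have "discrete_slope K p n A i \<le> c"
    by (rule discrete_slope_le[OF n W c(1)]) (use c(2) in \<open>auto simp: abs_le_iff\<close>)
  moreover have "discrete_slope K p n (\<lambda>j. - A j) i \<le> c"
  proof (rule discrete_slope_le[OF n W c(1)])
    fix j assume "j \<in> {1..n}"
    then show "phi p (- A j - - A i) \<le> c"
      using c(2)[of j] phi_odd[of p "A j - A i"] by (simp add: algebra_simps abs_le_iff)
  qed
  ultimately show ?thesis by (simp add: discrete_slope_uminus abs_le_iff)
qed

text \<open>
  With \<open>r = M - A\<^sub>i\<close>, monotonicity of \<open>\<phi>\<close> bounds the slope by \<open>\<phi>(r) = r\<^sup>p\<^sup>-\<^sup>2 r\<close>, and the condition on \<open>\<tau>\<close> ensures \<open>\<tau> \<phi>(r) \<le> r\<close>. The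
  lower bound follows because the scheme is odd.
\<close>

lemma euler_step_max_principle:
  assumes p: "2 \<le> p" and n: "0 < n"
    and W: "\<And>j. j \<in> {1..n} \<Longrightarrow> 0 \<le> weight K n i j \<and> weight K n i j \<le> 1"
    and A: "\<And>j. j \<in> {1..n} \<Longrightarrow> \<bar>A j\<bar> \<le> M" and i: "i \<in> {1..n}"
    and \<tau>: "0 \<le> \<tau>" "\<tau> * (2 * M) powr (p - 2) \<le> 1"
  shows "\<bar>A i + \<tau> * discrete_slope K p n A i\<bar> \<le> M"
proof -
  have upper: "A i + \<tau> * discrete_slope K p n A i \<le> M"
    if A: "\<And>j. j \<in> {1..n} \<Longrightarrow> \<bar>A j\<bar> \<le> M" for A
  proof -
    define r where "r = M - A i"
    have r: "0 \<le> r" "r \<le> 2 * M" using A[OF i] by (auto simp: r_def abs_le_iff)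
    have "discrete_slope K p n A i \<le> phi p r"
      by (rule discrete_slope_le[OF n W phi_nonneg[OF r(1)]])
        (use A p in \<open>auto simp: r_def abs_le_iff intro!: monoD[OF phi_mono]\<close>)
    then have "\<tau> * discrete_slope K p n A i \<le> \<tau> * phi p r"
      using \<tau>(1) by (rule mult_left_mono)
    also have "\<dots> = (\<tau> * r powr (p - 2)) * r"
      using r by (simp add: phi_def)
    also have "\<dots> \<le> (\<tau> * (2 * M) powr (p - 2)) * r"
      using r p \<tau> by (intro mult_right_mono mult_left_mono powr_mono2) auto
    also have "\<dots> \<le> 1 * r"
      using \<tau> r by (intro mult_right_mono) auto
    finally show ?thesis by (simp add: r_def)
  qed
  have "A i + \<tau> * discrete_slope K p n A i \<le> M"
    by (rule upper) (rule A)
  moreover have "- A i + \<tau> * discrete_slope K p n (\<lambda>j. - A j) i \<le> M"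
    by (rule upper) (use A in auto)
  ultimately show ?thesis by (simp add: discrete_slope_uminus abs_le_iff)
qed

text \<open>
  For \<open>p \<le> 2\<close> one has \<open>\<phi>(r) \<le> 1 + r\<close>, so the maximum grows at most exponentially with a rate independent of the
  step size.
\<close>

lemma euler_step_linear_growth:
  assumes p: "1 < p" "p \<le> 2" and n: "0 < n"
    and W: "\<And>j. j \<in> {1..n} \<Longrightarrow> 0 \<le> weight K n i j \<and> weight K n i j \<le> 1"
    and A: "\<And>j. j \<in> {1..n} \<Longrightarrow> \<bar>A j\<bar> \<le> m" and i: "i \<in> {1..n}" and \<tau>: "0 \<le> \<tau>"
  shows "\<bar>A i + \<tau> * discrete_slope K p n A i\<bar> + 1 \<le> (m + 1) * exp (2 * \<tau>)"
proof -
  have m: "0 \<le> m" using A[OF i] by linarith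
  have lin: "phi p r \<le> 1 + r" if "0 \<le> r" for r
  proof (cases "r \<le> 1")
    case True
    then have "r powr (p - 1) \<le> 1 powr (p - 1)" using that p by (intro powr_mono2) auto
    then show ?thesis using that by (simp add: phi_eq)
  next
    case False
    then have "r powr (p - 1) \<le> r powr 1" using p by (intro powr_mono) auto
    then show ?thesis using that False p by (simp add: phi_eq)
  qed
  have "\<bar>discrete_slope K p n A i\<bar> \<le> 1 + 2 * m"
  proof (rule discrete_slope_abs_le[OF n W])
    fix j assume j: "j \<in> {1..n}"
    then have "\<bar>A j - A i\<bar> \<le> 2 * m" using A[OF i] A[OF j] by linarith
    then have "\<bar>phi p (A j - A i)\<bar> \<le> phi p (2 * m)" by (rule phi_abs_le[OF p(1)])
    also have "\<dots> \<le> 1 + 2 * m" using lin m by simp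
    finally show "\<bar>phi p (A j - A i)\<bar> \<le> 1 + 2 * m" .
  qed (use m in auto)
  then have "\<tau> * \<bar>discrete_slope K p n A i\<bar> \<le> \<tau> * (1 + 2 * m)"
    using \<tau> by (rule mult_left_mono)
  moreover have "\<bar>A i + \<tau> * discrete_slope K p n A i\<bar> \<le> \<bar>A i\<bar> + \<tau> * \<bar>discrete_slope K p n A i\<bar>"
    using \<tau> abs_triangle_ineq[of "A i" "\<tau> * discrete_slope K p n A i"] by (simp add: abs_mult)
  ultimately have "\<bar>A i + \<tau> * discrete_slope K p n A i\<bar> + 1 \<le> m + 1 + \<tau> * (1 + 2 * m)"
    using A[OF i] by linarith
  also have "\<dots> \<le> (m + 1) * (1 + 2 * \<tau>)" using \<tau> by (simp add: algebra_simps)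
  also have "\<dots> \<le> (m + 1) * exp (2 * \<tau>)"
    using m exp_ge_add_one_self[of "2 * \<tau>"] by (intro mult_left_mono) auto
  finally show ?thesis .
qed

lemma discrete_solutions_bounded:
  assumes p: "1 < p" and M: "0 \<le> M"
    and W: "\<And>n i j. 0 < n \<Longrightarrow> i \<in> {1..n} \<Longrightarrow> j \<in> {1..n} \<Longrightarrow> 0 \<le> weight K n i j \<and> weight K n i j \<le> 1"
    and I: "\<And>n i. 0 < n \<Longrightarrow> i \<in> {1..n} \<Longrightarrow> \<bar>init g n i\<bar> \<le> M"
  obtains B \<delta> where "M \<le> B" "0 < \<delta>"
    "\<And>n N t U h i. 0 < n \<Longrightarrow> time_partition T N t \<Longrightarrow> mesh N t < \<delta> \<Longrightarrow> discrete_solution K p g n N t U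
      \<Longrightarrow> h \<le> N \<Longrightarrow> i \<in> {1..n} \<Longrightarrow> \<bar>U h i\<bar> \<le> B"
proof (cases "2 \<le> p")
  case True
  define \<delta> where "\<delta> = 1 / ((2 * M) powr (p - 2) + 1)"
  have \<delta>: "0 < \<delta>" by (simp add: \<delta>_def add_nonneg_pos)
  have \<delta>_le: "\<delta> * (2 * M) powr (p - 2) \<le> 1"
    by (simp add: \<delta>_def add_nonneg_pos)
  show ?thesis
  proof (rule that[of M \<delta>])
    fix n N t U h i
    assume n: "0 < n" and tp: "time_partition T N t" and mesh: "mesh N t < \<delta>"
      and U: "discrete_solution K p g n N t U" and "h \<le> N" "i \<in> {1..n}"
    show "\<bar>U h i\<bar> \<le> M"
      using \<open>h \<le> N\<close> \<open>i \<in> {1..n}\<close>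
    proof (induction h arbitrary: i)
      case 0
      then show ?case using U I[OF n] by (auto simp: discrete_solution_def)
    next
      case (Suc h)
      have h: "Suc h \<in> {1..N}" using Suc.prems by auto
      let ?\<tau> = "t (Suc h) - t h"
      have \<tau>: "0 \<le> ?\<tau>" "?\<tau> \<le> \<delta>"
        using partition_step[OF tp h] step_le_mesh[OF h, of t] mesh by auto
      have "?\<tau> * (2 * M) powr (p - 2) \<le> \<delta> * (2 * M) powr (p - 2)"
        using \<tau> by (intro mult_right_mono) auto
      with \<delta>_le have "?\<tau> * (2 * M) powr (p - 2) \<le> 1" by linarith
      then have "\<bar>U h i + ?\<tau> * discrete_slope K p n (U h) i\<bar> \<le> M"
        using Suc.IH Suc.prems \<tau>(1) by (intro euler_step_max_principle[OF True n W[OF n]]) auto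
      then show ?case using discrete_solution_step[OF tp U h Suc.prems(2)] by simp
    qed
  qed (use \<delta> in auto)
next
  case False
  show ?thesis
  proof (rule that[of "(M + 1) * exp (2 * \<bar>T\<bar>)" 1])
    have "(M + 1) * 1 \<le> (M + 1) * exp (2 * \<bar>T\<bar>)" using M by (intro mult_left_mono) auto
    then show "M \<le> (M + 1) * exp (2 * \<bar>T\<bar>)" by simp
    fix n N t U h i
    assume n: "0 < n" and tp: "time_partition T N t"
      and U: "discrete_solution K p g n N t U" and hi: "h \<le> N" "i \<in> {1..n}"
    have "\<bar>U h i\<bar> \<le> (M + 1) * exp (2 * t h) - 1"
      using hi
    proof (induction h arbitrary: i)
      case 0
      then show ?case using U I[OF n] tp by (auto simp: discrete_solution_def time_partition_def)
    next
      case (Suc h)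
      have h: "Suc h \<in> {1..N}" using Suc.prems by auto
      let ?\<tau> = "t (Suc h) - t h"
      have "\<bar>U h i + ?\<tau> * discrete_slope K p n (U h) i\<bar> + 1
          \<le> ((M + 1) * exp (2 * t h) - 1 + 1) * exp (2 * ?\<tau>)"
        using Suc.IH Suc.prems False p partition_step(1)[OF tp h]
        by (intro euler_step_linear_growth[OF _ _ n W[OF n]]) auto
      also have "\<dots> = (M + 1) * exp (2 * t (Suc h))"
        by (simp add: mult.assoc exp_add[symmetric] right_diff_distrib)
      finally show ?case using discrete_solution_step[OF tp U h Suc.prems(2)] by simp
    qed
    also have "\<dots> \<le> (M + 1) * exp (2 * \<bar>T\<bar>)"
    proof -
      have "exp (2 * t h) \<le> exp (2 * \<bar>T\<bar>)" using partition_range(2)[OF tp hi(1)] by simp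
      then have "(M + 1) * exp (2 * t h) \<le> (M + 1) * exp (2 * \<bar>T\<bar>)"
        using M by (intro mult_left_mono) auto
      then show ?thesis by linarith
    qed
    finally show "\<bar>U h i\<bar> \<le> (M + 1) * exp (2 * \<bar>T\<bar>)" .
  qed simp
qed

lemma interpolation_initial:
  assumes "discrete_solution K p g n N t U"
  shows "interpolation g n N t U x 0 = cell_fun n (U 0) x"
  using assms by (auto simp: interpolation_def cell_fun_def discrete_solution_def intro!: sum.cong)

text \<open>
  On \<open>(t\<^sub>h\<^sub>-\<^sub>1, t\<^sub>h]\<close> the interpolation is the solution of the differential equation with the slope frozen at the beginning of the step.
\<close>

lemma interpolation_step:
  assumes tp: "time_partition T N t" and U: "discrete_solution K p g n N t U"
    and h: "h \<in> {1..N}" and s: "s \<in> {t (h - 1)<..t h}"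
  shows "interpolation g n N t U x s
    = cell_fun n (\<lambda>i. U (h - 1) i + (s - t (h - 1)) * discrete_slope K p n (U (h - 1)) i) x"
proof -
  have "h - 1 \<le> N" using h by auto
  then have "0 < s" using partition_range(1)[OF tp, of "h - 1"] s by auto
  have unique: "k = h" if k: "k \<in> {1..N}" "s \<in> {t (k - 1)<..t k}" for k
  proof (rule ccontr)
    assume "k \<noteq> h"
    then consider "k \<le> h - 1" | "h \<le> k - 1" by linarith
    then show False
    proof cases
      case 1
      then have "t k \<le> t (h - 1)" using partition_mono[OF tp] h by auto
      with k s show False by auto
    next
      case 2
      then have "t h \<le> t (k - 1)" using partition_mono[OF tp] k by auto
      with k s show False by auto
    qed
  qed
  show ?thesis
    unfolding interpolation_def cell_fun_def
  proof (rule sum.cong[OF refl])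
    fix i assume i: "i \<in> {1..n}"
    define c where "c k = (t k - s) / step t (k - 1) * U (k - 1) i + (s - t (k - 1)) / step t (k - 1) * U k i" for k
    have "(\<Sum>k=1..N. indicator {t (k - 1)<..t k} s * c k) = (\<Sum>k=1..N. if k = h then c k else 0)"
    proof (rule sum.cong[OF refl])
      fix k assume k: "k \<in> {1..N}"
      show "indicator {t (k - 1)<..t k} s * c k = (if k = h then c k else 0)"
      proof (cases "k = h")
        case True
        with s show ?thesis by simp
      next
        case False
        then have "s \<notin> {t (k - 1)<..t k}" using unique[OF k] by blast
        with False show ?thesis by simp
      qed
    qed
    also have "\<dots> = c h" using h by simp
    also have "c h = U (h - 1) i + (s - t (h - 1)) * discrete_slope K p n (U (h - 1)) i"
    proof -
      define d where "d = t h - t (h - 1)"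
      have d: "d \<noteq> 0" "step t (h - 1) = d" using partition_step[OF tp h] by (auto simp: d_def)
      have eq: "t h - s = d - (s - t (h - 1))" by (simp add: d_def)
      show ?thesis
        unfolding c_def d(2) eq discrete_solution_step[OF tp U h i, folded d_def]
        using d(1) by (simp add: field_simps)
    qed
    finally show "indicator (cell n i) x * (if s = 0 then init g n i else
        \<Sum>k=1..N. indicator {t (k - 1)<..t k} s *
          ((t k - s) / step t (k - 1) * U (k - 1) i + (s - t (k - 1)) / step t (k - 1) * U k i))
      = indicator (cell n i) x * (U (h - 1) i + (s - t (h - 1)) * discrete_slope K p n (U (h - 1)) i)"
      using \<open>0 < s\<close> by (simp add: c_def)
  qed
qed

section \<open>Representatives of the kernel and of the solution\<close>

text \<open>
  Passing to a Borel representative may destroy symmetry and bounds on a null set; averaging with the transposed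
  kernel and clipping to \<open>[0,1]\<close> restores them everywhere.
\<close>

lemma kernel_representative:
  assumes "symmetric_kernel K"
  obtains Kb where "(\<lambda>(x, y). Kb x y) \<in> borel_measurable lborel2"
    "\<And>x y. 0 \<le> Kb x y" "\<And>x y. Kb x y \<le> 1" "\<And>x y. Kb x y = Kb y x"
    "\<And>x y. x \<notin> Om \<or> y \<notin> Om \<Longrightarrow> Kb x y = 0"
    "AE z in lborel. z \<in> Om \<times> Om \<longrightarrow> K (fst z) (snd z) = Kb (fst z) (snd z)"
proof -
  have K: "(\<lambda>(x, y). K x y) \<in> borel_measurable (lebesgue_on (Om \<times> Om))"
    and K1: "\<And>x y. x \<in> Om \<Longrightarrow> y \<in> Om \<Longrightarrow> 0 \<le> K x y \<and> K x y \<le> 1 \<and> K x y = K y x"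
    using assms unfolding symmetric_kernel_def by blast+
  obtain k where k: "k \<in> borel_measurable borel" "\<And>z. z \<notin> Om \<times> Om \<Longrightarrow> k z = 0"
    "AE z in lborel. z \<in> Om \<times> Om \<longrightarrow> (case z of (x, y) \<Rightarrow> K x y) = k z"
    using borel_representative_exists[OF Om2_borel K] by blast
  define Kb where "Kb x y = max 0 (min 1 ((k (x, y) + k (y, x)) / 2))" for x y
  have [measurable]: "k \<in> borel_measurable (borel \<Otimes>\<^sub>M borel)"
    using k(1) by (simp add: borel_prod)
  show thesis
  proof (rule that[of Kb])
    show "(\<lambda>(x, y). Kb x y) \<in> borel_measurable lborel2"
      unfolding Kb_def case_prod_unfold by measurable
    show "AE z in lborel. z \<in> Om \<times> Om \<longrightarrow> K (fst z) (snd z) = Kb (fst z) (snd z)"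
      using k(3) AE_lborel_swap[OF k(3)]
    proof eventually_elim
      case (elim z)
      show ?case
      proof
        assume z: "z \<in> Om \<times> Om"
        obtain x y where xy: "z = (x, y)" by (cases z)
        then have "k (x, y) = K x y" "k (y, x) = K x y"
          using elim z K1[of x y] by auto
        then show "K (fst z) (snd z) = Kb (fst z) (snd z)"
          using xy z K1[of x y] by (auto simp: Kb_def)
      qed
    qed
  qed (use k(2) in \<open>auto simp: Kb_def add.commute\<close>)
qed

text \<open>
  At each time \<open>u\<close> equals its primitive for almost every \<open>x\<close>, which transfers both the equation and the integrability
  of the flux from \<open>u\<close> to the primitive.
\<close>

lemma solution_representative:
  assumes T: "0 < T" and p: "1 < p" and sol: "is_solution K p g T u"
    and Kb: "(\<lambda>(x, y). Kb x y) \<in> borel_measurable lborel2"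
      "\<And>x y. 0 \<le> Kb x y" "\<And>x y. Kb x y = Kb y x"
      "\<And>x y. x \<notin> Om \<or> y \<notin> Om \<Longrightarrow> Kb x y = 0"
      "AE z in lborel. z \<in> Om \<times> Om \<longrightarrow> K (fst z) (snd z) = Kb (fst z) (snd z)"
  obtains u0 vb where "nonlocal_flow Kb (phi p) u0 vb T"
    "\<And>s. s \<in> {0..T} \<Longrightarrow> AE x in lborel. x \<in> Om \<longrightarrow> u x s = primitive u0 vb x s"
    "\<And>x. x \<notin> Om \<Longrightarrow> u0 x = 0" "AE x in lborel. x \<in> Om \<longrightarrow> g x = u0 x"
proof -
  obtain v where W: "W11 T u v" and init: "AE x in OmM. u x 0 = g x"
    and dom: "AE s in lebesgue_on {0<..<T}. plap_domain K p (\<lambda>x. u x s)"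
    and eq: "AE z in lebesgue_on (Om \<times> {0<..<T}).
       (case z of (x, s) \<Rightarrow> v x s = - nonlocal_plap K p (\<lambda>y. u y s) x)"
    using sol unfolding is_solution_def by blast
  note W' = W[unfolded W11_def]
  note v_int = W'[THEN conjunct2, THEN conjunct1]
    and u_slice = W'[THEN conjunct2, THEN conjunct2, THEN conjunct2, THEN conjunct1, rule_format]
  have T_borel: "{0<..<T} \<in> sets borel" by simp
  obtain vb where vb: "integrable lborel2 (\<lambda>(x, t). vb x t)"
    "\<And>x t. x \<notin> Om \<or> t \<notin> {0<..<T} \<Longrightarrow> vb x t = 0"
    "AE z in lborel. z \<in> Om \<times> {0<..<T} \<longrightarrow> v (fst z) (snd z) = vb (fst z) (snd z)"
    by (rule product_representative_exists[OF Om_borel T_borel v_int]) (rule that)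
  have "0 \<in> {0..T}" using T by simp
  then obtain u0 where u0: "integrable lborel u0" "\<And>x. x \<notin> Om \<Longrightarrow> u0 x = 0"
    "AE x in lborel. x \<in> Om \<longrightarrow> u x 0 = u0 x"
    using OmM_representative_exists[OF u_slice] by blast
  define P where "P = primitive u0 vb"
  have prim: "AE x in lborel. x \<in> Om \<longrightarrow> u x s = P x s" if "s \<in> {0..T}" for s
    unfolding P_def primitive_def by (rule W11_primitive[OF W T u0 vb that])
  have P_meas [measurable]: "(\<lambda>x. P x s) \<in> borel_measurable borel" for s
    unfolding P_def by (rule primitive_measurable(2)[OF u0(1) vb(1)])
  have [measurable]: "phi p \<in> borel_measurable borel"
    by (rule borel_measurable_mono[OF phi_mono[OF p]])
  have Kb_meas [measurable]: "(\<lambda>z. Kb (fst z) (snd z)) \<in> borel_measurable lborel2"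
    using Kb(1) by (simp add: case_prod_unfold)
  have Kb_sec [measurable]: "(\<lambda>y. Kb x y) \<in> borel_measurable borel" for x
    using measurable_compose[OF measurable_Pair1'[of x lborel lborel] Kb_meas] by simp
  have dom': "AE s in lborel. s \<in> {0<..<T} \<longrightarrow> plap_domain K p (\<lambda>x. u x s)"
    using dom by (simp add: AE_lebesgue_on_iff)
  have S: "Om \<times> {0<..<T} \<in> sets (borel :: (real \<times> real) measure)"
    by (simp add: borel_prod[symmetric])
  have eq': "AE s in lborel. AE x in lborel. (x, s) \<in> Om \<times> {0<..<T} \<longrightarrow>
      v x s = - nonlocal_plap K p (\<lambda>y. u y s) x"
    using AE_lborel_snd[OF eq[unfolded AE_lebesgue_on_iff[OF S]]] by simp
  have flow: "AE s in lborel. s \<in> {0<..<T} \<longrightarrow>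
      flux_integrable Kb (phi p) (\<lambda>x. P x s) \<and>
      (AE x in lborel. vb x s = flux Kb (phi p) (\<lambda>x. P x s) x)"
    using dom' eq' AE_lborel_snd[OF vb(3)]
  proof eventually_elim
    case (elim s)
    show ?case
    proof
      assume s: "s \<in> {0<..<T}"
      then have ae: "AE x in lborel. x \<in> Om \<longrightarrow> u x s = P x s" by (intro prim) auto
      let ?F = "\<lambda>z. Kb (fst z) (snd z) * phi p (P (snd z) s - P (fst z) s)"
      have F_meas: "?F \<in> borel_measurable lborel2" by measurable
      have ae2: "AE z in lborel. z \<in> Om \<times> Om \<longrightarrow>
          (case z of (x, y) \<Rightarrow> K x y * phi p (u y s - u x s)) = ?F z"
        using Kb(5) AE_lborel_fst_lift(1)[OF ae] AE_lborel_fst_lift(2)[OF ae]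
        by eventually_elim auto
      have "integrable lborel (\<lambda>z. indicator (Om \<times> Om) z * ?F z)"
        using lebesgue_on_representative(2)[OF Om2_borel _ ae2] F_meas elim(1) s
        by (simp add: plap_domain_def lborel_prod borel_prod)
      also have "(\<lambda>z. indicator (Om \<times> Om) z * ?F z) = ?F"
        using Kb(4) by (auto simp: fun_eq_iff indicator_def)
      finally have 1: "flux_integrable Kb (phi p) (\<lambda>x. P x s)"
        by (simp only: lborel_prod case_prod_unfold)
      have "AE x in lborel. vb x s = flux Kb (phi p) (\<lambda>x. P x s) x"
        using elim(2,3) ae AE_lborel_fst[OF Kb(5)]
      proof eventually_elim
        case (elim x)
        show ?case
        proof (cases "x \<in> Om")
          case True
          have "vb x s = (\<integral>y. K x y * phi p (u y s - u x s) \<partial>OmM)"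
            using elim(1,2) True s by (simp add: nonlocal_plap_def)
          also have "\<dots> = flux Kb (phi p) (\<lambda>x. P x s) x"
          proof (rule integral_OmM_representative)
            show "AE y in lborel. y \<in> Om \<longrightarrow> K x y * phi p (u y s - u x s) = Kb x y * phi p (P y s - P x s)"
              using elim(4) ae by eventually_elim (use elim(3) True in auto)
          qed (use Kb(4) in auto)
          finally show ?thesis .
        qed (use vb(2) Kb(4) in simp)
      qed
      with 1 show "flux_integrable Kb (phi p) (\<lambda>x. P x s) \<and>
        (AE x in lborel. vb x s = flux Kb (phi p) (\<lambda>x. P x s) x)" by blast
    qed
  qed
  have g: "AE x in lborel. x \<in> Om \<longrightarrow> g x = u0 x"
    using u0(3) init unfolding AE_lebesgue_on_iff[OF Om_borel] by eventually_elim auto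
  show thesis
  proof (rule that[of u0 vb])
    show "nonlocal_flow Kb (phi p) u0 vb T"
      by unfold_locales (use Kb(2,3) phi_mono[OF p] phi_odd u0(1) vb(1) flow in \<open>auto simp: P_def\<close>)
  qed (use prim u0(2) g in \<open>auto simp: P_def\<close>)
qed

section \<open>Convergence of the projected data\<close>

lemma weight_eq_average:
  assumes ij: "i \<in> {1..n}" "j \<in> {1..n}"
    and Kb: "(\<lambda>(x, y). Kb x y) \<in> borel_measurable lborel2"
      "AE z in lborel. z \<in> Om \<times> Om \<longrightarrow> K (fst z) (snd z) = Kb (fst z) (snd z)"
  shows "weight K n i j = average (\<lambda>z. Kb (fst z) (snd z)) (cell n i \<times> cell n j)"
proof -
  have "(\<integral>z. (case z of (x, y) \<Rightarrow> K x y) \<partial>lebesgue_on (cell n i \<times> cell n j))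
      = (LBINT z. indicator (cell n i \<times> cell n j) z * Kb (fst z) (snd z))"
  proof (rule lebesgue_on_representative(3)[OF cell_Times_borel])
    show "(\<lambda>z. Kb (fst z) (snd z)) \<in> borel_measurable borel"
      using Kb(1) by (simp add: case_prod_unfold lborel_prod borel_prod)
    show "AE z in lborel. z \<in> cell n i \<times> cell n j \<longrightarrow> (case z of (x, y) \<Rightarrow> K x y) = Kb (fst z) (snd z)"
      using Kb(2)
    proof eventually_elim
      case (elim z)
      then show ?case
        using cell_subset[OF ij(1)] cell_subset[OF ij(2)] by (fastforce simp: Om_def)
    qed
  qed
  then show ?thesis
    using measure_cell_Times(2)[of i j n] ij by (simp add: weight_def average_def)
qed

lemma init_eq_average:
  assumes i: "i \<in> {1..n}" and gb: "gb \<in> borel_measurable borel"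
    "AE x in lborel. x \<in> Om \<longrightarrow> g x = gb x"
  shows "init g n i = average gb (cell n i)"
proof -
  have "(\<integral>x. g x \<partial>lebesgue_on (cell n i)) = (LBINT x. indicator (cell n i) x * gb x)"
  proof (rule lebesgue_on_representative(3)[OF cell_borel gb(1)])
    show "AE x in lborel. x \<in> cell n i \<longrightarrow> g x = gb x"
      using gb(2) by eventually_elim (use cell_subset[OF i] in \<open>auto simp: Om_def\<close>)
  qed
  then show ?thesis using measure_cell[of i n] i by (simp add: init_def average_def)
qed

lemma kernel_averages_converge:
  assumes "(\<lambda>(x, y). Kb x y) \<in> borel_measurable lborel2"
    "\<And>x y. 0 \<le> Kb x y" "\<And>x y. Kb x y \<le> 1"
    "AE z in lborel. z \<in> Om \<times> Om \<longrightarrow> K (fst z) (snd z) = Kb (fst z) (snd z)"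
  shows "(\<lambda>n. cell_L1_error Kb (weight K n) n) \<longlonglongrightarrow> 0"
proof -
  let ?f = "\<lambda>z. Kb (fst z) (snd z)"
  let ?Q = "\<lambda>n (i, j). cell n i \<times> cell n j"
  have "(\<lambda>n. \<Sum>ij\<in>{1..n} \<times> {1..n}. LBINT z. indicator (?Q n ij) z * \<bar>?f z - average ?f (?Q n ij)\<bar>) \<longlonglongrightarrow> 0"
  proof (rule averages_converge_L1[where B = 1 and D = "\<lambda>n. 2 / real n" and a = "(0, 0)" and b = "(1, 1)"])
    show "?f \<in> borel_measurable borel"
      using assms(1) by (simp add: case_prod_unfold lborel_prod borel_prod)
    show "\<bar>?f z\<bar> \<le> 1" for z using assms(2,3) by simp
    show "disjoint_family_on (?Q n) ({1..n} \<times> {1..n})" for n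
      using cell_unique by (fastforce simp: disjoint_family_on_def)
    show "?Q n ij \<in> sets borel" for n ij
      using cell_Times_borel by (simp split: prod.split)
    show "?Q n ij \<subseteq> cbox (0, 0) (1, 1)" if "ij \<in> {1..n} \<times> {1..n}" for n ij
    proof -
      obtain i j where ij: "ij = (i, j)" "i \<in> {1..n}" "j \<in> {1..n}" using \<open>ij \<in> _\<close> by auto
      show ?thesis using cell_subset[OF ij(2)] cell_subset[OF ij(3)] unfolding ij(1) cbox_Pair_eq by auto
    qed
    show "0 < measure lborel (?Q n ij)" if "ij \<in> {1..n} \<times> {1..n}" for n ij
      using that measure_cell_Times(2)[of "fst ij" "snd ij" n] by (auto simp: case_prod_unfold)
    show "dist x y \<le> 2 / real n" if "x \<in> ?Q n ij" "y \<in> ?Q n ij" for n ij x y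
    proof -
      have "\<bar>fst x - fst y\<bar> \<le> 1 / real n" "\<bar>snd x - snd y\<bar> \<le> 1 / real n"
        using that cell_diameter by (auto simp: case_prod_unfold mem_Times_iff)
      moreover have "dist x y \<le> \<bar>fst x - fst y\<bar> + \<bar>snd x - snd y\<bar>"
        unfolding dist_prod_def dist_real_def by (rule order_trans[OF sqrt_sum_squares_le_sum_abs]) simp
      ultimately show ?thesis by simp
    qed
    show "(\<lambda>n. 2 / real n) \<longlonglongrightarrow> 0" by (rule lim_const_over_n)
  qed auto
  moreover have "(\<Sum>ij\<in>{1..n} \<times> {1..n}. LBINT z. indicator (?Q n ij) z * \<bar>?f z - average ?f (?Q n ij)\<bar>)
    = (\<Sum>i=1..n. \<Sum>j=1..n. LBINT z. indicator (cell n i \<times> cell n j) z * \<bar>?f z - weight K n i j\<bar>)" for n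
    unfolding sum.cartesian_product
    by (rule sum.cong) (auto simp: weight_eq_average[OF _ _ assms(1,4)])
  ultimately show ?thesis by simp
qed

lemma initial_averages_converge:
  assumes gb: "gb \<in> borel_measurable borel" "\<And>x. \<bar>gb x\<bar> \<le> M" "\<And>x. x \<notin> Om \<Longrightarrow> gb x = 0"
    "AE x in lborel. x \<in> Om \<longrightarrow> g x = gb x"
  shows "(\<lambda>n. LBINT x. \<bar>gb x - cell_fun n (init g n) x\<bar>) \<longlonglongrightarrow> 0"
proof (rule Lim_transform_eventually)
  show "(\<lambda>n. \<Sum>i\<in>{1..n}. LBINT x. indicator (cell n i) x * \<bar>gb x - average gb (cell n i)\<bar>) \<longlonglongrightarrow> 0"
  proof (rule averages_converge_L1[where D = "\<lambda>n. 1 / real n" and a = 0 and b = 1, OF gb(1,2)])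
    show "disjoint_family_on (cell n) {1..n}" for n by (rule cell_disjoint)
    show "cell n i \<subseteq> cbox 0 1" if "i \<in> {1..n}" for n i using cell_subset[OF that] by auto
    show "0 < measure lborel (cell n i)" if "i \<in> {1..n}" for n i using that measure_cell[of i n] by auto
    show "dist x y \<le> 1 / real n" if "x \<in> cell n i" "y \<in> cell n i" for n i x y
      using cell_diameter[OF that] by (simp add: dist_real_def)
    show "(\<lambda>n. 1 / real n) \<longlonglongrightarrow> 0" by (rule lim_const_over_n)
  qed auto
  show "\<forall>\<^sub>F n in sequentially. (\<Sum>i\<in>{1..n}. LBINT x. indicator (cell n i) x * \<bar>gb x - average gb (cell n i)\<bar>)
      = (LBINT x. \<bar>gb x - cell_fun n (init g n) x\<bar>)"
    using eventually_gt_at_top[of 0]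
  proof eventually_elim
    case (elim n)
    note [measurable] = gb(1)
    have "(\<Sum>i\<in>{1..n}. LBINT x. indicator (cell n i) x * \<bar>gb x - average gb (cell n i)\<bar>)
        = (LBINT x. (\<Sum>i\<in>{1..n}. indicator (cell n i) x * \<bar>gb x - average gb (cell n i)\<bar>))"
    proof (rule Bochner_Integration.integral_sum[symmetric])
      fix i assume i: "i \<in> {1..n}"
      show "integrable lborel (\<lambda>x. indicator (cell n i) x * \<bar>gb x - average gb (cell n i)\<bar>)"
      proof (rule bounded_cut_integrable[where B = "M + \<bar>average gb (cell n i)\<bar>"])
        show "\<bar>\<bar>gb x - average gb (cell n i)\<bar>\<bar> \<le> M + \<bar>average gb (cell n i)\<bar>" for x
          using gb(2)[of x] by auto
      qed (use gb(1) i in \<open>auto simp: emeasure_cell\<close>)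
    qed
    also have "\<dots> = (LBINT x. \<bar>gb x - cell_fun n (init g n) x\<bar>)"
    proof (rule integral_cong_AE)
      show "AE x in lborel. (\<Sum>i\<in>{1..n}. indicator (cell n i) x * \<bar>gb x - average gb (cell n i)\<bar>)
          = \<bar>gb x - cell_fun n (init g n) x\<bar>"
        using AE_lborel_singleton[of 1]
      proof eventually_elim
        case (elim x)
        have s: "(\<Sum>i\<in>{1..n}. indicator (cell n i) x * \<bar>gb x - average gb (cell n i)\<bar>)
            = cell_fun n (\<lambda>i. \<bar>gb x - average gb (cell n i)\<bar>) x"
          by (simp add: cell_fun_def)
        show ?case
        proof (cases "x \<in> {0..<1}")
          case True
          then obtain i where i: "i \<in> {1..n}" "x \<in> cell n i" using cell_cover[OF \<open>0 < n\<close>] by blast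
          show ?thesis unfolding s cell_fun_cell[OF i] init_eq_average[OF i(1) gb(1,4)] ..
        next
          case False
          with elim have "x \<notin> Om" by (auto simp: Om_def)
          with False show ?thesis unfolding s by (simp add: cell_fun_outside gb(3))
        qed
      qed
    qed measurable
    finally show ?case .
  qed
qed

section \<open>Convergence of the interpolation\<close>

text \<open>
  Within a step the interpolation is a convex combination of the values at the two ends, hence inherits their bound.
\<close>

lemma segment_bounded:
  fixes x z :: real
  assumes "\<bar>x\<bar> \<le> B" "\<bar>x + \<tau> * z\<bar> \<le> B" "0 \<le> \<sigma>" "\<sigma> \<le> \<tau>"
  shows "\<bar>x + \<sigma> * z\<bar> \<le> B"
proof (cases "0 \<le> z")
  case True
  then have "0 \<le> \<sigma> * z" "\<sigma> * z \<le> \<tau> * z" using assms by (auto intro: mult_right_mono)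
  with assms(1,2) show ?thesis by (auto simp: abs_le_iff)
next
  case False
  then have "\<sigma> * z \<le> 0" "\<tau> * z \<le> \<sigma> * z"
    using assms by (auto intro: mult_right_mono_neg simp: mult_nonneg_nonpos)
  with assms(1,2) show ?thesis by (auto simp: abs_le_iff)
qed

text \<open>
  Between two nodes the error grows by at most \<open>\<rho>\<close> times the elapsed time; the increments are summed over the steps.
\<close>

lemma interpolation_L1_error:
  assumes F: "nonlocal_flow Kb (phi p) u0 vb T" and p: "1 < p" and n: "0 < n"
    and Kb: "(\<lambda>(x, y). Kb x y) \<in> borel_measurable lborel2"
      "\<And>x y. Kb x y \<le> 1" "\<And>x y. x \<notin> Om \<or> y \<notin> Om \<Longrightarrow> Kb x y = 0"
    and W: "\<And>i j. i \<in> {1..n} \<Longrightarrow> j \<in> {1..n} \<Longrightarrow> 0 \<le> weight K n i j \<and> weight K n i j \<le> 1"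
    and tp: "time_partition T N t" and U: "discrete_solution K p g n N t U"
    and B: "\<And>h i. h \<le> N \<Longrightarrow> i \<in> {1..n} \<Longrightarrow> \<bar>U h i\<bar> \<le> B" "0 \<le> B"
    and modulus: "\<And>a b. \<bar>a\<bar> \<le> 2 * B \<Longrightarrow> \<bar>b\<bar> \<le> 2 * B \<Longrightarrow> \<bar>a - b\<bar> < d \<Longrightarrow> \<bar>phi p a - phi p b\<bar> \<le> \<omega>"
    and fine: "2 * phi p (2 * B) * mesh N t < d"
    and \<rho>: "phi p (2 * B) * cell_L1_error Kb (weight K n) n + \<omega> \<le> \<rho>"
    and s: "0 \<le> s" "s \<le> T"
  shows "(LBINT x. \<bar>primitive u0 vb x s - interpolation g n N t U x s\<bar>)
    \<le> (LBINT x. \<bar>u0 x - cell_fun n (init g n) x\<bar>) + s * \<rho>"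
proof -
  interpret F: nonlocal_flow Kb "phi p" u0 vb T by (rule F)
  define C where "C = phi p (2 * B)"
  have C0: "0 \<le> C" unfolding C_def using B(2) by (simp add: phi_nonneg)
  have [measurable]: "phi p \<in> borel_measurable borel"
    by (rule borel_measurable_mono[OF phi_mono[OF p]])
  define z where "z h = discrete_slope K p n (U h)" for h
  define V where "V h \<sigma> i = U h i + \<sigma> * z h i" for h \<sigma> i
  have diff_le: "\<bar>a j - a i\<bar> \<le> 2 * B" if "\<And>i. i \<in> {1..n} \<Longrightarrow> \<bar>a i\<bar> \<le> B" "i \<in> {1..n}" "j \<in> {1..n}"
    for a :: "nat \<Rightarrow> real" and i j
    using that(1)[OF that(2)] that(1)[OF that(3)] by linarith
  have growth: "(LBINT x. \<bar>F.U x r - cell_fun n (V (h - 1) (r - t (h - 1))) x\<bar>)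
      \<le> (LBINT x. \<bar>F.U x (t (h - 1)) - cell_fun n (U (h - 1)) x\<bar>) + (r - t (h - 1)) * \<rho>"
    if h: "h \<in> {1..N}" and r: "t (h - 1) \<le> r" "r \<le> t h" for h r
  proof -
    have hN: "h - 1 \<le> N" "h \<le> N" using h by auto
    have z_le: "\<bar>z (h - 1) i\<bar> \<le> C" if "i \<in> {1..n}" for i
      unfolding z_def
    proof (rule discrete_slope_abs_le[OF n W[OF that] C0])
      fix j assume "j \<in> {1..n}"
      then show "\<bar>phi p (U (h - 1) j - U (h - 1) i)\<bar> \<le> C"
        unfolding C_def using that B(1)[OF hN(1)] by (intro phi_abs_le[OF p] diff_le)
    qed
    have V_le: "\<bar>V (h - 1) \<sigma> i\<bar> \<le> B" if "0 \<le> \<sigma>" "\<sigma> \<le> t h - t (h - 1)" "i \<in> {1..n}" for \<sigma> i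
      unfolding V_def
    proof (rule segment_bounded[OF B(1)[OF hN(1) that(3)] _ that(1,2)])
      show "\<bar>U (h - 1) i + (t h - t (h - 1)) * z (h - 1) i\<bar> \<le> B"
        using B(1)[OF hN(2) that(3)] discrete_solution_step[OF tp U h that(3)] by (simp add: z_def)
    qed
    have residual: "flux_integrable Kb (phi p) (cell_fun n (V (h - 1) \<sigma>))"
        "(LBINT x. \<bar>flux Kb (phi p) (cell_fun n (V (h - 1) \<sigma>)) x
          - cell_fun n (z (h - 1)) x\<bar>) \<le> \<rho>"
      if \<sigma>: "0 \<le> \<sigma>" "\<sigma> \<le> t h - t (h - 1)" for \<sigma>
    proof -
      have VC: "\<bar>phi p (V (h - 1) \<sigma> j - V (h - 1) \<sigma> i)\<bar> \<le> C" if "i \<in> {1..n}" "j \<in> {1..n}" for i j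
        unfolding C_def by (intro phi_abs_le[OF p] diff_le V_le \<sigma> that)
      have V\<omega>: "\<bar>phi p (V (h - 1) \<sigma> j - V (h - 1) \<sigma> i) - phi p (U (h - 1) j - U (h - 1) i)\<bar> \<le> \<omega>"
        if ij: "i \<in> {1..n}" "j \<in> {1..n}" for i j
      proof (rule modulus)
        show "\<bar>V (h - 1) \<sigma> j - V (h - 1) \<sigma> i\<bar> \<le> 2 * B" by (intro diff_le V_le \<sigma> ij)
        show "\<bar>U (h - 1) j - U (h - 1) i\<bar> \<le> 2 * B" by (intro diff_le B(1)[OF hN(1)] ij)
        have "\<bar>(V (h - 1) \<sigma> j - V (h - 1) \<sigma> i) - (U (h - 1) j - U (h - 1) i)\<bar>
            = \<sigma> * \<bar>z (h - 1) j - z (h - 1) i\<bar>"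
          using \<sigma>(1) by (simp add: V_def right_diff_distrib[symmetric] abs_mult)
        also have "\<dots> \<le> mesh N t * (2 * C)"
        proof (rule mult_mono)
          show "\<sigma> \<le> mesh N t"
            using \<sigma>(2) step_le_mesh[OF h, of t] partition_step(2)[OF tp h] by linarith
          then show "0 \<le> mesh N t" using \<sigma>(1) by linarith
          show "\<bar>z (h - 1) j - z (h - 1) i\<bar> \<le> 2 * C"
            using z_le[OF ij(1)] z_le[OF ij(2)] by linarith
        qed simp
        also have "\<dots> < d" using fine by (simp add: C_def mult_ac)
        finally show "\<bar>(V (h - 1) \<sigma> j - V (h - 1) \<sigma> i) - (U (h - 1) j - U (h - 1) i)\<bar> < d" .
      qed
      have zz: "z (h - 1) i = 1 / real n * (\<Sum>j=1..n. weight K n i j * phi p (U (h - 1) j - U (h - 1) i))" for i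
        by (simp add: z_def discrete_slope_def)
      note res = cell_residual[OF n Kb(1) F.K_nonneg Kb(2,3) _ W VC V\<omega> zz]
      show "flux_integrable Kb (phi p) (cell_fun n (V (h - 1) \<sigma>))"
        by (rule res(1)) auto
      have "(LBINT x. \<bar>flux Kb (phi p) (cell_fun n (V (h - 1) \<sigma>)) x
          - cell_fun n (z (h - 1)) x\<bar>)
        \<le> C * cell_L1_error Kb (weight K n) n + \<omega>"
        by (rule res(2)) auto
      also have "\<dots> \<le> \<rho>" using \<rho> by (simp add: C_def)
      finally show "(LBINT x. \<bar>flux Kb (phi p) (cell_fun n (V (h - 1) \<sigma>)) x
          - cell_fun n (z (h - 1)) x\<bar>) \<le> \<rho>" .
    qed
    have V_cell: "cell_fun n (V (h - 1) \<sigma>) x = cell_fun n (U (h - 1)) x + \<sigma> * cell_fun n (z (h - 1)) x" for \<sigma> x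
      unfolding V_def by (rule cell_fun_linear)
    show ?thesis
      unfolding V_cell
    proof (rule F.L1_growth)
      show "0 \<le> t (h - 1)" by (rule partition_range(1)[OF tp hN(1)])
      show "r \<le> T" using r(2) partition_range(2)[OF tp hN(2)] by simp
    next
      fix \<sigma> assume "\<sigma> \<in> {t (h - 1)<..<r}"
      then have "0 \<le> \<sigma> - t (h - 1)" "\<sigma> - t (h - 1) \<le> t h - t (h - 1)" using r by auto
      note residual[OF this, unfolded V_cell]
      then show "flux_integrable Kb (phi p) (\<lambda>x. cell_fun n (U (h - 1)) x + (\<sigma> - t (h - 1)) * cell_fun n (z (h - 1)) x)"
        and "(LBINT x. \<bar>flux Kb (phi p) (\<lambda>x. cell_fun n (U (h - 1)) x + (\<sigma> - t (h - 1)) * cell_fun n (z (h - 1)) x) x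
            - cell_fun n (z (h - 1)) x\<bar>) \<le> \<rho>" .
    qed (use r cell_fun_integrable in auto)
  qed
  let ?E0 = "\<integral>x. \<bar>u0 x - cell_fun n (init g n) x\<bar> \<partial>lborel"
  have init_eq: "cell_fun n (U 0) x = cell_fun n (init g n) x" for x
    by (rule cell_fun_cong) (use U in \<open>auto simp: discrete_solution_def\<close>)
  have nodes: "(LBINT x. \<bar>F.U x (t h) - cell_fun n (U h) x\<bar>) \<le> ?E0 + t h * \<rho>" if "h \<le> N" for h
    using that
  proof (induction h)
    case 0
    then show ?case using tp by (simp add: time_partition_def primitive_0 init_eq)
  next
    case (Suc h)
    have h: "Suc h \<in> {1..N}" using Suc.prems by auto
    have "cell_fun n (V h (t (Suc h) - t h)) x = cell_fun n (U (Suc h)) x" for x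
      by (rule cell_fun_cong) (use discrete_solution_step[OF tp U h] in \<open>simp add: V_def z_def\<close>)
    then have "(LBINT x. \<bar>F.U x (t (Suc h)) - cell_fun n (U (Suc h)) x\<bar>)
        \<le> (LBINT x. \<bar>F.U x (t h) - cell_fun n (U h) x\<bar>) + (t (Suc h) - t h) * \<rho>"
      using growth[OF h, of "t (Suc h)"] partition_step(1)[OF tp h] by simp
    then show ?case using Suc by (simp add: algebra_simps)
  qed
  show ?thesis
  proof (cases "s = 0")
    case True
    then show ?thesis by (simp add: primitive_0 interpolation_initial[OF U] init_eq)
  next
    case False
    then obtain h where h: "h \<in> {1..N}" "s \<in> {t (h - 1)<..t h}"
      using partition_locate[OF tp, of s] s by auto
    have "interpolation g n N t U x s = cell_fun n (V (h - 1) (s - t (h - 1))) x" for x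
      unfolding interpolation_step[OF tp U h] V_def z_def ..
    then have "(LBINT x. \<bar>F.U x s - interpolation g n N t U x s\<bar>)
        \<le> (LBINT x. \<bar>F.U x (t (h - 1)) - cell_fun n (U (h - 1)) x\<bar>) + (s - t (h - 1)) * \<rho>"
      using growth[OF h(1), of s] h(2) by simp
    also have "\<dots> \<le> ?E0 + t (h - 1) * \<rho> + (s - t (h - 1)) * \<rho>"
      using nodes[of "h - 1"] h(1) by auto
    also have "\<dots> = ?E0 + s * \<rho>" by (simp add: algebra_simps)
    finally show ?thesis .
  qed
qed

text \<open>
  Interpolation between \<open>L\<^sup>1\<close> and \<open>L\<^sup>\<infinity>\<close>: \<open>|e|\<^sup>p \<le> R\<^sup>p\<^sup>-\<^sup>1 |e|\<close>.
\<close>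

lemma Lp_norm_le_of_L1:
  assumes p: "1 < p" and R: "0 < R" and c: "0 < c"
    and f: "AE x in lborel. x \<in> Om \<longrightarrow> f x = e x"
    and e: "integrable lborel e" "AE x in lborel. \<bar>e x\<bar> \<le> R"
    and le: "R powr (p - 1) * (LBINT x. \<bar>e x\<bar>) \<le> c powr p"
  shows "Lp_norm p f \<le> ennreal c"
proof -
  define I where "I = (\<integral>\<^sup>+x. ennreal (\<bar>f x\<bar> powr p) \<partial>OmM)"
  have "I = (\<integral>\<^sup>+x. ennreal (\<bar>f x\<bar> powr p) * indicator Om x \<partial>lborel)"
    unfolding I_def by (subst nn_integral_restrict_space) (auto simp: nn_integral_completion)
  also have "\<dots> \<le> (\<integral>\<^sup>+x. ennreal (R powr (p - 1) * \<bar>e x\<bar>) \<partial>lborel)"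
  proof (rule nn_integral_mono_AE)
    show "AE x in lborel. ennreal (\<bar>f x\<bar> powr p) * indicator Om x \<le> ennreal (R powr (p - 1) * \<bar>e x\<bar>)"
      using f e(2)
    proof eventually_elim
      case (elim x)
      have "\<bar>e x\<bar> powr p = \<bar>e x\<bar> powr (p - 1) * \<bar>e x\<bar>"
        using powr_mult_base[of "\<bar>e x\<bar>" "p - 1"] by (simp add: mult.commute)
      also have "\<dots> \<le> R powr (p - 1) * \<bar>e x\<bar>"
        using elim p by (intro mult_right_mono powr_mono2) auto
      finally show ?case
        using elim by (auto simp: indicator_def intro: ennreal_leI)
    qed
  qed
  also have "\<dots> = ennreal (R powr (p - 1) * (LBINT x. \<bar>e x\<bar>))"
    by (subst nn_integral_eq_integral) (use e(1) in auto)
  also have "\<dots> \<le> ennreal (c powr p)" by (rule ennreal_leI[OF le])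
  finally have I: "I \<le> ennreal (c powr p)" .
  then have fin: "I \<noteq> \<infinity>" by (auto simp: top_unique)
  have "enn2real I \<le> c powr p" using enn2real_mono[OF I] by simp
  then have "enn2real I powr (1 / p) \<le> (c powr p) powr (1 / p)"
    using p by (intro powr_mono2) auto
  also have "\<dots> = c" using p c by (simp add: powr_powr)
  finally show ?thesis
    using fin by (simp add: Lp_norm_def I_def[symmetric] Let_def ennreal_leI)
qed

theorem corollary6p2:
  fixes T p :: real
    and K :: "real \<Rightarrow> real \<Rightarrow> real"
    and g :: "real \<Rightarrow> real"
    and u :: "real \<Rightarrow> real \<Rightarrow> real"
  assumes "T > 0"
    and "p > 1"
    and "symmetric_kernel K"
    and "Linfty g"
    and "is_solution K p g T u"
  shows "\<forall>\<epsilon>>0. \<exists>n0\<ge>1. \<exists>\<delta>>0. \<forall>n\<ge>n0. \<forall>(N::nat) (t::nat \<Rightarrow> real) (U::nat \<Rightarrow> nat \<Rightarrow> real).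
           time_partition T N t \<longrightarrow> mesh N t < \<delta> \<longrightarrow> discrete_solution K p g n N t U \<longrightarrow>
           CLp_norm T p (\<lambda>x s. u x s - interpolation g n N t U x s) < ennreal \<epsilon>"
proof (intro allI impI)
  fix \<epsilon> :: real assume \<epsilon>: "0 < \<epsilon>"
  note T = \<open>T > 0\<close> and p = \<open>p > 1\<close>
  obtain Kb where Kb: "(\<lambda>(x, y). Kb x y) \<in> borel_measurable lborel2"
    "\<And>x y. 0 \<le> Kb x y" "\<And>x y. Kb x y \<le> 1" "\<And>x y. Kb x y = Kb y x"
    "\<And>x y. x \<notin> Om \<or> y \<notin> Om \<Longrightarrow> Kb x y = 0"
    "AE z in lborel. z \<in> Om \<times> Om \<longrightarrow> K (fst z) (snd z) = Kb (fst z) (snd z)"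
    by (rule kernel_representative[OF \<open>symmetric_kernel K\<close>]) (rule that)
  obtain u0 vb where F: "nonlocal_flow Kb (phi p) u0 vb T"
    and prim: "\<And>s. s \<in> {0..T} \<Longrightarrow> AE x in lborel. x \<in> Om \<longrightarrow> u x s = primitive u0 vb x s"
    and u0: "\<And>x. x \<notin> Om \<Longrightarrow> u0 x = 0" "AE x in lborel. x \<in> Om \<longrightarrow> g x = u0 x"
    by (rule solution_representative[OF T p \<open>is_solution K p g T u\<close> Kb(1,2,4) _ Kb(6)])
      (use Kb(5) in blast, rule that)
  interpret F: nonlocal_flow Kb "phi p" u0 vb T by (rule F)
  obtain M0 where "AE x in OmM. \<bar>g x\<bar> \<le> M0" using \<open>Linfty g\<close> by (auto simp: Linfty_def)
  define M where "M = \<bar>M0\<bar>"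
  have M: "0 \<le> M" "AE x in lborel. x \<in> Om \<longrightarrow> \<bar>g x\<bar> \<le> M"
  proof -
    have "AE x in lborel. x \<in> Om \<longrightarrow> \<bar>g x\<bar> \<le> M0"
      using \<open>AE x in OmM. \<bar>g x\<bar> \<le> M0\<close> by (simp add: AE_lebesgue_on_iff)
    then show "AE x in lborel. x \<in> Om \<longrightarrow> \<bar>g x\<bar> \<le> M"
      by eventually_elim (auto simp: M_def)
  qed (simp add: M_def)
  define gb where "gb x = max (- M) (min M (u0 x))" for x
  have u0_M: "AE x in lborel. \<bar>u0 x\<bar> \<le> M"
    using u0(2) M(2)
  proof eventually_elim
    case (elim x)
    then show ?case using u0(1)[of x] M(1) by (cases "x \<in> Om") auto
  qed
  have u0_gb: "AE x in lborel. u0 x = gb x"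
    using u0_M by eventually_elim (auto simp: gb_def)
  have gb: "gb \<in> borel_measurable borel" "\<And>x. \<bar>gb x\<bar> \<le> M" "\<And>x. x \<notin> Om \<Longrightarrow> gb x = 0"
    "AE x in lborel. x \<in> Om \<longrightarrow> g x = gb x"
  proof -
    have [measurable]: "u0 \<in> borel_measurable borel" using F.u0_int by auto
    show "gb \<in> borel_measurable borel" unfolding gb_def by measurable
    show "AE x in lborel. x \<in> Om \<longrightarrow> g x = gb x"
      using u0(2) u0_gb by eventually_elim auto
  qed (use M(1) u0(1) in \<open>auto simp: gb_def\<close>)
  have W: "0 \<le> weight K n i j \<and> weight K n i j \<le> 1"
    if "0 < n" "i \<in> {1..n}" "j \<in> {1..n}" for n i j
  proof -
    have "(\<lambda>z. Kb (fst z) (snd z)) \<in> borel_measurable borel"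
      using Kb(1) by (simp add: case_prod_unfold lborel_prod borel_prod)
    from average_bounds[OF this, of 0 1 "cell n i \<times> cell n j"] show ?thesis
      using that Kb(2,3) cell_Times_borel[of n i j] measure_cell_Times[of i j n]
      by (simp add: weight_eq_average[OF that(2,3) Kb(1,6)])
  qed
  have I: "\<bar>init g n i\<bar> \<le> M" if "0 < n" "i \<in> {1..n}" for n i
  proof -
    have "- M \<le> gb x \<and> gb x \<le> M" for x using gb(2)[of x] by (simp add: abs_le_iff)
    from average_bounds[OF gb(1) this, of "cell n i"] show ?thesis
      using that emeasure_cell[of i n] measure_cell[of i n]
      by (simp add: init_eq_average[OF that(2) gb(1,4)] abs_le_iff)
  qed
  obtain B \<delta>0 where B: "M \<le> B" "0 < \<delta>0"
    "\<And>n N t U h i. 0 < n \<Longrightarrow> time_partition T N t \<Longrightarrow> mesh N t < \<delta>0 \<Longrightarrow> discrete_solution K p g n N t U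
      \<Longrightarrow> h \<le> N \<Longrightarrow> i \<in> {1..n} \<Longrightarrow> \<bar>U h i\<bar> \<le> B"
    by (rule discrete_solutions_bounded[where K = K and g = g and T = T, OF p M(1)])
      (rule W, assumption+, rule I, assumption+, rule that)
  have B0: "0 \<le> B" using M(1) B(1) by simp
  define C where "C = phi p (2 * B)"
  have C0: "0 \<le> C" unfolding C_def using B0 by (simp add: phi_nonneg)
  define R where "R = 2 * B + 1"
  have R0: "0 < R" using B0 by (simp add: R_def)
  \<comment> \<open>\<open>\<eta>\<close> is the \<open>L\<^sup>1\<close> error that yields an \<open>L\<^sup>p\<close> error of \<open>\<epsilon> / 2\<close>. Half of it is reserved for the initial data; the two parts of the residual may each reach \<open>\<omega>\<close>, which over the time \<open>T\<close> makes up the other half.\<close>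
  define \<eta> where "\<eta> = (\<epsilon> / 2) powr p / R powr (p - 1)"
  have \<eta>: "0 < \<eta>" "R powr (p - 1) * \<eta> = (\<epsilon> / 2) powr p"
    using \<epsilon> R0 by (auto simp: \<eta>_def)
  define \<omega> where "\<omega> = \<eta> / (4 * T)"
  have \<omega>: "0 < \<omega>" using \<eta>(1) T by (simp add: \<omega>_def)
  have "uniformly_continuous_on {- (2 * B)..2 * B} (phi p)"
    by (rule compact_uniformly_continuous)
      (use phi_continuous[OF p] continuous_on_subset in auto)
  then obtain d where d: "0 < d" "\<And>a b. \<bar>a\<bar> \<le> 2 * B \<Longrightarrow> \<bar>b\<bar> \<le> 2 * B \<Longrightarrow> \<bar>a - b\<bar> < d \<Longrightarrow> \<bar>phi p a - phi p b\<bar> \<le> \<omega>"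
    using \<omega> unfolding uniformly_continuous_on_def dist_real_def
    by (metis abs_le_iff atLeastAtMost_iff less_imp_le minus_le_iff)
  \<comment> \<open>Differences of cell values move by at most \<open>2 C\<close> times the step; adding \<open>1\<close> avoids division by \<open>0\<close>.\<close>
  define \<delta> where "\<delta> = min \<delta>0 (d / (2 * C + 1))"
  have \<delta>: "0 < \<delta>" using B(2) d(1) C0 by (simp add: \<delta>_def)
  let ?E = "\<lambda>n. \<integral>x. \<bar>gb x - cell_fun n (init g n) x\<bar> \<partial>lborel"
  let ?S = "\<lambda>n. cell_L1_error Kb (weight K n) n"
  have "(\<lambda>n. C * ?S n) \<longlonglongrightarrow> C * 0"
    by (intro tendsto_mult tendsto_const kernel_averages_converge[OF Kb(1,2,3,6)])
  then have "\<forall>\<^sub>F n in sequentially. C * ?S n < \<omega> \<and> ?E n < \<eta> / 2"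
    using \<omega> \<eta>(1) initial_averages_converge[OF gb]
    by (intro eventually_conj order_tendstoD(2)[where y = "C * 0"] order_tendstoD(2)[where y = 0]) auto
  then obtain n1 where n1: "\<And>n. n1 \<le> n \<Longrightarrow> C * ?S n < \<omega> \<and> ?E n < \<eta> / 2"
    by (auto simp: eventually_sequentially)
  show "\<exists>n0\<ge>1. \<exists>\<delta>>0. \<forall>n\<ge>n0. \<forall>(N::nat) (t::nat \<Rightarrow> real) (U::nat \<Rightarrow> nat \<Rightarrow> real).
           time_partition T N t \<longrightarrow> mesh N t < \<delta> \<longrightarrow> discrete_solution K p g n N t U \<longrightarrow>
           CLp_norm T p (\<lambda>x s. u x s - interpolation g n N t U x s) < ennreal \<epsilon>"
  proof (rule exI[of _ "max 1 n1"], rule conjI, simp, rule exI[of _ \<delta>], rule conjI, rule \<delta>, intro allI impI)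
    fix n N t U
    assume n: "max 1 n1 \<le> n" and tp: "time_partition T N t" and mesh: "mesh N t < \<delta>"
      and U: "discrete_solution K p g n N t U"
    have n0: "0 < n" using n by simp
    have mesh0: "mesh N t < \<delta>0" using mesh by (simp add: \<delta>_def)
    note UB = B(3)[OF n0 tp mesh0 U]
    have "0 \<le> mesh N t"
    proof -
      have "N \<noteq> 0" using tp T by (metis less_irrefl time_partition_def)
      then have "1 \<in> {1..N}" by auto
      from step_le_mesh[OF this, of t] show ?thesis by (simp add: step_def)
    qed
    moreover have "mesh N t < d / (2 * C + 1)" using mesh by (simp add: \<delta>_def)
    ultimately have fine: "2 * phi p (2 * B) * mesh N t < d"
      using C0 unfolding C_def[symmetric] by (simp add: field_simps)
    have S: "phi p (2 * B) * ?S n + \<omega> \<le> 2 * \<omega>"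
      using n1[of n] n unfolding C_def by simp
    have E: "(LBINT x. \<bar>u0 x - cell_fun n (init g n) x\<bar>) < \<eta> / 2"
    proof -
      have "(LBINT x. \<bar>u0 x - cell_fun n (init g n) x\<bar>) = ?E n"
      proof (rule integral_cong_AE)
        show "AE x in lborel. \<bar>u0 x - cell_fun n (init g n) x\<bar> = \<bar>gb x - cell_fun n (init g n) x\<bar>"
          using u0_gb by eventually_elim simp
      qed (use gb(1) F.u0_int in auto)
      then show ?thesis using n1[of n] n by simp
    qed
    have "Lp_norm p (\<lambda>x. u x s - interpolation g n N t U x s) \<le> ennreal (\<epsilon> / 2)" if s: "s \<in> {0..T}" for s
    proof (rule Lp_norm_le_of_L1[OF p R0])
      let ?e = "\<lambda>x. primitive u0 vb x s - interpolation g n N t U x s"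
      show "0 < \<epsilon> / 2" using \<epsilon> by simp
      show "AE x in lborel. x \<in> Om \<longrightarrow> u x s - interpolation g n N t U x s = ?e x"
        using prim[OF s] by eventually_elim auto
      obtain c where c: "\<And>x. interpolation g n N t U x s = cell_fun n c x" "\<And>i. i \<in> {1..n} \<Longrightarrow> \<bar>c i\<bar> \<le> B"
      proof (cases "s = 0")
        case True
        show ?thesis
          by (rule that[of "U 0"]) (use True interpolation_initial[OF U] UB[of 0] in auto)
      next
        case False
        then obtain h where h: "h \<in> {1..N}" "s \<in> {t (h - 1)<..t h}"
          using partition_locate[OF tp, of s] s by auto
        have hN: "h - 1 \<le> N" "h \<le> N" using h by auto
        show ?thesis
        proof (rule that[OF interpolation_step[OF tp U h]])
          fix i assume i: "i \<in> {1..n}"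
          show "\<bar>U (h - 1) i + (s - t (h - 1)) * discrete_slope K p n (U (h - 1)) i\<bar> \<le> B"
          proof (rule segment_bounded[where \<tau> = "t h - t (h - 1)"])
            show "\<bar>U (h - 1) i + (t h - t (h - 1)) * discrete_slope K p n (U (h - 1)) i\<bar> \<le> B"
              using UB[OF hN(2) i] discrete_solution_step[OF tp U h(1) i] by simp
          qed (use UB[OF hN(1) i] h in auto)
        qed
      qed
      show "integrable lborel ?e"
        unfolding c(1) by (intro Bochner_Integration.integrable_diff F.U_integrable cell_fun_integrable)
      have "AE x in lborel. \<bar>primitive u0 vb x s\<bar> \<le> M"
        by (rule F.maximum_principle[OF M(1) u0_M]) (use s in auto)
      then show "AE x in lborel. \<bar>?e x\<bar> \<le> R"
      proof eventually_elim
        case (elim x)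
        moreover have "\<bar>cell_fun n c x\<bar> \<le> B" by (rule cell_fun_bounded[OF c(2) B0])
        ultimately show ?case using B(1) by (simp add: c(1) R_def)
      qed
      have "(LBINT x. \<bar>?e x\<bar>) \<le> (LBINT x. \<bar>u0 x - cell_fun n (init g n) x\<bar>) + s * (2 * \<omega>)"
        by (rule interpolation_L1_error[OF F p n0 Kb(1,3,5) W[OF n0] tp U UB B0 d(2) fine S])
          (use s in auto)
      also have "\<dots> \<le> \<eta> / 2 + T * (2 * \<omega>)"
        using E s \<omega> by (intro add_mono mult_right_mono) auto
      also have "\<dots> = \<eta>" using T by (simp add: \<omega>_def field_simps)
      finally have "R powr (p - 1) * (LBINT x. \<bar>?e x\<bar>) \<le> R powr (p - 1) * \<eta>"
        by (intro mult_left_mono) auto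
      then show "R powr (p - 1) * (LBINT x. \<bar>?e x\<bar>) \<le> (\<epsilon> / 2) powr p"
        using \<eta>(2) by simp
    qed
    then have "CLp_norm T p (\<lambda>x s. u x s - interpolation g n N t U x s) \<le> ennreal (\<epsilon> / 2)"
      unfolding CLp_norm_def by (rule SUP_least)
    also have "\<dots> < ennreal \<epsilon>" using \<epsilon> by (simp add: ennreal_less_iff)
    finally show "CLp_norm T p (\<lambda>x s. u x s - interpolation g n N t U x s) < ennreal \<epsilon>" .
  qed
qed

end
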